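(* Let $\Bbbk$ be a field of characteristic zero, let $U(3)$ and $M_{(0,\Delta)}$ be as defined below, and let $0\neq\Delta\in\Bbbk$. Then $H^n(U(3),M_{(0,\Delta)})=0$ for all $n\ge 3$.
   Context: A conformal algebra over $\Bbbk$ is a $\Bbbk[\partial]$-module $C$ with a bilinear $\lambda$-product $(a\,{}_{\lambda}\,b)=\sum_{n\ge0}\frac{\lambda^n}{n!}(a\,{}_{(n)}\,b)\in C[\lambda]$ satisfying $(\partial a\,{}_\lambda\, b)=-\lambda(a\,{}_\lambda\, b)$ and $(a\,{}_\lambda\,\partial b)=(\partial+\lambda)(a\,{}_\lambda\, b)$; it is associative if $a\,{}_\lambda(b\,{}_\mu c)=(a\,{}_\lambda b)\,{}_{\lambda+\mu} c$. $U(3)$ is the associative conformal algebra generated by one element $v$ subject to $v\,{}_{(n)}\,v=0$ for $n\ge 3$ and $2\,v\,{}_{(1)}\,v-\partial(v\,{}_{(2)}\,v)=2v$. A left conformal module over an associative conformal algebra $C$ is a $\Bbbk[\partial]$-module $M$ with a bilinear map $a\otimes m\mapsto a\,{}_\lambda m\in M[\lambda]$ satisfying $(\partial a)\,{}_\lambda m=-\lambda(a\,{}_\lambda m)$, $a\,{}_\lambda\,\partial m=(\partial+\lambda)(a\,{}_\lambda m)$, $a\,{}_\lambda(b\,{}_\mu m)=(a\,{}_\lambda b)\,{}_{\lambda+\mu}m$. $M_{(0,\Delta)}=\Bbbk[\partial]u$ with $v\,{}_\lambda\, u=(\partial+\Delta\lambda)u$, a conformal $U(3)$-module. Hochschild cohomology: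 the basic complex $\tilde C^n(C,M)$ ($n\ge1$) consists of maps $\varphi_{\bar\lambda}:C^{\otimes n}\to M[\lambda_1,\dots,\lambda_n]$ with $\varphi_{\bar\lambda}(a_1,\dots,\partial a_i,\dots,a_n)=-\lambda_i\varphi_{\bar\lambda}(a_1,\dots,a_n)$, $\tilde C^0=M$, with differential $(d\varphi)_{\bar\lambda}(a_1,\dots,a_{n+1})=a_1\,{}_{\lambda_1}\varphi_{(\lambda_2,\dots,\lambda_{n+1})}(a_2,\dots,a_{n+1})+\sum_{i=1}^n(-1)^i\varphi_{(\lambda_1,\dots,\lambda_i+\lambda_{i+1},\dots,\lambda_{n+1})}(a_1,\dots,a_i\,{}_{\lambda_i}a_{i+1},\dots,a_{n+1})$ (for $n=0$: $(dm)_\lambda(a)=a\,{}_\lambda m$). $\partial$ acts on $\tilde C^n$ by $(\partial\varphi)_{\bar\lambda}=(\partial+\sum_i\lambda_i)\varphi_{\bar\lambda}$, commuting with $d$; $H^n(C,M)$ is the cohomology of the reduced complex $\tilde C^\bullet(C,M)/\partial\tilde C^\bullet(C,M)$. *)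

theory Defs
  imports Complex_Main
begin

text \<open>Over a field of characteristic zero (hence infinite) a polynomial in the variables
  x_i (i in V) is the same thing as the polynomial function it induces.  Points are
  maps nat => k; by convention variable 0 is the derivation and variable i (i >= 1)
  is the formal parameter lambda_i.\<close>

inductive_set polyfun :: "nat set \<Rightarrow> ((nat \<Rightarrow> 'k::comm_ring_1) \<Rightarrow> 'k) set"
  for V :: "nat set" where
  pf_const: "(\<lambda>x. c) \<in> polyfun V"
| pf_var: "i \<in> V \<Longrightarrow> (\<lambda>x. x i) \<in> polyfun V"
| pf_add: "p \<in> polyfun V \<Longrightarrow> q \<in> polyfun V \<Longrightarrow> (\<lambda>x. p x + q x) \<in> polyfun V"
| pf_mult: "p \<in> polyfun V \<Longrightarrow> q \<in> polyfun V \<Longrightarrow> (\<lambda>x. p x * q x) \<in> polyfun V"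

text \<open>A conformal algebra structure on the k-vector space (UNIV, +, scale): the derivation
  D and the n-products nprod n a b = a_(n) b.  The lambda-product is
  (a_lambda b) = sum_n lambda^n/n! a_(n) b, evaluated at lambda = l.\<close>

definition lprod :: "('k::field_char_0 \<Rightarrow> 'c::ab_group_add \<Rightarrow> 'c) \<Rightarrow> (nat \<Rightarrow> 'c \<Rightarrow> 'c \<Rightarrow> 'c)
    \<Rightarrow> 'c \<Rightarrow> 'c \<Rightarrow> 'k \<Rightarrow> 'c" where
  "lprod scale nprod a b l =
     (\<Sum>n\<in>{n. nprod n a b \<noteq> 0}. scale (l ^ n / fact n) (nprod n a b))"

definition assoc_conformal_algebra ::
  "('k::field_char_0 \<Rightarrow> 'c::ab_group_add \<Rightarrow> 'c) \<Rightarrow> ('c \<Rightarrow> 'c) \<Rightarrow> (nat \<Rightarrow> 'c \<Rightarrow> 'c \<Rightarrow> 'c) \<Rightarrow> bool" where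
  "assoc_conformal_algebra scale D nprod \<longleftrightarrow>
     vector_space scale \<and>
     Vector_Spaces.linear scale scale D \<and>
     (\<forall>n a. Vector_Spaces.linear scale scale (nprod n a)) \<and>
     (\<forall>n b. Vector_Spaces.linear scale scale (\<lambda>a. nprod n a b)) \<and>
     (\<forall>a b. finite {n. nprod n a b \<noteq> 0}) \<and>
     (\<forall>a b l. lprod scale nprod (D a) b l = scale (- l) (lprod scale nprod a b l)) \<and>
     (\<forall>a b l. lprod scale nprod a (D b) l = D (lprod scale nprod a b l) + scale l (lprod scale nprod a b l)) \<and>
     (\<forall>a b c l m. lprod scale nprod a (lprod scale nprod b c m) l
                 = lprod scale nprod (lprod scale nprod a b l) c (l + m))"

definition U3_relations ::
  "('k::field_char_0 \<Rightarrow> 'c::ab_group_add \<Rightarrow> 'c) \<Rightarrow> ('c \<Rightarrow> 'c) \<Rightarrow> (nat \<Rightarrow> 'c \<Rightarrow> 'c \<Rightarrow> 'c) \<Rightarrow> 'c \<Rightarrow> bool" where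
  "U3_relations scale D nprod v \<longleftrightarrow>
     (\<forall>n\<ge>3. nprod n v v = 0) \<and>
     scale 2 (nprod 1 v v) - D (nprod 2 v v) = scale 2 v"

inductive_set generated ::
  "('k::field_char_0 \<Rightarrow> 'c::ab_group_add \<Rightarrow> 'c) \<Rightarrow> ('c \<Rightarrow> 'c) \<Rightarrow> (nat \<Rightarrow> 'c \<Rightarrow> 'c \<Rightarrow> 'c) \<Rightarrow> 'c \<Rightarrow> 'c set"
  for scale D nprod v where
  gen_base: "v \<in> generated scale D nprod v"
| gen_add: "a \<in> generated scale D nprod v \<Longrightarrow> b \<in> generated scale D nprod v \<Longrightarrow>
    a + b \<in> generated scale D nprod v"
| gen_scale: "a \<in> generated scale D nprod v \<Longrightarrow> scale c a \<in> generated scale D nprod v"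
| gen_D: "a \<in> generated scale D nprod v \<Longrightarrow> D a \<in> generated scale D nprod v"
| gen_prod: "a \<in> generated scale D nprod v \<Longrightarrow> b \<in> generated scale D nprod v \<Longrightarrow>
    nprod n a b \<in> generated scale D nprod v"

definition conformal_hom ::
  "('k::field_char_0 \<Rightarrow> 'c::ab_group_add \<Rightarrow> 'c) \<Rightarrow> ('c \<Rightarrow> 'c) \<Rightarrow> (nat \<Rightarrow> 'c \<Rightarrow> 'c \<Rightarrow> 'c)
   \<Rightarrow> ('c \<Rightarrow> 'c) \<Rightarrow> (nat \<Rightarrow> 'c \<Rightarrow> 'c \<Rightarrow> 'c) \<Rightarrow> ('c \<Rightarrow> 'c) \<Rightarrow> bool" where
  "conformal_hom scale D nprod D' nprod' h \<longleftrightarrow>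
     Vector_Spaces.linear scale scale h \<and>
     (\<forall>a. h (D a) = D' (h a)) \<and>
     (\<forall>n a b. h (nprod n a b) = nprod' n (h a) (h b))"

definition is_U3 ::
  "('k::field_char_0 \<Rightarrow> 'c::ab_group_add \<Rightarrow> 'c) \<Rightarrow> ('c \<Rightarrow> 'c) \<Rightarrow> (nat \<Rightarrow> 'c \<Rightarrow> 'c \<Rightarrow> 'c) \<Rightarrow> 'c \<Rightarrow> bool" where
  "is_U3 scale D nprod v \<longleftrightarrow>
     assoc_conformal_algebra scale D nprod \<and>
     U3_relations scale D nprod v \<and>
     generated scale D nprod v = UNIV \<and>
     (\<forall>D' nprod' w. assoc_conformal_algebra scale D' nprod' \<and> U3_relations scale D' nprod' w
        \<longrightarrow> (\<exists>h. conformal_hom scale D nprod D' nprod' h \<and> h v = w))"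

text \<open>M = k[d]u is represented as polyfun {0} (u is the constant 1, d acts as multiplication
  by variable 0).  act a m is a_lambda m in M[lambda] = polyfun {0,1} (variable 1 = lambda).
  Coefficientwise extensions to M[lambda,mu] are given pointwise (variable 2 = mu).\<close>

definition conformal_module_M ::
  "('k::field_char_0 \<Rightarrow> 'c::ab_group_add \<Rightarrow> 'c) \<Rightarrow> ('c \<Rightarrow> 'c) \<Rightarrow> (nat \<Rightarrow> 'c \<Rightarrow> 'c \<Rightarrow> 'c)
   \<Rightarrow> ('c \<Rightarrow> ((nat \<Rightarrow> 'k) \<Rightarrow> 'k) \<Rightarrow> ((nat \<Rightarrow> 'k) \<Rightarrow> 'k)) \<Rightarrow> bool" where
  "conformal_module_M scale D nprod act \<longleftrightarrow>
     (\<forall>a. \<forall>m\<in>polyfun {0}. act a m \<in> polyfun {0,1}) \<and>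
     (\<forall>a b. \<forall>m\<in>polyfun {0}. act (a + b) m = (\<lambda>x. act a m x + act b m x)) \<and>
     (\<forall>a c. \<forall>m\<in>polyfun {0}. act (scale c a) m = (\<lambda>x. c * act a m x)) \<and>
     (\<forall>a. \<forall>m\<in>polyfun {0}. \<forall>m'\<in>polyfun {0}. act a (\<lambda>x. m x + m' x) = (\<lambda>x. act a m x + act a m' x)) \<and>
     (\<forall>a c. \<forall>m\<in>polyfun {0}. act a (\<lambda>x. c * m x) = (\<lambda>x. c * act a m x)) \<and>
     (\<forall>a. \<forall>m\<in>polyfun {0}. act (D a) m = (\<lambda>x. - x 1 * act a m x)) \<and>
     (\<forall>a. \<forall>m\<in>polyfun {0}. act a (\<lambda>x. x 0 * m x) = (\<lambda>x. (x 0 + x 1) * act a m x)) \<and>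
     (\<forall>a b. \<forall>m\<in>polyfun {0}.
        (\<lambda>x. act a (\<lambda>y. act b m (y(1 := x 2))) x)
      = (\<lambda>x. act (lprod scale nprod a b (x 1)) m (x(1 := x 1 + x 2))))"

definition is_M0Delta ::
  "('k::field_char_0 \<Rightarrow> 'c::ab_group_add \<Rightarrow> 'c) \<Rightarrow> ('c \<Rightarrow> 'c) \<Rightarrow> (nat \<Rightarrow> 'c \<Rightarrow> 'c \<Rightarrow> 'c) \<Rightarrow> 'c \<Rightarrow> 'k
   \<Rightarrow> ('c \<Rightarrow> ((nat \<Rightarrow> 'k) \<Rightarrow> 'k) \<Rightarrow> ((nat \<Rightarrow> 'k) \<Rightarrow> 'k)) \<Rightarrow> bool" where
  "is_M0Delta scale D nprod v \<Delta> act \<longleftrightarrow>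
     conformal_module_M scale D nprod act \<and>
     act v (\<lambda>x. 1) = (\<lambda>x. x 0 + \<Delta> * x 1)"

text \<open>An n-cochain maps lists of length n of elements of C to M[lambda_1..lambda_n]
  = polyfun {0..n}; it is zero on lists of other length (normalisation).  For n = 0 the
  cochains are exactly the elements of M (the value on the empty list).\<close>

definition cochain ::
  "('k::field_char_0 \<Rightarrow> 'c::ab_group_add \<Rightarrow> 'c) \<Rightarrow> ('c \<Rightarrow> 'c) \<Rightarrow> nat
   \<Rightarrow> ('c list \<Rightarrow> (nat \<Rightarrow> 'k) \<Rightarrow> 'k) \<Rightarrow> bool" where
  "cochain scale D n \<phi> \<longleftrightarrow>
     (\<forall>as. length as \<noteq> n \<longrightarrow> \<phi> as = (\<lambda>x. 0)) \<and>
     (\<forall>as. length as = n \<longrightarrow> \<phi> as \<in> polyfun {0..n}) \<and>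
     (\<forall>as i a b. length as = n \<longrightarrow> i < n \<longrightarrow>
        \<phi> (as[i := a + b]) = (\<lambda>x. \<phi> (as[i := a]) x + \<phi> (as[i := b]) x)) \<and>
     (\<forall>as i a c. length as = n \<longrightarrow> i < n \<longrightarrow>
        \<phi> (as[i := scale c a]) = (\<lambda>x. c * \<phi> (as[i := a]) x)) \<and>
     (\<forall>as i. length as = n \<longrightarrow> i < n \<longrightarrow>
        \<phi> (as[i := D (as ! i)]) = (\<lambda>x. - x (Suc i) * \<phi> as x))"

text \<open>The Hochschild differential d : C^n -> C^(n+1).  Position i (1-based) of the argument
  list carries lambda_i = variable i.\<close>

definition hdiff ::
  "('k::field_char_0 \<Rightarrow> 'c::ab_group_add \<Rightarrow> 'c) \<Rightarrow> (nat \<Rightarrow> 'c \<Rightarrow> 'c \<Rightarrow> 'c)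
   \<Rightarrow> ('c \<Rightarrow> ((nat \<Rightarrow> 'k) \<Rightarrow> 'k) \<Rightarrow> ((nat \<Rightarrow> 'k) \<Rightarrow> 'k)) \<Rightarrow> nat
   \<Rightarrow> ('c list \<Rightarrow> (nat \<Rightarrow> 'k) \<Rightarrow> 'k) \<Rightarrow> ('c list \<Rightarrow> (nat \<Rightarrow> 'k) \<Rightarrow> 'k)" where
  "hdiff scale nprod act n \<phi> as x =
     (if length as = Suc n then
        act (as ! 0) (\<lambda>y. \<phi> (tl as) (\<lambda>j. if j = 0 then y 0 else x (Suc j))) x
        + (\<Sum>i=1..n. (-1) ^ i *
             \<phi> (take (i - 1) as @ [lprod scale nprod (as ! (i - 1)) (as ! i) (x i)] @ drop (Suc i) as)
               (\<lambda>j. if j < i then x j else if j = i then x i + x (Suc i) else x (Suc j)))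
      else 0)"

definition cdiff :: "nat \<Rightarrow> ('c list \<Rightarrow> (nat \<Rightarrow> 'k::field_char_0) \<Rightarrow> 'k) \<Rightarrow> ('c list \<Rightarrow> (nat \<Rightarrow> 'k) \<Rightarrow> 'k)" where
  "cdiff n \<phi> as x = (x 0 + (\<Sum>i=1..n. x i)) * \<phi> as x"

text \<open>Vanishing of H^n (n >= 1) of the reduced complex C~/dC~: every cochain whose
  differential lies in d C~^(n+1) is a coboundary modulo d C~^n.\<close>

definition hochschild_vanishes ::
  "('k::field_char_0 \<Rightarrow> 'c::ab_group_add \<Rightarrow> 'c) \<Rightarrow> ('c \<Rightarrow> 'c) \<Rightarrow> (nat \<Rightarrow> 'c \<Rightarrow> 'c \<Rightarrow> 'c)
   \<Rightarrow> ('c \<Rightarrow> ((nat \<Rightarrow> 'k) \<Rightarrow> 'k) \<Rightarrow> ((nat \<Rightarrow> 'k) \<Rightarrow> 'k)) \<Rightarrow> nat \<Rightarrow> bool" where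
  "hochschild_vanishes scale D nprod act n \<longleftrightarrow>
     (\<forall>\<phi>. cochain scale D n \<phi> \<and>
          (\<exists>\<chi>. cochain scale D (Suc n) \<chi> \<and> hdiff scale nprod act n \<phi> = cdiff (Suc n) \<chi>)
      \<longrightarrow> (\<exists>\<psi> \<chi>. cochain scale D (n - 1) \<psi> \<and> cochain scale D n \<chi> \<and>
              \<phi> = (\<lambda>as x. hdiff scale nprod act (n - 1) \<psi> as x + cdiff n \<chi> as x)))"

end

theory Submission
  imports Defs "HOL-Computational_Algebra.Polynomial" "HOL-Library.Function_Algebras" "HOL-Library.Nat_Bijection"
begin

text \<open>Evaluating the formal variables, \<open>U(3)\<close> acts on \<open>M\<^sub>(\<^sub>0\<^sub>,\<^sub>\<Delta>\<^sub>)\<close> by shift operators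
  \<open>f(x) \<mapsto> p(x, \<Delta>) f(x + \<lambda>)\<close>, where \<open>v\<close> has the symbol \<open>p(x, s) = x + s \<lambda>\<close>.  The universal property
  yields a symbol for every element of \<open>U(3)\<close>, and the defining relations show that an element whose
  symbol vanishes at \<open>\<lambda>\<close> is a multiple of \<open>\<partial> + \<lambda>\<close>.  Basic cochains are therefore the polynomial
  multilinear cochains of the algebra of symbols, a non-unital algebra over which the trivial module
  has a projective resolution of length three.  Since \<open>\<Delta> \<noteq> 0\<close>, the last map of that resolution
  induces a surjection on cochains with values in \<open>M\<close>, so cocycles of the basic complex in degree at
  least three are coboundaries.  The reduced complex follows, because \<open>\<partial>\<close> is
  injective on basic cochains: if \<open>d \<phi> = \<partial> \<chi>\<close> then \<open>\<chi>\<close> is a cocycle, \<open>\<chi> = d \<omega>\<close>, and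
  \<open>\<phi> - \<partial> \<omega>\<close> is a cocycle.\<close>

text \<open>Write P(s) for the operator of a symbol and x for multiplication by the variable. Then
  \<open>sA1\<close> is the condition P(0) x = x P(1), \<open>sE\<close> is P(0) = x P(1), and
  \<open>sT\<close> is P(0) = x P(1) x. Right multiplication by \<open>rho\<close> (1 at s = 0, x at
  s = 1), by \<open>om\<close> (x at s = 0, 1 at s = 1) and by e = s (1 - s) carries one condition
  into another, and this yields all maps of the resolution.

  The obstacle is that the unit lives in degree l = 0 only, so exactness is not uniform in the
  degree: since e om(x + \<nu>) - om(x) e = \<nu> (1 - s) e, the preimage of (1 - s) e in degree
  \<nu> is (e, - om) divided by \<nu>. Cochains depend polynomially on the degrees, so a quotient by
  \<nu> survives at \<nu> = 0; hence the statements on polynomial families that accompany every map.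

  A cochain is given on elements of U(3), not on symbols. That its value depends only on symbols
  rests on a spanning set of U(3) over k[\<partial>], which comes from associativity of the products
  with v.\<close>

section \<open>Polynomial functions: substitution, one-variable restriction, division by a linear
  factor\<close>

lemma polyfun_subst:
  assumes "f \<in> polyfun V" "\<And>i. i \<in> V \<Longrightarrow> (\<lambda>y. g y i) \<in> polyfun W"
  shows "(\<lambda>y. f (g y)) \<in> polyfun W"
  using assms(1)
  by induction (auto intro: polyfun.intros assms(2))

lemma polyfun_uminus: "f \<in> polyfun V \<Longrightarrow> (\<lambda>y. - f y) \<in> polyfun V"
  using pf_mult[OF pf_const[of "-1"]] by simp

lemma polyfun_diff: "f \<in> polyfun V \<Longrightarrow> g \<in> polyfun V \<Longrightarrow> (\<lambda>y. f y - g y) \<in> polyfun V"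
  using pf_add[OF _ polyfun_uminus, of f V g] by simp

lemma polyfun_power: "f \<in> polyfun V \<Longrightarrow> (\<lambda>y. f y ^ n) \<in> polyfun V"
  by (induction n) (auto intro: polyfun.intros)

lemma polyfun_if:
  "(c \<Longrightarrow> f \<in> polyfun V) \<Longrightarrow> (\<not> c \<Longrightarrow> g \<in> polyfun V) \<Longrightarrow> (\<lambda>y. if c then f y else g y) \<in> polyfun V"
  by (cases c) simp_all

lemma polyfun_sum: "(\<And>i. i \<in> I \<Longrightarrow> f i \<in> polyfun V) \<Longrightarrow> (\<lambda>y. \<Sum>i\<in>I. f i y) \<in> polyfun V"
  by (induction I rule: infinite_finite_induct) (auto intro: polyfun.intros)

lemma polyfun_UNIV_var: "(\<lambda>y. y i) \<in> polyfun UNIV"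
  by (rule pf_var) simp

lemmas polyfun_intros = pf_const polyfun_UNIV_var pf_add pf_mult polyfun_uminus polyfun_diff
  polyfun_power polyfun_sum polyfun_if

text \<open>Freezing the variables outside V at 0 leaves only those of V. This allows arguments with
  all variables available, the support being settled at the end.\<close>

lemma polyfun_restrict:
  assumes "f \<in> polyfun UNIV" "\<And>y. f y = f (\<lambda>i. if i \<in> V then y i else 0)"
  shows "f \<in> polyfun V"
proof -
  have "(\<lambda>y. f (\<lambda>i. if i \<in> V then y i else 0)) \<in> polyfun V"
    by (rule polyfun_subst[OF assms(1)]) (auto intro!: polyfun_if intro: polyfun.intros)
  moreover have "f = (\<lambda>y. f (\<lambda>i. if i \<in> V then y i else 0))" using assms(2) by (rule ext)
  ultimately show ?thesis by simp
qed

lemma polyfun_local: "f \<in> polyfun V \<Longrightarrow> (\<And>i. i \<in> V \<Longrightarrow> y i = z i) \<Longrightarrow> f y = f z"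
  by (induction rule: polyfun.induct) auto

lemma polyfun_line:
  assumes "f \<in> polyfun V" "\<And>i. i \<in> V \<Longrightarrow> \<exists>p. \<forall>t. g t i = poly p t"
  shows "\<exists>p. \<forall>t. f (g t) = poly p t"
  using assms(1)
proof induction
  case (pf_const c) show ?case by (rule exI[of _ "[:c:]"]) simp
next
  case (pf_var i) then show ?case using assms(2) by auto
next
  case (pf_add p q)
  then show ?case by (metis poly_add)
next
  case (pf_mult p q)
  then show ?case by (metis poly_mult)
qed

lemma polyfun_line_upd:
  assumes "f \<in> polyfun V" shows "\<exists>p. \<forall>t. f (y(i := t)) = poly p t"
proof (rule polyfun_line[OF assms])
  fix j
  have "\<forall>t. (y(i := t)) j = poly (if j = i then [:0,1:] else [:y j:]) t" by simp
  then show "\<exists>p. \<forall>t. (y(i := t)) j = poly p t" by blast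
qed

text \<open>The continuation principle used throughout: identities are proved where division is
  allowed and carried to the finitely many exceptional points.\<close>

lemma poly_cofinite_eq:
  fixes p q :: "'k::field_char_0 poly"
  assumes "finite S" "\<And>t. t \<notin> S \<Longrightarrow> poly p t = poly q t"
  shows "p = q"
proof (rule ccontr)
  assume "p \<noteq> q"
  then have "finite {t. poly (p - q) t = 0}" by (intro poly_roots_finite) simp
  moreover have "UNIV - S \<subseteq> {t. poly (p - q) t = 0}" using assms(2) by auto
  ultimately have "finite (UNIV :: 'k set)"
    by (meson assms(1) finite_Diff2 finite_subset)
  then show False using infinite_UNIV_char_0 by blast
qed

text \<open>The factor theorem with the other variables as parameters. Induction on the build-up of
  f, with a Leibniz rule in the product case, produces the cofactor without any
  coefficients.\<close>

lemma polyfun_divide: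
  assumes "f \<in> polyfun UNIV" "a \<in> polyfun UNIV"
  shows "\<exists>g\<in>polyfun UNIV. \<forall>y. f y - f (y(i := a y)) = (y i - a y) * g y"
  using assms(1)
proof induction
  case (pf_const c) show ?case by (rule bexI[of _ "\<lambda>_. 0"]) (auto intro: polyfun_intros)
next
  case (pf_var j)
  show ?case
    by (rule bexI[of _ "\<lambda>_. if j = i then 1 else 0"]) (auto intro: polyfun_intros)
next
  case (pf_add p q)
  then obtain g h where gh: "g \<in> polyfun UNIV" "h \<in> polyfun UNIV"
    "\<And>y. p y - p (y(i := a y)) = (y i - a y) * g y" "\<And>y. q y - q (y(i := a y)) = (y i - a y) * h y"
    by blast
  have "p y + q y - (p (y(i := a y)) + q (y(i := a y))) = (y i - a y) * (g y + h y)" for y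
    using gh(3,4)[of y] by (simp add: add_diff_add distrib_left)
  then show ?case using gh(1,2) by (intro bexI[of _ "\<lambda>y. g y + h y"] allI polyfun.pf_add)
next
  case (pf_mult p q)
  then obtain g h where gh: "g \<in> polyfun UNIV" "h \<in> polyfun UNIV"
    "\<And>y. p y - p (y(i := a y)) = (y i - a y) * g y" "\<And>y. q y - q (y(i := a y)) = (y i - a y) * h y"
    by blast
  have "p y * q y - (p (y(i := a y)) * q (y(i := a y)))
      = (y i - a y) * (g y * q y + p (y(i := a y)) * h y)" for y
  proof -
    have "p y * q y - (p (y(i := a y)) * q (y(i := a y)))
      = (p y - p (y(i := a y))) * q y + p (y(i := a y)) * (q y - q (y(i := a y)))"
      by (simp add: algebra_simps)
    then show ?thesis by (simp add: gh(3,4)) (simp add: algebra_simps)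
  qed
  moreover have "(\<lambda>y. p (y(i := a y))) \<in> polyfun UNIV"
    by (rule polyfun_subst[OF pf_mult.hyps(1)]) (auto simp: fun_upd_def intro: polyfun_intros assms(2))
  ultimately show ?case using gh(1,2) pf_mult.hyps
    by (intro bexI[of _ "\<lambda>y. g y * q y + p (y(i := a y)) * h y"] polyfun.pf_add polyfun.pf_mult allI) assumption+
qed

section \<open>Jointly polynomial families\<close>

text \<open>A symbol is a function of the module variable \<open>x\<close> and of the parameter \<open>s\<close> standing for
  \<open>\<Delta>\<close>; a family of symbols depends on an auxiliary point \<open>y\<close>, shifted here by two to make room
  for \<open>x\<close> and \<open>s\<close>.\<close>

type_synonym 'k sym = "'k \<Rightarrow> 'k \<Rightarrow> 'k"

definition psym_family :: "((nat \<Rightarrow> 'k::field_char_0) \<Rightarrow> 'k sym) \<Rightarrow> bool" where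
  "psym_family p \<longleftrightarrow> (\<lambda>y. p (\<lambda>i. y (i + 2)) (y 0) (y 1)) \<in> polyfun UNIV"

abbreviation psym :: "'k::field_char_0 sym \<Rightarrow> bool" where
  "psym p \<equiv> psym_family (\<lambda>_. p)"

lemma psym_family_eval:
  assumes "psym_family p" "\<And>i. (\<lambda>y. u y i) \<in> polyfun UNIV" "\<xi> \<in> polyfun UNIV" "\<sigma> \<in> polyfun UNIV"
  shows "(\<lambda>y. p (u y) (\<xi> y) (\<sigma> y)) \<in> polyfun UNIV"
proof -
  define g where "g = (\<lambda>y i. if i = 0 then \<xi> y else if i = 1 then \<sigma> y else u y (i - 2))"
  have "(\<lambda>y. (\<lambda>y. p (\<lambda>i. y (i + 2)) (y 0) (y 1)) (g y)) \<in> polyfun UNIV"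
    by (rule polyfun_subst[OF assms(1)[unfolded psym_family_def]])
       (auto simp: g_def assms intro!: polyfun_if)
  moreover have "(\<lambda>y. (\<lambda>y. p (\<lambda>i. y (i + 2)) (y 0) (y 1)) (g y)) = (\<lambda>y. p (u y) (\<xi> y) (\<sigma> y))"
    by (simp add: g_def)
  ultimately show ?thesis by simp
qed

lemma psym_familyI:
  assumes "\<And>(u :: (nat \<Rightarrow> 'k::field_char_0) \<Rightarrow> nat \<Rightarrow> 'k) \<xi> \<sigma>. (\<And>i. (\<lambda>y. u y i) \<in> polyfun UNIV) \<Longrightarrow>
     \<xi> \<in> polyfun UNIV \<Longrightarrow> \<sigma> \<in> polyfun UNIV \<Longrightarrow> (\<lambda>y. p (u y) (\<xi> y) (\<sigma> y)) \<in> polyfun UNIV"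
  shows "psym_family p"
  unfolding psym_family_def by (rule assms) (rule polyfun_UNIV_var)+

lemma polyfun_eval:
  assumes "f \<in> polyfun UNIV" "\<And>i. (\<lambda>y. u y i) \<in> polyfun UNIV"
  shows "(\<lambda>y. f (u y)) \<in> polyfun UNIV"
  using assms by (rule polyfun_subst)

lemma psym_family_line_x: "psym_family p \<Longrightarrow> \<exists>q. \<forall>x. p y x s = poly q x"
proof -
  assume p: "psym_family p"
  obtain q where "\<forall>t. p (\<lambda>i. ((\<lambda>i. if i = 1 then s else y (i - 2))(0 := t)) (i + 2)) t s = poly q t"
    using polyfun_line_upd[OF p[unfolded psym_family_def], of "\<lambda>i. if i = 1 then s else y (i - 2)" 0]
    by auto
  then show ?thesis by auto
qed

lemma psym_family_line_s: "psym_family p \<Longrightarrow> \<exists>q. \<forall>s. p y x s = poly q s"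
proof -
  assume p: "psym_family p"
  obtain q where "\<forall>t. p (\<lambda>i. ((\<lambda>i. if i = 0 then x else y (i - 2))(1 := t)) (i + 2)) x t = poly q t"
    using polyfun_line_upd[OF p[unfolded psym_family_def], of "\<lambda>i. if i = 0 then x else y (i - 2)" 1]
    by auto
  then show ?thesis by auto
qed

section \<open>Exact division by x and by s (1 - s)\<close>

text \<open>If d has finitely many zeros the polynomial cofactor is unique, so the quotient also has
  a value at the zeros of d. Later constructions evaluate it exactly there.\<close>

definition pquot :: "('k::field_char_0 \<Rightarrow> 'k) \<Rightarrow> ('k \<Rightarrow> 'k) \<Rightarrow> 'k \<Rightarrow> 'k" where
  "pquot d f t = (SOME c. \<exists>p. (\<forall>t. f t = d t * poly p t) \<and> c = poly p t)"

lemma pquot_eq: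
  assumes "finite {t. d t = 0}" "\<And>t. f t = d t * poly p t"
  shows "pquot d f t = poly p t"
proof -
  have "q = p" if "\<forall>t. f t = d t * poly q t" for q
    using that assms by (intro poly_cofinite_eq[OF assms(1)]) (metis (mono_tags, lifting) mem_Collect_eq mult_left_cancel)
  then have "(\<exists>p. (\<forall>t. f t = d t * poly p t) \<and> c = poly p t) \<longleftrightarrow> c = poly p t" for c
    using assms(2) by blast
  then show ?thesis unfolding pquot_def by simp
qed

definition divx :: "('k::field_char_0 \<Rightarrow> 'k) \<Rightarrow> 'k \<Rightarrow> 'k" where
  "divx f = pquot (\<lambda>t. t) (\<lambda>t. f t - f 0)"

text \<open>The subtracted term interpolates linearly between s = 0 and s = 1, so the quotient
  describes the part of p that is invisible at both ends, where all module conditions are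
  imposed.\<close>

definition dive :: "'k::field_char_0 sym \<Rightarrow> 'k sym" where
  "dive p x = pquot (\<lambda>s. s * (1 - s)) (\<lambda>s. p x s - (1 - s) * p x 0 - s * p x 1)"

lemma finite_e_roots: "finite {s::'k::field_char_0. s * (1 - s) = 0}"
proof -
  have "{s::'k. s * (1 - s) = 0} = {0, 1}" by auto
  then show ?thesis by simp
qed

lemma divx_eqI: "(\<And>t. f t = f 0 + t * poly q t) \<Longrightarrow> divx f t = poly q t"
  unfolding divx_def by (rule pquot_eq) (simp, metis add_diff_cancel_left')

lemma psym_family_divx_ex:
  assumes "psym_family p"
  shows "\<exists>q. psym_family q \<and> (\<forall>y x s. p y x s - p y 0 s = x * q y x s)"
proof -
  obtain g where g: "g \<in> polyfun UNIV"
    "\<And>y. p (\<lambda>i. y (i + 2)) (y 0) (y 1) - p (\<lambda>i. y (i + 2)) 0 (y 1) = y 0 * g y"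
    using polyfun_divide[OF assms[unfolded psym_family_def] pf_const[of 0], of 0] by auto
  define q where "q = (\<lambda>y x s. g (\<lambda>i. if i = 0 then x else if i = 1 then s else y (i - 2)))"
  have "psym_family q"
    unfolding q_def by (rule psym_familyI, rule polyfun_subst[OF g(1)]) (auto intro!: polyfun_if)
  moreover have "p y x s - p y 0 s = x * q y x s" for y x s
    using g(2)[of "\<lambda>i. if i = 0 then x else if i = 1 then s else y (i - 2)"] by (simp add: q_def)
  ultimately show ?thesis by blast
qed

lemma psym_family_dive_ex:
  assumes "psym_family p"
  shows "\<exists>q. psym_family q \<and>
    (\<forall>y x s. p y x s - (1 - s) * p y x 0 - s * p y x 1 = s * (1 - s) * q y x s)"
proof -
  obtain g where g: "g \<in> polyfun UNIV"
    "\<And>y. p (\<lambda>i. y (i + 2)) (y 0) (y 1) - p (\<lambda>i. y (i + 2)) (y 0) 0 = y 1 * g y"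
    using polyfun_divide[OF assms[unfolded psym_family_def] pf_const[of 0], of 1] by auto
  obtain h where h: "h \<in> polyfun UNIV" "\<And>y. g y - g (y(1 := 1)) = (y 1 - 1) * h y"
    using polyfun_divide[OF g(1) pf_const[of 1], of 1] by auto
  \<comment> \<open>The second division produces the factor s - 1 instead of 1 - s, hence the
    sign.\<close>
  define q where "q = (\<lambda>y x s. - h (\<lambda>i. if i = 0 then x else if i = 1 then s else y (i - 2)))"
  have "psym_family q"
    unfolding q_def
    by (rule psym_familyI, rule polyfun_uminus, rule polyfun_subst[OF h(1)]) (auto intro!: polyfun_if)
  moreover have "p y x s - (1 - s) * p y x 0 - s * p y x 1 = s * (1 - s) * q y x s" for y x s
  proof -
    let ?u = "\<lambda>i. if i = 0 then x else if i = 1 then s else y (i - 2)"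
    have 1: "p y x s - p y x 0 = s * g ?u" using g(2)[of ?u] by simp
    have 2: "p y x 1 - p y x 0 = g (?u(1 := 1))" using g(2)[of "?u(1 := 1)"] by simp
    have 3: "g ?u - g (?u(1 := 1)) = (s - 1) * h ?u" using h(2)[of ?u] by simp
    have "p y x s - (1 - s) * p y x 0 - s * p y x 1
       = (p y x s - p y x 0) - s * (p y x 1 - p y x 0)" by (simp add: algebra_simps)
    also have "\<dots> = s * (g ?u - g (?u(1 := 1)))" unfolding 1 2 by (simp add: algebra_simps)
    also have "\<dots> = s * (1 - s) * q y x s" unfolding 3 q_def by (simp add: algebra_simps)
    finally show ?thesis .
  qed
  ultimately show ?thesis by blast
qed

lemma divx_unique:
  assumes "psym_family q" "\<And>x. f x - f 0 = x * q y x s"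
  shows "divx f x = q y x s"
proof -
  obtain r where r: "\<And>x. q y x s = poly r x" using psym_family_line_x[OF assms(1)] by metis
  show ?thesis unfolding r by (rule divx_eqI) (metis assms(2) r add.commute diff_add_cancel)
qed

lemma dive_unique:
  assumes "psym q" "\<And>x s. p x s - (1 - s) * p x 0 - s * p x 1 = s * (1 - s) * q x s"
  shows "dive p = q"
proof (intro ext)
  fix x s
  obtain r where r: "\<And>s. q x s = poly r s" using psym_family_line_s[OF assms(1)] by metis
  have "p x s - (1 - s) * p x 0 - s * p x 1 = s * (1 - s) * poly r s" for s
    using assms(2)[of x s] r[of s] by simp
  then show "dive p x s = q x s"
    unfolding dive_def r by (intro pquot_eq finite_e_roots)
qed

lemma psym_family_at: "psym_family p \<Longrightarrow> psym (p y)"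
  by (rule psym_familyI, rule psym_family_eval) (auto intro: polyfun_intros)

lemma psym_family_dive:
  assumes "psym_family p" shows "psym_family (\<lambda>y. dive (p y))"
proof -
  obtain q where q: "psym_family q"
    "\<And>y x s. p y x s - (1 - s) * p y x 0 - s * p y x 1 = s * (1 - s) * q y x s"
    using psym_family_dive_ex[OF assms] by blast
  have "dive (p y) = q y" for y
    by (rule dive_unique[OF psym_family_at[OF q(1)]]) (rule q(2))
  then show ?thesis using q(1) by simp
qed

lemma psym_family_divx:
  assumes "psym_family p" shows "psym_family (\<lambda>y x s. divx (\<lambda>x. p y x s) x)"
proof -
  obtain q where q: "psym_family q" "\<And>y x s. p y x s - p y 0 s = x * q y x s"
    using psym_family_divx_ex[OF assms] by blast
  have "divx (\<lambda>x. p y x s) x = q y x s" for y x s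
    by (rule divx_unique[OF q(1)]) (rule q(2))
  then show ?thesis using q(1) by simp
qed

lemma dive_decomp:
  assumes "psym p"
  shows "p x s = (1 - s) * p x 0 + s * p x 1 + s * (1 - s) * dive p x s"
proof -
  obtain q where q: "psym_family q"
    "\<And>(y::nat \<Rightarrow> 'a) x s. p x s - (1 - s) * p x 0 - s * p x 1 = s * (1 - s) * q y x s"
    using psym_family_dive_ex[OF assms] by blast
  have "dive p = q (\<lambda>_. 0)"
    by (rule dive_unique[OF psym_family_at[OF q(1)]]) (rule q(2))
  with q(2)[of x s "\<lambda>_. 0"]
  have "p x s - (1 - s) * p x 0 - s * p x 1 = s * (1 - s) * dive p x s" by simp
  then show ?thesis by (metis add.commute add.left_commute diff_add_cancel)
qed

lemma divx_decomp:
  assumes "psym p" shows "p x s = p 0 s + x * divx (\<lambda>x. p x s) x"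
proof -
  obtain q where q: "psym_family q" "\<And>(y::nat \<Rightarrow> 'a) x s. p x s - p 0 s = x * q y x s"
    using psym_family_divx_ex[OF assms] by blast
  have "divx (\<lambda>x. p x s) x = q (\<lambda>_. 0) x s"
    by (rule divx_unique[OF q(1)]) (rule q(2))
  with q(2)[of x s "\<lambda>_. 0"] have "p x s - p 0 s = x * divx (\<lambda>x. p x s) x" by simp
  then show ?thesis by (metis add.commute diff_add_cancel)
qed

section \<open>The bar differential on lists of shift operators\<close>

text \<open>The pair \<open>(p, l)\<close> stands for the operator \<open>f(x) \<mapsto> p(x, \<Delta>) f(x + l)\<close>: this is how a symbol evaluated at
  \<open>\<lambda> = l\<close> acts on \<open>M\<close>, and associativity of the \<open>\<lambda>\<close>-product becomes associativity of composition.\<close>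

type_synonym 'k hom = "'k sym \<times> 'k"

definition hmul :: "'k::field_char_0 hom \<Rightarrow> 'k hom \<Rightarrow> 'k hom" where
  "hmul a b = ((\<lambda>x s. fst a x s * fst b (x + snd a) s), snd a + snd b)"

definition hact :: "'k::field_char_0 \<Rightarrow> 'k hom \<Rightarrow> ('k \<Rightarrow> 'k) \<Rightarrow> 'k \<Rightarrow> 'k" where
  "hact \<Delta> a f x = fst a x \<Delta> * f (x + snd a)"

lemma hmul_assoc: "hmul (hmul a b) c = hmul a (hmul b c)"
  by (simp add: hmul_def algebra_simps)

lemma hact_hmul: "hact \<Delta> (hmul a b) f x = hact \<Delta> a (hact \<Delta> b f) x"
  by (simp add: hmul_def hact_def algebra_simps)

text \<open>The terms of the bar differential that multiply two neighbours. Fixing the first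
  argument flips the sign, which replaces the indexed alternating sum by a recursion;
  \<open>hS_sum\<close> recovers the sum.\<close>

fun hS :: "('k::field_char_0 hom list \<Rightarrow> 'k \<Rightarrow> 'k) \<Rightarrow> 'k hom list \<Rightarrow> 'k \<Rightarrow> 'k" where
  "hS f (a # b # l) = (\<lambda>x. f (hmul a b # l) x - hS (\<lambda>l. f (a # l)) (b # l) x)"
| "hS f [a] = (\<lambda>x. 0)"
| "hS f [] = (\<lambda>x. 0)"

text \<open>Nothing acts from the right on the last argument, so this is the bar differential with
  trivial right action. With the last argument taken from a left module X, the same formula gives
  the complex computing Ext from X to M.\<close>

fun hcob :: "'k::field_char_0 \<Rightarrow> ('k hom list \<Rightarrow> 'k \<Rightarrow> 'k) \<Rightarrow> 'k hom list \<Rightarrow> 'k \<Rightarrow> 'k" where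
  "hcob \<Delta> f (a # l) = (\<lambda>x. hact \<Delta> a (f l) x - hS f (a # l) x)"
| "hcob \<Delta> f [] = (\<lambda>x. 0)"

lemma hS_lin: "hS (\<lambda>l x. f l x + c * g l x) l x = hS f l x + c * hS g l x"
proof (induction l arbitrary: f g rule: induct_list012)
  case (3 a b l)
  then show ?case by (simp add: algebra_simps)
qed auto

lemma hcob_lin: "hcob \<Delta> (\<lambda>l x. f l x + c * g l x) l x = hcob \<Delta> f l x + c * hcob \<Delta> g l x"
  by (cases l) (auto simp: hS_lin hact_def algebra_simps)

lemma hS_diff: "hS (\<lambda>l x. f l x - g l x) l x = hS f l x - hS g l x"
  using hS_lin[of f "-1" g l x] by simp

lemma hS_snoc:
  "hS f (l @ [a, w]) x = hS (\<lambda>l. f (l @ [w])) (l @ [a]) x + (-1) ^ length l * f (l @ [hmul a w]) x"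
proof (induction l arbitrary: f)
  case Nil
  then show ?case by simp
next
  case (Cons b l)
  show ?case
  proof (cases l)
    case Nil
    then show ?thesis by (simp add: hmul_assoc)
  next
    case (Cons c l')
    then show ?thesis using Cons.IH[of "\<lambda>l. f (b # l)"] by simp
  qed
qed

text \<open>All dimension shifting happens in the last slot; this isolates the one term in which
  that slot gets multiplied.\<close>

lemma hcob_snoc:
  "hcob \<Delta> f (l @ [a, w]) x
     = hcob \<Delta> (\<lambda>l. f (l @ [w])) (l @ [a]) x - (-1) ^ length l * f (l @ [hmul a w]) x"
proof (cases l)
  case Nil
  then show ?thesis by simp
next
  case (Cons b l')
  then show ?thesis using hS_snoc[of f l a w x] by simp
qed

text \<open>With the first argument fixed the induction hypothesis applies to the tail, and the
  remaining terms cancel in pairs by associativity of \<open>hmul\<close>.\<close>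

lemma hS_hS: "hS (hS f) l x = 0"
proof (induction l arbitrary: f x rule: length_induct)
  case (1 l)
  consider "l = []" | a where "l = [a]" | a b where "l = [a, b]" | a b c l' where "l = a # b # c # l'"
    by (metis neq_Nil_conv)
  then show ?case
  proof cases
    case (4 a b c l')
    let ?F = "\<lambda>l. f (a # l)"
    have "length (b # c # l') < length l" using 4 by simp
    then have ih: "hS (hS ?F) (b # c # l') x = 0" using 1 by blast
    have d: "hS (\<lambda>l x. f (hmul a b # l) x - hS ?F (b # l) x) (c # l') x
        = hS (\<lambda>l. f (hmul a b # l)) (c # l') x - hS (\<lambda>l. hS ?F (b # l)) (c # l') x"
      by (rule hS_diff)
    show ?thesis unfolding 4 using ih d by (simp add: hmul_assoc algebra_simps)
  qed auto
qed

lemma hcob_hcob: "hcob \<Delta> (hcob \<Delta> f) l x = 0"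
proof -
  consider "l = []" | a where "l = [a]" | a b l' where "l = a # b # l'"
    by (cases l; cases "tl l") auto
  then show ?thesis
  proof cases
  case (3 a b l')
  have 1: "hS (\<lambda>l x. hact \<Delta> a (f l) x - hS f (a # l) x) (b # l') x
     = hS (\<lambda>l. hact \<Delta> a (f l)) (b # l') x - hS (\<lambda>l. hS f (a # l)) (b # l') x"
    by (rule hS_diff)
  have 2: "hS (\<lambda>l. hact \<Delta> a (f l)) l x = hact \<Delta> a (hS f l) x" for l
  proof (induction l arbitrary: f rule: induct_list012)
    case (3 c d l)
    show ?case using "3.IH"(2)[of "\<lambda>l. f (c # l)"] by (simp add: hact_def right_diff_distrib)
  qed (auto simp: hact_def)
  have 4: "hact \<Delta> a (\<lambda>x. u x - w x) x = hact \<Delta> a u x - hact \<Delta> a w x" for u w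
    by (simp add: hact_def right_diff_distrib)
  have 5: "hS f (hmul a b # l') x = hS (\<lambda>l. hS f (a # l)) (b # l') x"
    using hS_hS[of f "a # b # l'" x] by simp
  show ?thesis
    by (simp only: 3 hcob.simps hS.simps(1)[of "hcob \<Delta> f"] 1 2 4 5 hact_hmul) simp
  qed (simp_all add: hact_def)
qed

section \<open>Spaces of symbols\<close>

text \<open>The symbols of \<open>U(3)\<close> at \<open>\<lambda> = l\<close> are the \<open>p\<close> with \<open>p(x,0) = x f(x)\<close> and \<open>p(x,1) = (x + l) f(x)\<close> for a
  common polynomial \<open>f\<close>.  The unit is adjoined in \<open>sA1\<close>, and \<open>sE\<close>, \<open>sT\<close> are the left modules
  of the resolution.\<close>

definition sA :: "'k::field_char_0 hom set" where
  "sA = {(p, l) | p l. psym p \<and> p 0 0 = 0 \<and> (\<forall>x. p x 0 * (x + l) = x * p x 1)}"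

definition sA1 :: "'k::field_char_0 hom set" where
  "sA1 = {(p, l) | p l. psym p \<and> (\<forall>x. p x 0 * (x + l) = x * p x 1)}"

definition sE :: "'k::field_char_0 hom set" where
  "sE = {(p, l) | p l. psym p \<and> (\<forall>x. p x 0 = x * p x 1)}"

definition sT :: "'k::field_char_0 hom set" where
  "sT = {(p, l) | p l. psym p \<and> (\<forall>x. p x 0 = x * (x + l) * p x 1)}"

definition hfam :: "((nat \<Rightarrow> 'k::field_char_0) \<Rightarrow> 'k hom) \<Rightarrow> bool" where
  "hfam H \<longleftrightarrow> psym_family (\<lambda>y. fst (H y)) \<and> (\<lambda>y. snd (H y)) \<in> polyfun UNIV"

text \<open>Meaningful for equal degrees; linearity is demanded only there. The coefficient lets one
  operation serve for sums, multiples and negatives.\<close>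

definition hadd :: "'k::field_char_0 \<Rightarrow> 'k hom \<Rightarrow> 'k hom \<Rightarrow> 'k hom" where
  "hadd c a b = ((\<lambda>x s. fst a x s + c * fst b x s), snd a)"

definition amod :: "'k::field_char_0 hom set \<Rightarrow> bool" where
  "amod X \<longleftrightarrow> (\<forall>a\<in>sA. \<forall>g\<in>X. hmul a g \<in> X) \<and> (\<forall>g\<in>X. psym (fst g)) \<and>
     (\<forall>a\<in>X. \<forall>b\<in>X. \<forall>c. snd a = snd b \<longrightarrow> hadd c a b \<in> X)"

lemma sA_iff: "a \<in> sA \<longleftrightarrow> psym (fst a) \<and> fst a 0 0 = 0 \<and> (\<forall>x. fst a x 0 * (x + snd a) = x * fst a x 1)"
  by (cases a) (simp add: sA_def)

lemma sA1_iff: "a \<in> sA1 \<longleftrightarrow> psym (fst a) \<and> (\<forall>x. fst a x 0 * (x + snd a) = x * fst a x 1)"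
  by (cases a) (simp add: sA1_def)

lemma sE_iff: "a \<in> sE \<longleftrightarrow> psym (fst a) \<and> (\<forall>x. fst a x 0 = x * fst a x 1)"
  by (cases a) (simp add: sE_def)

lemma sT_iff: "a \<in> sT \<longleftrightarrow> psym (fst a) \<and> (\<forall>x. fst a x 0 = x * (x + snd a) * fst a x 1)"
  by (cases a) (simp add: sT_def)

lemma psym_eval:
  "psym p \<Longrightarrow> \<xi> \<in> polyfun UNIV \<Longrightarrow> \<sigma> \<in> polyfun UNIV \<Longrightarrow> (\<lambda>y. p (\<xi> y) (\<sigma> y)) \<in> polyfun UNIV"
  using psym_family_eval[of "\<lambda>_. p" "\<lambda>y. y"] polyfun_UNIV_var by blast

lemma psym_mult:
  assumes "psym p" "psym q" shows "psym (\<lambda>x s. p x s * q (x + l) s)"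
  by (rule psym_familyI) (intro polyfun_intros psym_eval[OF assms(1)] psym_eval[OF assms(2)])

lemma psym_lin:
  assumes "psym p" "psym q" shows "psym (\<lambda>x s. p x s + c * q x s)"
  by (rule psym_familyI) (intro polyfun_intros psym_eval[OF assms(1)] psym_eval[OF assms(2)])

lemma amodI:
  assumes "\<And>a g. a \<in> sA \<Longrightarrow> g \<in> X \<Longrightarrow> hmul a g \<in> X" "\<And>g. g \<in> X \<Longrightarrow> psym (fst g)"
    "\<And>a b c. a \<in> X \<Longrightarrow> b \<in> X \<Longrightarrow> snd a = snd b \<Longrightarrow> hadd c a b \<in> X"
  shows "amod X"
  using assms unfolding amod_def by blast

lemma amod_sE: "amod (sE :: 'k::field_char_0 hom set)"
proof (rule amodI)
  fix a g :: "'k hom" assume a: "a \<in> sA" and g: "g \<in> sE"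
  have "fst a x 0 * fst g (x + snd a) 0 = x * (fst a x 1 * fst g (x + snd a) 1)" for x
  proof -
    have 1: "fst g (x + snd a) 0 = (x + snd a) * fst g (x + snd a) 1" using g by (simp add: sE_iff)
    have 2: "fst a x 0 * (x + snd a) = x * fst a x 1" using a by (simp add: sA_iff)
    have "fst a x 0 * fst g (x + snd a) 0 = (fst a x 0 * (x + snd a)) * fst g (x + snd a) 1"
      unfolding 1 by (simp only: mult.assoc)
    then show ?thesis unfolding 2 by (simp only: mult.assoc)
  qed
  then show "hmul a g \<in> sE" using a g by (simp add: sE_iff sA_iff hmul_def psym_mult)
next
  fix a b :: "'k hom" and c assume a: "a \<in> sE" "b \<in> sE" "snd a = snd b"
  then have 1: "fst a x 0 = x * fst a x 1" "fst b x 0 = x * fst b x 1" for x by (auto simp: sE_iff)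
  show "hadd c a b \<in> sE"
    using a psym_lin[of "fst a" "fst b" c] unfolding sE_iff hadd_def fst_conv snd_conv 1(1) 1(2)
    by (simp add: algebra_simps)
qed (simp add: sE_iff)

lemma amod_sT: "amod (sT :: 'k::field_char_0 hom set)"
proof (rule amodI)
  fix a g :: "'k hom" assume a: "a \<in> sA" and g: "g \<in> sT"
  have "fst a x 0 * fst g (x + snd a) 0
     = x * (x + (snd a + snd g)) * (fst a x 1 * fst g (x + snd a) 1)" for x
  proof -
    have 1: "fst g (x + snd a) 0 = (x + snd a) * (x + snd a + snd g) * fst g (x + snd a) 1"
      using g by (simp add: sT_iff)
    have 2: "fst a x 0 * (x + snd a) = x * fst a x 1" using a by (simp add: sA_iff)
    have "fst a x 0 * fst g (x + snd a) 0
      = (fst a x 0 * (x + snd a)) * ((x + snd a + snd g) * fst g (x + snd a) 1)"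
      unfolding 1 by (simp only: ac_simps)
    then show ?thesis unfolding 2 by (simp only: ac_simps)
  qed
  then show "hmul a g \<in> sT" using a g by (simp add: sT_iff sA_iff hmul_def psym_mult)
next
  fix a b :: "'k hom" and c assume a: "a \<in> sT" "b \<in> sT" "snd a = snd b"
  then have 1: "fst a x 0 = x * (x + snd b) * fst a x 1" "fst b x 0 = x * (x + snd b) * fst b x 1" for x
    by (auto simp: sT_iff)
  show "hadd c a b \<in> sT"
    using a psym_lin[of "fst a" "fst b" c] unfolding sT_iff hadd_def fst_conv snd_conv 1(1) 1(2)
    by (simp add: algebra_simps)
qed (simp add: sT_iff)

lemma amod_sA1: "amod (sA1 :: 'k::field_char_0 hom set)"
proof (rule amodI)
  fix a g :: "'k hom" assume a: "a \<in> sA" and g: "g \<in> sA1"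
  have "fst a x 0 * fst g (x + snd a) 0 * (x + (snd a + snd g))
     = x * (fst a x 1 * fst g (x + snd a) 1)" for x
  proof -
    have 1: "fst g (x + snd a) 0 * (x + snd a + snd g) = (x + snd a) * fst g (x + snd a) 1"
      using g by (simp add: sA1_iff)
    have 2: "fst a x 0 * (x + snd a) = x * fst a x 1" using a by (simp add: sA_iff)
    have "fst a x 0 * fst g (x + snd a) 0 * (x + (snd a + snd g))
      = fst a x 0 * (fst g (x + snd a) 0 * (x + snd a + snd g))" by (simp only: ac_simps)
    also have "\<dots> = (fst a x 0 * (x + snd a)) * fst g (x + snd a) 1"
      unfolding 1 by (simp only: ac_simps)
    also have "\<dots> = x * (fst a x 1 * fst g (x + snd a) 1)" unfolding 2 by (simp only: ac_simps)
    finally show ?thesis .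
  qed
  then show "hmul a g \<in> sA1" using a g by (simp add: sA1_iff sA_iff hmul_def psym_mult)
next
  fix a b :: "'k hom" and c assume a: "a \<in> sA1" "b \<in> sA1" "snd a = snd b"
  then have "fst a x 0 * (x + snd b) = x * fst a x 1" "fst b x 0 * (x + snd b) = x * fst b x 1" for x
    by (auto simp: sA1_iff)
  then have "(fst a x 0 + c * fst b x 0) * (x + snd b) = x * (fst a x 1 + c * fst b x 1)" for x
    by (simp only: distrib_left[of x] distrib_right[of _ _ "x + snd b"] mult.assoc mult.left_commute[of x c])
  then show "hadd c a b \<in> sA1"
    using a psym_lin[of "fst a" "fst b" c] by (simp add: sA1_iff hadd_def)
qed (simp add: sA1_iff)

text \<open>At x = 0 the condition of \<open>sA1\<close> reads p(0,0) l = 0. Hence the two sets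
  agree in every degree l \<noteq> 0, and in degree 0 they differ by the constants, that is, by the
  adjoined unit.\<close>

lemma sA_sA1: "sA = {a \<in> sA1. fst a 0 0 = 0}"
  by (auto simp: sA_iff sA1_iff)

lemma amod_sA: "amod (sA :: 'k::field_char_0 hom set)"
proof -
  have "hmul a g \<in> sA" if "a \<in> sA" "g \<in> sA" for a g :: "'k hom"
    using amod_sA1 that unfolding sA_sA1 amod_def by (auto simp: hmul_def)
  moreover have "hadd c a b \<in> sA" if "a \<in> sA" "b \<in> sA" "snd a = snd b" for a b :: "'k hom" and c
    using amod_sA1 that unfolding sA_sA1 amod_def by (auto simp: hadd_def)
  ultimately show ?thesis by (intro amodI) (auto simp: sA_iff)
qed

lemma amodD:
  assumes "amod X"
  shows "a \<in> sA \<Longrightarrow> g \<in> X \<Longrightarrow> hmul a g \<in> X" "g \<in> X \<Longrightarrow> psym (fst g)"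
    "g \<in> X \<Longrightarrow> h \<in> X \<Longrightarrow> snd g = snd h \<Longrightarrow> hadd c g h \<in> X"
  using assms by (auto simp: amod_def)

section \<open>Polynomial multilinear cochains\<close>

abbreviation fits :: "'k::field_char_0 hom list \<Rightarrow> 'k hom set list \<Rightarrow> bool" where
  "fits l Xs \<equiv> list_all2 (\<in>) l Xs"

text \<open>For X = \<open>sA\<close> these lists are the arguments of Hochschild cochains of degree
  m + 1.\<close>

definition slots :: "nat \<Rightarrow> 'k::field_char_0 hom set \<Rightarrow> 'k hom set list" where
  "slots m X = replicate m sA @ [X]"

definition mlin :: "'k::field_char_0 hom set list \<Rightarrow> ('k hom list \<Rightarrow> 'k \<Rightarrow> 'k) \<Rightarrow> bool" where
  "mlin Xs f \<longleftrightarrow> (\<forall>l1 a b l2 c x. fits (l1 @ a # l2) Xs \<longrightarrow> fits (l1 @ b # l2) Xs \<longrightarrow> snd a = snd b \<longrightarrow>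
     f (l1 @ hadd c a b # l2) x = f (l1 @ a # l2) x + c * f (l1 @ b # l2) x)"

text \<open>Polynomial dependence on the formal variables, rephrased for numerical arguments. F may
  depend on y because fixing the first argument at a member of a family, as in
  \<open>pfam_Cons\<close>, produces such cochains.\<close>

definition pfam :: "'k::field_char_0 hom set list \<Rightarrow> ((nat \<Rightarrow> 'k) \<Rightarrow> 'k hom list \<Rightarrow> 'k \<Rightarrow> 'k) \<Rightarrow> bool" where
  "pfam Xs F \<longleftrightarrow> (\<forall>L \<xi>. (\<forall>H\<in>set L. hfam H) \<longrightarrow> (\<forall>y. fits (map (\<lambda>H. H y) L) Xs) \<longrightarrow>
     \<xi> \<in> polyfun UNIV \<longrightarrow> (\<lambda>y. F y (map (\<lambda>H. H y) L) (\<xi> y)) \<in> polyfun UNIV)"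

definition good :: "'k::field_char_0 hom set list \<Rightarrow> ('k hom list \<Rightarrow> 'k \<Rightarrow> 'k) \<Rightarrow> bool" where
  "good Xs f \<longleftrightarrow> mlin Xs f \<and> pfam Xs (\<lambda>_. f)"

lemma mlinD:
  "mlin Xs f \<Longrightarrow> fits (l1 @ a # l2) Xs \<Longrightarrow> fits (l1 @ b # l2) Xs \<Longrightarrow> snd a = snd b \<Longrightarrow>
     f (l1 @ hadd c a b # l2) x = f (l1 @ a # l2) x + c * f (l1 @ b # l2) x"
  unfolding mlin_def by blast

lemma mlin_last:
  assumes "mlin (slots m X) f" "fits l (replicate m sA)" "g \<in> X" "h \<in> X" "snd g = snd h"
  shows "f (l @ [hadd c g h]) x = f (l @ [g]) x + c * f (l @ [h]) x"
proof -
  have "fits (l @ [g]) (slots m X)" "fits (l @ [h]) (slots m X)"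
    using assms by (auto simp: slots_def intro!: list_all2_appendI)
  then show ?thesis using mlinD[OF assms(1), of l g "[]" h c x] assms(5) by simp
qed

lemma pfamD:
  "pfam Xs F \<Longrightarrow> (\<And>H. H \<in> set L \<Longrightarrow> hfam H) \<Longrightarrow> (\<And>y. fits (map (\<lambda>H. H y) L) Xs) \<Longrightarrow>
     \<xi> \<in> polyfun UNIV \<Longrightarrow> (\<lambda>y. F y (map (\<lambda>H. H y) L) (\<xi> y)) \<in> polyfun UNIV"
  by (auto simp: pfam_def)

lemma slots_Suc: "slots (Suc m) X = sA # slots m X"
  by (simp add: slots_def)

lemma slots_0: "slots 0 X = [X]"
  by (simp add: slots_def)

lemma slots_sA: "slots m sA = replicate (Suc m) sA"
  by (simp add: slots_def replicate_append_same)

lemma hadd_hmul: "hmul (hadd c a b) g = hadd c (hmul a g) (hmul b g)" if "snd a = snd b"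
  using that by (simp add: hmul_def hadd_def algebra_simps)

lemma hmul_hadd: "hmul g (hadd c a b) = hadd c (hmul g a) (hmul g b)"
  by (simp add: hmul_def hadd_def algebra_simps)

lemma hfam_hmul:
  assumes "hfam G" "hfam H" shows "hfam (\<lambda>y. hmul (G y) (H y))"
proof -
  have G: "psym_family (\<lambda>y. fst (G y))" "(\<lambda>y. snd (G y)) \<in> polyfun UNIV"
    and H: "psym_family (\<lambda>y. fst (H y))" "(\<lambda>y. snd (H y)) \<in> polyfun UNIV"
    using assms by (auto simp: hfam_def)
  show ?thesis unfolding hfam_def hmul_def fst_conv snd_conv
    by (intro conjI psym_familyI polyfun_intros psym_family_eval[OF G(1)] psym_family_eval[OF H(1)]
        polyfun_eval[OF G(2)] G(2) H(2))
qed

lemma hS_cong: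
  assumes "amod X" "\<And>l. fits l (slots m X) \<Longrightarrow> f l = g l" "fits l (slots (Suc m) X)"
  shows "hS f l = hS g l"
  using assms(2,3)
proof (induction m arbitrary: f g l)
  case 0
  then obtain a b where l: "l = [a, b]" "a \<in> sA" "b \<in> X"
    by (auto simp: slots_Suc slots_0 list_all2_Cons2)
  then have "f [hmul a b] = g [hmul a b]"
    using 0(1) amodD(1)[OF assms(1)] by (simp add: slots_0)
  then show ?case by (simp add: l)
next
  case (Suc m)
  then obtain a b l' where l: "l = a # b # l'" "a \<in> sA" "b \<in> sA" "fits l' (slots m X)"
    by (auto simp: slots_Suc list_all2_Cons2)
  have "hS (\<lambda>l. f (a # l)) (b # l') = hS (\<lambda>l. g (a # l)) (b # l')"
    using l Suc.prems by (intro Suc.IH) (auto simp: slots_Suc)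
  moreover have "f (hmul a b # l') = g (hmul a b # l')"
    using l by (intro Suc.prems(1)) (auto simp: slots_Suc amodD[OF amod_sA])
  ultimately show ?case by (simp add: l)
qed

lemma hcob_cong:
  assumes "amod X" "\<And>l. fits l (slots m X) \<Longrightarrow> f l = g l" "fits l (slots (Suc m) X)"
  shows "hcob \<Delta> f l = hcob \<Delta> g l"
proof -
  obtain a l' where l: "l = a # l'" "fits l' (slots m X)"
    using assms(3) by (auto simp: slots_Suc list_all2_Cons2)
  then have "f l' = g l'" using assms(2) by blast
  then show ?thesis using hS_cong[OF assms] by (simp add: l hact_def)
qed

lemma mlin_Cons: "mlin (sA # Xs) f \<Longrightarrow> a \<in> sA \<Longrightarrow> mlin Xs (\<lambda>l. f (a # l))"
  unfolding mlin_def
  by (metis append_Cons list_all2_Cons)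

lemma mlin_hS:
  assumes "amod X" "mlin (slots m X) f"
  shows "mlin (slots (Suc m) X) (hS f)"
  using assms(2)
proof (induction m arbitrary: f)
  case 0
  show ?case unfolding mlin_def
  proof (intro allI impI)
    fix l1 l2 :: "'a hom list" and a b c x
    assume f: "fits (l1 @ a # l2) (slots (Suc 0) X)" "fits (l1 @ b # l2) (slots (Suc 0) X)" "snd a = snd b"
    have lin: "f [hadd c g h] x = f [g] x + c * f [h] x" if "g \<in> X" "h \<in> X" "snd g = snd h" for g h
      using mlinD[OF 0, of "[]" g "[]" h c x] that by (simp add: slots_0)
    show "hS f (l1 @ hadd c a b # l2) x = hS f (l1 @ a # l2) x + c * hS f (l1 @ b # l2) x"
    proof (cases l1)
      case Nil
      with f obtain g where g: "l2 = [g]" "g \<in> X" "a \<in> sA" "b \<in> sA"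
        by (auto simp: slots_Suc slots_0 list_all2_Cons2)
      have "snd (hmul a g) = snd (hmul b g)" using f(3) by (simp add: hmul_def)
      then show ?thesis using f(3) Nil g lin[OF amodD(1)[OF assms(1) g(3,2)] amodD(1)[OF assms(1) g(4,2)]]
        by (simp add: hadd_hmul)
    next
      case (Cons u l1')
      with f have u: "l1' = []" "l2 = []" "u \<in> sA" "a \<in> X" "b \<in> X"
        by (auto simp: slots_Suc slots_0 list_all2_Cons2 append_eq_Cons_conv)
      have "snd (hmul u a) = snd (hmul u b)" using f(3) by (simp add: hmul_def)
      then show ?thesis using f(3) Cons u lin[OF amodD(1)[OF assms(1) u(3,4)] amodD(1)[OF assms(1) u(3,5)]]
        by (simp add: hmul_hadd)
    qed
  qed
next
  case (Suc m)
  show ?case unfolding mlin_def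
  proof (intro allI impI)
    fix l1 l2 :: "'a hom list" and a b c x
    assume f: "fits (l1 @ a # l2) (slots (Suc (Suc m)) X)" "fits (l1 @ b # l2) (slots (Suc (Suc m)) X)"
      "snd a = snd b"
    have IH: "mlin (slots (Suc m) X) (hS (\<lambda>l. f (u # l)))" if "u \<in> sA" for u
      using Suc.IH mlin_Cons Suc.prems that unfolding slots_Suc by blast
    have mA: "hmul u v \<in> sA" if "u \<in> sA" "v \<in> sA" for u v :: "'a hom" using amodD(1)[OF amod_sA that] .
    consider v l2' where "l1 = []" "l2 = v # l2'" | u where "l1 = [u]" | u v l1' where "l1 = u # v # l1'"
      using f(1) by (cases l1; cases "tl l1"; cases l2) (auto simp: slots_Suc slots_def)
    then show "hS f (l1 @ hadd c a b # l2) x = hS f (l1 @ a # l2) x + c * hS f (l1 @ b # l2) x"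
    proof cases
      case (1 v l2')
      have m: "a \<in> sA" "b \<in> sA" "v \<in> sA" "fits l2' (slots m X)" using f 1 by (auto simp: slots_Suc)
      have "hS (\<lambda>l. f (hadd c a b # l)) (v # l2') x
          = hS (\<lambda>l x. f (a # l) x + c * f (b # l) x) (v # l2') x"
        using m mlinD[OF Suc.prems, of "[]" a _ b] f(3)
        by (intro hS_cong[OF assms(1), THEN fun_cong, of m]) (auto simp: slots_Suc)
      then show ?thesis unfolding 1
        using mlinD[OF Suc.prems, of "[]" "hmul a v" l2' "hmul b v" c x] m f(3) mA
        by (simp add: hadd_hmul hS_lin slots_Suc) (simp add: hmul_def algebra_simps)
    next
      case (2 u)
      have m: "u \<in> sA" "a \<in> sA" "b \<in> sA" "fits l2 (slots m X)" using f 2 by (auto simp: slots_Suc)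
      show ?thesis unfolding 2
        using mlinD[OF IH[of u], of "[]" a l2 b c x] mlinD[OF Suc.prems, of "[]" "hmul u a" l2 "hmul u b" c x] m f(3) mA
        by (simp add: hmul_hadd slots_Suc) (simp add: hmul_def algebra_simps)
    next
      case (3 u v l1')
      have m: "u \<in> sA" "v \<in> sA" using f 3 by (auto simp: slots_Suc)
      show ?thesis unfolding 3
        using mlinD[OF IH[of u], of "v # l1'" a l2 b c x] f 3 m mA
          mlinD[OF Suc.prems, of "hmul u v # l1'" a l2 b c x]
        by (simp add: slots_Suc) (simp add: algebra_simps)
    qed
  qed
qed

lemma mlin_hcob:
  assumes "amod X" "mlin (slots m X) f"
  shows "mlin (slots (Suc m) X) (hcob \<Delta> f)"
  unfolding mlin_def
proof (intro allI impI)
  fix l1 l2 :: "'a hom list" and a b c x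
  assume f: "fits (l1 @ a # l2) (slots (Suc m) X)" "fits (l1 @ b # l2) (slots (Suc m) X)" "snd a = snd b"
  note S = mlinD[OF mlin_hS[OF assms] f, of c x]
  show "hcob \<Delta> f (l1 @ hadd c a b # l2) x = hcob \<Delta> f (l1 @ a # l2) x + c * hcob \<Delta> f (l1 @ b # l2) x"
  proof (cases l1)
    case Nil
    then show ?thesis using S f(3) by (simp add: hact_def hadd_def algebra_simps)
  next
    case (Cons u l1')
    then have "f (l1' @ hadd c a b # l2) x = f (l1' @ a # l2) x + c * f (l1' @ b # l2) x" for x
      using f by (intro mlinD[OF assms(2)]) (auto simp: slots_Suc)
    then show ?thesis using S Cons by (simp add: hact_def algebra_simps)
  qed
qed

lemma pfam_Cons:
  assumes "pfam (sA # Xs) F" "hfam H" "\<And>y. H y \<in> sA"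
  shows "pfam Xs (\<lambda>y l. F y (H y # l))"
  unfolding pfam_def
proof (intro allI impI)
  fix L :: "((nat \<Rightarrow> 'a) \<Rightarrow> 'a hom) list" and \<xi> :: "(nat \<Rightarrow> 'a) \<Rightarrow> 'a"
  assume "\<forall>H\<in>set L. hfam H" "\<forall>y. fits (map (\<lambda>H. H y) L) Xs" "\<xi> \<in> polyfun UNIV"
  then show "(\<lambda>y. F y (H y # map (\<lambda>H. H y) L) (\<xi> y)) \<in> polyfun UNIV"
    using pfamD[OF assms(1), of "H # L" \<xi>] assms(2,3) by auto
qed

lemma pfam_hS:
  assumes "amod X" "pfam (slots m X) F"
  shows "pfam (slots (Suc m) X) (\<lambda>y. hS (F y))"
  using assms(2)
proof (induction m arbitrary: F)
  case 0
  show ?case unfolding pfam_def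
  proof (intro allI impI)
    fix L :: "((nat \<Rightarrow> 'a) \<Rightarrow> 'a hom) list" and \<xi> :: "(nat \<Rightarrow> 'a) \<Rightarrow> 'a"
    assume L: "\<forall>H\<in>set L. hfam H" "\<forall>y. fits (map (\<lambda>H. H y) L) (slots (Suc 0) X)" "\<xi> \<in> polyfun UNIV"
    then obtain G H where GH: "L = [G, H]"
      by (auto simp: slots_Suc slots_0 list_all2_Cons2)
    then have "G y \<in> sA" "H y \<in> X" for y using L(2) by (auto simp: slots_Suc slots_0)
    then show "(\<lambda>y. hS (F y) (map (\<lambda>H. H y) L) (\<xi> y)) \<in> polyfun UNIV"
      using pfamD[OF 0, of "[\<lambda>y. hmul (G y) (H y)]" \<xi>] L GH
      by (simp add: hfam_hmul slots_0 amodD(1)[OF assms(1)])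
  qed
next
  case (Suc m)
  show ?case unfolding pfam_def
  proof (intro allI impI)
    fix L :: "((nat \<Rightarrow> 'a) \<Rightarrow> 'a hom) list" and \<xi> :: "(nat \<Rightarrow> 'a) \<Rightarrow> 'a"
    assume L: "\<forall>H\<in>set L. hfam H" "\<forall>y. fits (map (\<lambda>H. H y) L) (slots (Suc (Suc m)) X)" "\<xi> \<in> polyfun UNIV"
    then obtain G H L' where GH: "L = G # H # L'"
      by (auto simp: slots_Suc list_all2_Cons2)
    then have m: "G y \<in> sA" "H y \<in> sA" "fits (map (\<lambda>H. H y) L') (slots m X)" for y
      using L(2) by (auto simp: slots_Suc)
    have "hfam (\<lambda>y. hmul (G y) (H y))" using L(1) GH by (simp add: hfam_hmul)
    then have "(\<lambda>y. F y (map (\<lambda>H. H y) ((\<lambda>y. hmul (G y) (H y)) # L')) (\<xi> y)) \<in> polyfun UNIV"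
      using L(1,3) GH m by (intro pfamD[OF Suc.prems]) (auto simp: slots_Suc amodD(1)[OF amod_sA])
    then have 1: "(\<lambda>y. F y (hmul (G y) (H y) # map (\<lambda>H. H y) L') (\<xi> y)) \<in> polyfun UNIV" by simp
    have "pfam (slots m X) (\<lambda>y l. F y (G y # l))"
      using pfam_Cons Suc.prems m(1) L(1) GH by (auto simp: slots_Suc)
    then have 2: "(\<lambda>y. hS (\<lambda>l. F y (G y # l)) (map (\<lambda>H. H y) (H # L')) (\<xi> y)) \<in> polyfun UNIV"
      using L GH m by (intro pfamD[OF Suc.IH]) (auto simp: slots_Suc)
    show "(\<lambda>y. hS (F y) (map (\<lambda>H. H y) L) (\<xi> y)) \<in> polyfun UNIV"
      using polyfun_diff[OF 1 2] by (simp add: GH)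
  qed
qed

lemma pfam_hcob:
  assumes "amod X" "pfam (slots m X) (\<lambda>_. f)"
  shows "pfam (slots (Suc m) X) (\<lambda>_. hcob \<Delta> f)"
  unfolding pfam_def
proof (intro allI impI)
  fix L :: "((nat \<Rightarrow> 'a) \<Rightarrow> 'a hom) list" and \<xi> :: "(nat \<Rightarrow> 'a) \<Rightarrow> 'a"
  assume L: "\<forall>H\<in>set L. hfam H" "\<forall>y. fits (map (\<lambda>H. H y) L) (slots (Suc m) X)" "\<xi> \<in> polyfun UNIV"
  then obtain G L' where GL: "L = G # L'" by (auto simp: slots_Suc list_all2_Cons2)
  have G: "psym_family (\<lambda>y. fst (G y))" "(\<lambda>y. snd (G y)) \<in> polyfun UNIV"
    using L(1) GL by (auto simp: hfam_def)
  have 1: "(\<lambda>y. hS f (map (\<lambda>H. H y) L) (\<xi> y)) \<in> polyfun UNIV"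
    using L by (intro pfamD[OF pfam_hS[OF assms]]) auto
  have 2: "(\<lambda>y. f (map (\<lambda>H. H y) L') (\<xi> y + snd (G y))) \<in> polyfun UNIV"
    using L GL G by (intro pfamD[OF assms(2)]) (auto simp: slots_Suc intro: polyfun_intros)
  have 3: "(\<lambda>y. fst (G y) (\<xi> y) \<Delta>) \<in> polyfun UNIV"
    using psym_family_eval[OF G(1), of "\<lambda>y. y"] L(3) by (simp add: polyfun_intros)
  show "(\<lambda>y. hcob \<Delta> f (map (\<lambda>H. H y) L) (\<xi> y)) \<in> polyfun UNIV"
    using polyfun_diff[OF pf_mult[OF 3 2] 1] by (simp add: GL hact_def)
qed

lemma good_hcob: "amod X \<Longrightarrow> good (slots m X) f \<Longrightarrow> good (slots (Suc m) X) (hcob \<Delta> f)"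
  by (simp add: good_def mlin_hcob pfam_hcob)

lemma good_lin:
  assumes "good Xs f" "good Xs g" shows "good Xs (\<lambda>l x. f l x + c * g l x)"
proof -
  have "mlin Xs (\<lambda>l x. f l x + c * g l x)"
    using assms by (simp add: good_def mlin_def algebra_simps)
  moreover have "pfam Xs (\<lambda>_ l x. f l x + c * g l x)"
    unfolding pfam_def
  proof (intro allI impI)
    fix L :: "((nat \<Rightarrow> 'a) \<Rightarrow> 'a hom) list" and \<xi> :: "(nat \<Rightarrow> 'a) \<Rightarrow> 'a"
    assume L: "\<forall>H\<in>set L. hfam H" "\<forall>y. fits (map (\<lambda>H. H y) L) Xs" "\<xi> \<in> polyfun UNIV"
    show "(\<lambda>y. f (map (\<lambda>H. H y) L) (\<xi> y) + c * g (map (\<lambda>H. H y) L) (\<xi> y)) \<in> polyfun UNIV"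
      using assms L unfolding good_def by (intro polyfun_intros pfamD[of Xs "\<lambda>_. f"] pfamD[of Xs "\<lambda>_. g"]) auto
  qed
  ultimately show ?thesis by (simp add: good_def)
qed

lemma good_add: "good Xs f \<Longrightarrow> good Xs g \<Longrightarrow> good Xs (\<lambda>l x. f l x + g l x)"
  using good_lin[of Xs f g 1] by simp

lemma good_diff: "good Xs f \<Longrightarrow> good Xs g \<Longrightarrow> good Xs (\<lambda>l x. f l x - g l x)"
  using good_lin[of Xs f g "-1"] by simp

lemma good_scale: "good Xs f \<Longrightarrow> good Xs (\<lambda>l x. c * f l x)"
  using good_lin[of Xs f f "c - 1"] by (simp add: algebra_simps)

text \<open>Linearity within each degree is the condition, so that right multiplications are covered
  as well as the linear lifts and retractions, which do not commute with the left action.\<close>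

definition slotmap :: "'k::field_char_0 hom set \<Rightarrow> 'k hom set \<Rightarrow> ('k hom \<Rightarrow> 'k hom) \<Rightarrow> bool" where
  "slotmap X Y t \<longleftrightarrow> (\<forall>a\<in>X. t a \<in> Y) \<and>
     (\<forall>a\<in>X. \<forall>b\<in>X. \<forall>c. snd a = snd b \<longrightarrow> t (hadd c a b) = hadd c (t a) (t b) \<and> snd (t a) = snd (t b)) \<and>
     (\<forall>H. hfam H \<longrightarrow> (\<forall>y. H y \<in> X) \<longrightarrow> hfam (\<lambda>y. t (H y)))"

definition onlast :: "('k hom \<Rightarrow> 'k hom) \<Rightarrow> ('k hom list \<Rightarrow> 'k \<Rightarrow> 'k) \<Rightarrow> 'k hom list \<Rightarrow> 'k \<Rightarrow> 'k" where
  "onlast t f l = f (butlast l @ [t (last l)])"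

lemma onlast_snoc [simp]: "onlast t f (l @ [g]) = f (l @ [t g])"
  by (simp add: onlast_def)

lemma fits_slotsE:
  assumes "fits l (slots m X)"
  obtains l' g where "l = l' @ [g]" "fits l' (replicate m sA)" "g \<in> X"
  using assms unfolding slots_def by (auto simp: list_all2_append2 list_all2_Cons2)

lemma fits_slots_snoc: "fits (l @ [g]) (slots m X) \<longleftrightarrow> fits l (replicate m sA) \<and> g \<in> X"
  by (cases "length l = m") (auto simp: slots_def list_all2_append dest: list_all2_lengthD)

lemma slotmapD:
  assumes "slotmap X Y t"
  shows "a \<in> X \<Longrightarrow> t a \<in> Y"
    "a \<in> X \<Longrightarrow> b \<in> X \<Longrightarrow> snd a = snd b \<Longrightarrow> t (hadd c a b) = hadd c (t a) (t b)"
    "a \<in> X \<Longrightarrow> b \<in> X \<Longrightarrow> snd a = snd b \<Longrightarrow> snd (t a) = snd (t b)"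
    "hfam H \<Longrightarrow> (\<And>y. H y \<in> X) \<Longrightarrow> hfam (\<lambda>y. t (H y))"
  using assms unfolding slotmap_def by blast+

lemma good_onlast:
  assumes "slotmap X Y t" "good (slots m Y) f"
  shows "good (slots m X) (onlast t f)"
  unfolding good_def
proof
  show "mlin (slots m X) (onlast t f)"
    unfolding mlin_def
  proof (intro allI impI)
    fix l1 l2 :: "'a hom list" and a b c x
    assume f: "fits (l1 @ a # l2) (slots m X)" "fits (l1 @ b # l2) (slots m X)" "snd a = snd b"
    show "onlast t f (l1 @ hadd c a b # l2) x = onlast t f (l1 @ a # l2) x + c * onlast t f (l1 @ b # l2) x"
    proof (cases l2 rule: rev_cases)
      case Nil
      with f have m: "fits l1 (replicate m sA)" "a \<in> X" "b \<in> X" by (simp_all add: fits_slots_snoc)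
      have "f (l1 @ [hadd c (t a) (t b)]) x = f (l1 @ [t a]) x + c * f (l1 @ [t b]) x"
        using assms(2) m unfolding good_def
        by (intro mlin_last[of m Y] slotmapD(1)[OF assms(1)] slotmapD(3)[OF assms(1) _ _ f(3)]) simp_all
      moreover have "t (hadd c a b) = hadd c (t a) (t b)"
        using m f(3) by (intro slotmapD(2)[OF assms(1)])
      ultimately show ?thesis by (simp add: Nil)
    next
      case (snoc l2' g)
      have "fits ((l1 @ a # l2') @ [g]) (slots m X)" "fits ((l1 @ b # l2') @ [g]) (slots m X)"
        using f snoc by simp_all
      then have "fits ((l1 @ a # l2') @ [t g]) (slots m Y)" "fits ((l1 @ b # l2') @ [t g]) (slots m Y)"
        unfolding fits_slots_snoc by (simp_all add: slotmapD(1)[OF assms(1)])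
      then have "f (l1 @ hadd c a b # l2' @ [t g]) x
          = f (l1 @ a # l2' @ [t g]) x + c * f (l1 @ b # l2' @ [t g]) x"
        using assms(2) f(3) unfolding good_def by (intro mlinD[of "slots m Y"]) simp_all
      moreover have "onlast t f (l1 @ u # l2' @ [g]) = f (l1 @ u # l2' @ [t g])" for u
        using onlast_snoc[of t f "l1 @ u # l2'" g] by simp
      ultimately show ?thesis by (simp add: snoc)
    qed
  qed
  show "pfam (slots m X) (\<lambda>_. onlast t f)"
    unfolding pfam_def
  proof (intro allI impI)
    fix L :: "((nat \<Rightarrow> 'a) \<Rightarrow> 'a hom) list" and \<xi> :: "(nat \<Rightarrow> 'a) \<Rightarrow> 'a"
    assume L: "\<forall>H\<in>set L. hfam H" "\<forall>y. fits (map (\<lambda>H. H y) L) (slots m X)" "\<xi> \<in> polyfun UNIV"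
    have "L \<noteq> []" using L(2) by (cases L) (simp_all add: slots_def)
    then obtain L' G where LG: "L = L' @ [G]" by (cases L rule: rev_cases) simp_all
    have m: "fits (map (\<lambda>H. H y) L') (replicate m sA)" "G y \<in> X" for y
      using L(2) by (simp_all add: LG fits_slots_snoc)
    have "(\<lambda>y. f (map (\<lambda>H. H y) (L' @ [\<lambda>y. t (G y)])) (\<xi> y)) \<in> polyfun UNIV"
    proof (rule pfamD[of "slots m Y" "\<lambda>_. f"])
      show "pfam (slots m Y) (\<lambda>_. f)" using assms(2) by (simp add: good_def)
      show "hfam H" if "H \<in> set (L' @ [\<lambda>y. t (G y)])" for H
        using that L(1) m(2) slotmapD(4)[OF assms(1), of G] by (auto simp: LG)
      show "fits (map (\<lambda>H. H y) (L' @ [\<lambda>y. t (G y)])) (slots m Y)" for y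
        using m by (simp add: fits_slots_snoc slotmapD(1)[OF assms(1)])
    qed (rule L(3))
    then show "(\<lambda>y. onlast t f (map (\<lambda>H. H y) L) (\<xi> y)) \<in> polyfun UNIV"
      by (simp add: LG)
  qed
qed

lemma good_append:
  assumes "w \<in> X" "psym (fst w)" "good (slots (Suc m) X) f"
  shows "good (slots m sA) (\<lambda>l. f (l @ [w]))"
  unfolding good_def
proof
  have r: "fits (l @ [w]) (slots (Suc m) X)" if "fits l (slots m sA)" for l
    using that assms(1) by (simp add: fits_slots_snoc slots_sA)
  show "mlin (slots m sA) (\<lambda>l. f (l @ [w]))"
    unfolding mlin_def
  proof (intro allI impI)
    fix l1 l2 :: "'a hom list" and a b c x
    assume f: "fits (l1 @ a # l2) (slots m sA)" "fits (l1 @ b # l2) (slots m sA)" "snd a = snd b"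
    show "f ((l1 @ hadd c a b # l2) @ [w]) x = f ((l1 @ a # l2) @ [w]) x + c * f ((l1 @ b # l2) @ [w]) x"
      using mlinD[of "slots (Suc m) X" f l1 a "l2 @ [w]" b c x] r[OF f(1)] r[OF f(2)] f(3) assms(3)
      by (simp add: good_def)
  qed
  show "pfam (slots m sA) (\<lambda>_ l. f (l @ [w]))"
    unfolding pfam_def
  proof (intro allI impI)
    fix L :: "((nat \<Rightarrow> 'a) \<Rightarrow> 'a hom) list" and \<xi> :: "(nat \<Rightarrow> 'a) \<Rightarrow> 'a"
    assume L: "\<forall>H\<in>set L. hfam H" "\<forall>y. fits (map (\<lambda>H. H y) L) (slots m sA)" "\<xi> \<in> polyfun UNIV"
    have "(\<lambda>y. f (map (\<lambda>H. H y) (L @ [\<lambda>_. w])) (\<xi> y)) \<in> polyfun UNIV"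
    proof (rule pfamD[of "slots (Suc m) X" "\<lambda>_. f"])
      show "pfam (slots (Suc m) X) (\<lambda>_. f)" using assms(3) by (simp add: good_def)
      show "hfam H" if "H \<in> set (L @ [\<lambda>_. w])" for H
        using that L(1) assms(2) by (auto simp: hfam_def pf_const)
      show "fits (map (\<lambda>H. H y) (L @ [\<lambda>_. w])) (slots (Suc m) X)" for y
        using r L(2) by simp
    qed (rule L(3))
    then show "(\<lambda>y. f (map (\<lambda>H. H y) L @ [w]) (\<xi> y)) \<in> polyfun UNIV" by simp
  qed
qed

section \<open>Maps between the modules of the resolution\<close>

definition eh :: "'k::field_char_0 hom" where "eh = (\<lambda>x s. s * (1 - s), 0)"
definition om :: "'k::field_char_0 sym" where "om x s = (1 - s) * x + s"
definition rho :: "'k::field_char_0 sym" where "rho x s = (1 - s) + s * x"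
definition omh :: "'k::field_char_0 hom" where "omh = (om, 0)"
definition rhoh :: "'k::field_char_0 hom" where "rhoh = (rho, 0)"
definition oneh :: "'k::field_char_0 hom" where "oneh = (\<lambda>x s. 1, 0)"

text \<open>\<open>sE\<close> is projective, with dual basis \<open>omh\<close>, \<open>omh1\<close> and coordinates \<open>r1h\<close>, \<open>r2h\<close>: the identity
  \<open>r1(x) om(x) + r2(x) om(x - 1) = 1\<close> replaces \<open>[d/dx, x] = 1\<close>.  The polynomials are \<open>rho(x)\<close> and
  \<open>- rho(x - 1)\<close>, corrected by a multiple of \<open>s(1 - s)\<close> to make it exact.\<close>

definition omh1 :: "'k::field_char_0 hom" where "omh1 = (om, 1)"
definition r1h :: "'k::field_char_0 hom" where
  "r1h = (\<lambda>x s. rho x s + s * (1 - s) * (3 - 2 * x) * (2 - x), 0)"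
definition r2h :: "'k::field_char_0 hom" where
  "r2h = (\<lambda>x s. - rho (x - 1) s - s * (1 - s) * (3 - 2 * x) * (1 - x), - 1)"

abbreviation rm :: "'k::field_char_0 hom \<Rightarrow> 'k hom \<Rightarrow> 'k hom" where
  "rm w g \<equiv> hmul g w"

lemma psym_e: "psym (\<lambda>x s. s * (1 - s))" by (rule psym_familyI) (intro polyfun_intros)
lemma psym_om: "psym om" unfolding om_def by (rule psym_familyI) (intro polyfun_intros)
lemma psym_rho: "psym rho" unfolding rho_def by (rule psym_familyI) (intro polyfun_intros)

lemma psym_consts [simp]:
  "psym (fst eh)" "psym (fst omh)" "psym (fst rhoh)" "psym (fst oneh)" "psym (fst omh1)"
  "psym (fst r1h)" "psym (fst r2h)"
proof -
  show "psym (fst oneh)" unfolding oneh_def fst_conv by (rule psym_familyI) (intro polyfun_intros)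
  show "psym (fst r1h)" unfolding r1h_def rho_def fst_conv by (rule psym_familyI) (intro polyfun_intros)
  show "psym (fst r2h)" unfolding r2h_def rho_def fst_conv by (rule psym_familyI) (intro polyfun_intros)
qed (simp_all add: eh_def omh_def rhoh_def omh1_def psym_e psym_om psym_rho)

lemma hfam_const: "psym (fst w) \<Longrightarrow> hfam (\<lambda>_. w)"
  by (simp add: hfam_def pf_const)

lemma slotmap_rm:
  assumes "psym (fst w)" "\<And>g. g \<in> X \<Longrightarrow> rm w g \<in> Y"
  shows "slotmap X Y (rm w)"
  unfolding slotmap_def
proof (intro conjI ballI allI impI)
  show "hfam (\<lambda>y. rm w (H y))" if "hfam H" for H
    using that hfam_const[OF assms(1)] by (rule hfam_hmul)
qed (auto simp: assms(2) hadd_hmul, simp add: hmul_def)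

text \<open>The symbol s (1 - s) vanishes at s = 0 and s = 1, where the conditions of all four
  modules are imposed.\<close>

lemma rm_eh:
  assumes "psym (fst g)"
  shows "rm eh g \<in> sA" "rm eh g \<in> sE" "rm eh g \<in> sT" "rm eh g \<in> sA1"
proof -
  have "psym (fst (rm eh g))" using psym_mult[OF assms psym_e] by (simp add: hmul_def eh_def)
  then show "rm eh g \<in> sA" "rm eh g \<in> sE" "rm eh g \<in> sT" "rm eh g \<in> sA1"
    by (simp_all add: sA_iff sE_iff sT_iff sA1_iff hmul_def eh_def)
qed

lemma psym_rm: "psym (fst g) \<Longrightarrow> psym (fst w) \<Longrightarrow> psym (fst (rm w g))"
  by (simp add: hmul_def psym_mult)

text \<open>Only the ends count: \<open>rho\<close> is 1 and x there, \<open>om\<close> is x and 1.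
  The corrections in \<open>r1h\<close> and \<open>r2h\<close> carry the factor s (1 - s), so those
  two behave like \<open>rho\<close> and like its negative shifted by - 1.\<close>

lemma rm_sE:
  assumes "g \<in> sE"
  shows "rm rhoh g \<in> sA" "rm omh g \<in> sT" "rm r1h g \<in> sA" "rm r2h g \<in> sA"
proof -
  have g: "psym (fst g)" "fst g x 0 = x * fst g x 1" for x using assms by (auto simp: sE_iff)
  show "rm rhoh g \<in> sA" unfolding sA_iff
    by (intro conjI psym_rm g psym_consts) (simp_all add: hmul_def rhoh_def rho_def g(2))
  show "rm omh g \<in> sT" unfolding sT_iff
    by (intro conjI psym_rm g psym_consts) (simp_all add: hmul_def omh_def om_def g(2))
  show "rm r1h g \<in> sA" unfolding sA_iff
    by (intro conjI psym_rm g psym_consts) (simp_all add: hmul_def r1h_def rho_def g(2))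
  show "rm r2h g \<in> sA" unfolding sA_iff
    by (intro conjI psym_rm g psym_consts) (simp_all add: hmul_def r2h_def rho_def g(2) algebra_simps)
qed

lemma rm_sT:
  assumes "g \<in> sT" shows "rm rhoh g \<in> sE"
proof -
  have g: "psym (fst g)" "fst g x 0 = x * (x + snd g) * fst g x 1" for x using assms by (auto simp: sT_iff)
  show ?thesis unfolding sE_iff
    by (intro conjI psym_rm g psym_consts) (simp_all add: hmul_def rhoh_def rho_def g(2))
qed

lemma rm_sA1:
  assumes "g \<in> sA1" shows "rm omh g \<in> sE"
proof -
  have g: "psym (fst g)" "fst g x 0 * (x + snd g) = x * fst g x 1" for x using assms by (auto simp: sA1_iff)
  show ?thesis unfolding sE_iff
    by (intro conjI psym_rm g psym_consts) (simp_all add: hmul_def omh_def om_def g(2))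
qed

lemma basis_sE: "omh \<in> sE" "omh1 \<in> sE"
  using psym_om by (simp_all add: sE_iff omh_def omh1_def om_def[abs_def])

lemma oneh_sA1: "oneh \<in> sA1"
  using psym_consts(4) by (simp add: sA1_iff oneh_def)

text \<open>The product om(x) rho(x) changes by 1 + s (1 - s) (2 x - 3) between x - 1 and x. The
  defect is removed by s (1 - s) (3 - 2 x) times the identity (2 - x) om(x) - (1 - x) om(x - 1) = 1,
  which explains the constants in \<open>r1h\<close> and \<open>r2h\<close>.\<close>

lemma dual_basis: "hadd 1 (rm omh (rm r1h g)) (rm omh1 (rm r2h g)) = g"
proof (rule prod_eqI)
  have id: "(rho y s + s * (1 - s) * (3 - 2 * y) * (2 - y)) * om y s
     + (- rho (y - 1) s - s * (1 - s) * (3 - 2 * y) * (1 - y)) * om (y - 1) s = 1" for y s :: 'a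
    by (simp add: rho_def om_def) algebra
  have fac: "A * B * C + 1 * (A * B' * C') = A" if "B * C + B' * C' = 1" for A B C B' C' :: 'a
    using arg_cong[OF that, of "\<lambda>t. A * t"] by (simp only: distrib_left mult.assoc mult_1_left mult_1_right)
  show "fst (hadd 1 (rm omh (rm r1h g)) (rm omh1 (rm r2h g))) = fst g"
    unfolding hmul_def hadd_def omh_def omh1_def r1h_def r2h_def fst_conv snd_conv
  proof (intro ext fac)
    fix x s
    show "(rho (x + snd g) s + s * (1 - s) * (3 - 2 * (x + snd g)) * (2 - (x + snd g))) * om (x + (snd g + 0)) s +
       (- rho (x + snd g - 1) s - s * (1 - s) * (3 - 2 * (x + snd g)) * (1 - (x + snd g))) * om (x + (snd g + - 1)) s = 1"
      using id[of "x + snd g" s] by (simp add: add_diff_eq)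
  qed
qed (simp add: hmul_def hadd_def omh_def r1h_def)

lemma rm_comm:
  "rm eh (rm rhoh g) = rm rhoh (rm eh g)" "rm eh (rm omh g) = rm omh (rm eh g)"
  "rm omh (rm rhoh g) = rm rhoh (rm omh g)"
  by (simp_all add: hmul_def eh_def rhoh_def omh_def mult_ac)

lemma rm_oneh [simp]: "rm oneh g = g"
  by (simp add: hmul_def oneh_def)

lemma hcob_onlast_rm: "hcob \<Delta> (onlast (rm w) f) (l @ [a, g]) x = hcob \<Delta> f (l @ [a, rm w g]) x"
  unfolding hcob_snoc by (simp add: hmul_assoc)

lemma hcob_append:
  "hcob \<Delta> (\<lambda>l. f (l @ [w])) (l @ [a]) x
     = hcob \<Delta> f (l @ [a, w]) x + (-1) ^ length l * f (l @ [hmul a w]) x"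
  by (simp add: hcob_snoc)

lemma fits_snoc2:
  "fits (l @ [a, g]) (slots (Suc m) X) \<longleftrightarrow> fits l (replicate m sA) \<and> a \<in> sA \<and> g \<in> X"
  using fits_slots_snoc[of "l @ [a]" g "Suc m" X] fits_slots_snoc[of l a m sA] by (simp add: slots_sA)

lemma fits_slots_SucE:
  assumes "fits l (slots (Suc m) X)"
  obtains l' a g where "l = l' @ [a, g]" "fits l' (replicate m sA)" "a \<in> sA" "g \<in> X"
proof -
  obtain l1 g where l1: "l = l1 @ [g]" "fits l1 (slots m sA)" "g \<in> X"
    using fits_slotsE[OF assms] unfolding slots_sA by blast
  obtain l' a where "l1 = l' @ [a]" "fits l' (replicate m sA)" "a \<in> sA"
    using fits_slotsE[OF l1(2)] by blast
  then show ?thesis using that l1 by simp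
qed

lemma hcob_congA:
  assumes "\<And>l. fits l (replicate k sA) \<Longrightarrow> f l = g l" "fits l (replicate (Suc k) sA)"
  shows "hcob \<Delta> f l = hcob \<Delta> g l"
proof (cases k)
  case 0
  then obtain a where "l = [a]" using assms(2) by (auto simp: list_all2_Cons2)
  then show ?thesis using assms(1)[of "[]"] 0 by simp
next
  case (Suc j)
  then show ?thesis using assms by (intro hcob_cong[OF amod_sA, of j]) (simp_all add: slots_sA)
qed

section \<open>Acyclicity of the complexes with last slot \<open>sE\<close>\<close>

text \<open>The contracting homotopy of a projective module: g is expanded in the dual basis, its
  coordinates lie in \<open>sA\<close> and become an ordinary argument, and the basis element takes
  the last slot.\<close>

definition contr :: "nat \<Rightarrow> ('k::field_char_0 hom list \<Rightarrow> 'k \<Rightarrow> 'k) \<Rightarrow> 'k hom list \<Rightarrow> 'k \<Rightarrow> 'k" where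
  "contr m f = (\<lambda>l x. (-1) ^ Suc m *
     (onlast (rm r1h) (\<lambda>l. f (l @ [omh])) l x + onlast (rm r2h) (\<lambda>l. f (l @ [omh1])) l x))"

lemma good_contr:
  assumes "good (slots (Suc m) sE) f" shows "good (slots m sE) (contr m f)"
  unfolding contr_def
  by (intro good_scale good_add good_onlast[where Y = sA] slotmap_rm good_append[where X = sE] assms
      rm_sE basis_sE psym_consts)

text \<open>The cocycle condition on l', a, coordinate, basis element leaves only the term where the
  last two are multiplied; the dual basis identity sums these terms to g.\<close>

lemma hcob_contr:
  assumes "good (slots (Suc m) sE) f"
    and "\<And>l x. fits l (slots (Suc (Suc m)) sE) \<Longrightarrow> hcob \<Delta> f l x = 0"
    and "fits l (slots (Suc m) sE)"
  shows "hcob \<Delta> (contr m f) l x = f l x"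
proof -
  obtain l' a g where l: "l = l' @ [a, g]" "fits l' (replicate m sA)" "a \<in> sA" "g \<in> sE"
    using fits_slots_SucE[OF assms(3)] by blast
  have len: "length l' = m" using l(2) by (auto dest: list_all2_lengthD)
  have part: "hcob \<Delta> (onlast (rm r) (\<lambda>l. f (l @ [w]))) l x = (-1) ^ Suc m * f (l' @ [a, rm w (rm r g)]) x"
    if "rm r g \<in> sA" "w \<in> sE" for r w
  proof -
    have "fits ((l' @ [a]) @ [rm r g, w]) (slots (Suc (Suc m)) sE)"
      using l that fits_slots_snoc[of l' a m sA] by (simp only: fits_snoc2) (simp add: slots_sA)
    then have 0: "hcob \<Delta> f ((l' @ [a]) @ [rm r g, w]) x = 0" by (rule assms(2))
    have "hcob \<Delta> (onlast (rm r) (\<lambda>l. f (l @ [w]))) l x = hcob \<Delta> (\<lambda>l. f (l @ [w])) ((l' @ [a]) @ [rm r g]) x"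
      unfolding l hcob_onlast_rm by simp
    also have "\<dots> = (-1) ^ Suc m * f (l' @ [a, rm w (rm r g)]) x"
      unfolding hcob_append 0 using len by simp
    finally show ?thesis .
  qed
  have sgn: "(-1) ^ Suc m * (-1) ^ Suc m = (1::'a)"
    by (simp add: power_mult_distrib[symmetric])
  let ?F1 = "onlast (rm r1h) (\<lambda>l. f (l @ [omh]))" and ?F2 = "onlast (rm r2h) (\<lambda>l. f (l @ [omh1]))"
  have "hcob \<Delta> (contr m f) l x = (-1) ^ Suc m * (hcob \<Delta> ?F1 l x + hcob \<Delta> ?F2 l x)"
  proof -
    have "hcob \<Delta> (\<lambda>l x. 0 + (-1) ^ Suc m * (?F1 l x + 1 * ?F2 l x)) l x
        = hcob \<Delta> (\<lambda>l x. 0) l x + (-1) ^ Suc m * hcob \<Delta> (\<lambda>l x. ?F1 l x + 1 * ?F2 l x) l x"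
      by (rule hcob_lin)
    moreover have "hcob \<Delta> (\<lambda>l x. ?F1 l x + 1 * ?F2 l x) l x = hcob \<Delta> ?F1 l x + 1 * hcob \<Delta> ?F2 l x"
      by (rule hcob_lin)
    moreover have "hcob \<Delta> (\<lambda>l x. 0) l x = 0"
      using hcob_lin[of \<Delta> "\<lambda>l x. 0" "-1" "\<lambda>l x. 0" l x] by simp
    ultimately show ?thesis unfolding contr_def by simp
  qed
  also have "\<dots> = f (l' @ [a, rm omh (rm r1h g)]) x + f (l' @ [a, rm omh1 (rm r2h g)]) x"
    unfolding part[OF rm_sE(3)[OF l(4)] basis_sE(1)] part[OF rm_sE(4)[OF l(4)] basis_sE(2)]
    by (simp only: distrib_left[symmetric] mult.assoc[symmetric] sgn mult_1_left)
  also have "\<dots> = f ((l' @ [a]) @ [hadd 1 (rm omh (rm r1h g)) (rm omh1 (rm r2h g))]) x"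
  proof -
    have "rm omh (rm r1h g) \<in> sE" "rm omh1 (rm r2h g) \<in> sE"
      using l(4) rm_sE(3,4) basis_sE amodD(1)[OF amod_sE] by blast+
    moreover have "snd (rm omh (rm r1h g)) = snd (rm omh1 (rm r2h g))"
      by (simp add: hmul_def omh_def omh1_def r1h_def r2h_def)
    moreover have "fits (l' @ [a]) (replicate (Suc m) sA)"
      using l fits_slots_snoc[of l' a m sA] by (simp add: slots_sA)
    ultimately show ?thesis
      using mlin_last[of "Suc m" sE f "l' @ [a]" _ _ 1 x] assms(1) by (simp add: good_def)
  qed
  finally show ?thesis unfolding dual_basis l by simp
qed

text \<open>The coboundary meets the last argument in two forms only, F itself and a F, so a
  decomposition of d is required just for these.\<close>

lemma hcob_descend:
  assumes "fits l (replicate k sA)" "a \<in> sA"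
    and "\<And>l. fits l (replicate k sA) \<Longrightarrow> d (l @ [F]) = (\<lambda>x. f1 (l @ [G]) x + f2 (l @ [H]) x)"
    and "d (l @ [hmul a F]) x = f1 (l @ [hmul a G]) x + f2 (l @ [hmul a H]) x"
  shows "hcob \<Delta> d (l @ [a, F]) x = hcob \<Delta> f1 (l @ [a, G]) x + hcob \<Delta> f2 (l @ [a, H]) x"
proof -
  have "fits (l @ [a]) (replicate (Suc k) sA)"
    using assms(1,2) fits_slots_snoc[of l a k sA] by (simp add: slots_sA)
  then have "hcob \<Delta> (\<lambda>l. d (l @ [F])) (l @ [a]) x
      = hcob \<Delta> (\<lambda>l x. f1 (l @ [G]) x + 1 * f2 (l @ [H]) x) (l @ [a]) x"
    using assms(3) by (intro hcob_congA[THEN fun_cong]) simp_all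
  also have "\<dots> = hcob \<Delta> (\<lambda>l. f1 (l @ [G])) (l @ [a]) x + 1 * hcob \<Delta> (\<lambda>l. f2 (l @ [H])) (l @ [a]) x"
    by (rule hcob_lin)
  finally show ?thesis unfolding hcob_snoc assms(4) by (simp add: distrib_left)
qed

lemma psym_dive: "psym p \<Longrightarrow> psym (dive p)"
  by (rule psym_family_dive)

lemma psym_divx: "psym p \<Longrightarrow> psym (\<lambda>x s. divx (\<lambda>x. p x s) x)"
  by (rule psym_family_divx)

lemma dive_lin:
  assumes "psym p" "psym q"
  shows "dive (\<lambda>x s. p x s + c * q x s) = (\<lambda>x s. dive p x s + c * dive q x s)"
proof (rule dive_unique)
  show "psym (\<lambda>x s. dive p x s + c * dive q x s)"
    using assms by (intro psym_lin psym_dive)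
  fix x s
  have "p x s + c * q x s - (1 - s) * (p x 0 + c * q x 0) - s * (p x 1 + c * q x 1)
     = (p x s - (1 - s) * p x 0 - s * p x 1) + c * (q x s - (1 - s) * q x 0 - s * q x 1)"
    by (simp add: algebra_simps)
  also have "p x s - (1 - s) * p x 0 - s * p x 1 = s * (1 - s) * dive p x s"
    by (subst dive_decomp[OF assms(1), of x s]) simp
  also have "q x s - (1 - s) * q x 0 - s * q x 1 = s * (1 - s) * dive q x s"
    by (subst dive_decomp[OF assms(2), of x s]) simp
  finally show "p x s + c * q x s - (1 - s) * (p x 0 + c * q x 0) - s * (p x 1 + c * q x 1)
     = s * (1 - s) * (dive p x s + c * dive q x s)" by (simp add: algebra_simps)
qed

lemma dive_e: "psym p \<Longrightarrow> dive (\<lambda>x s. p x s * (s * (1 - s))) = p"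
  by (rule dive_unique) simp_all

lemma divx_lin:
  assumes "psym p" "psym q"
  shows "divx (\<lambda>x. p x s + c * q x s) x = divx (\<lambda>x. p x s) x + c * divx (\<lambda>x. q x s) x"
proof -
  have "psym (\<lambda>x s. divx (\<lambda>x. p x s) x + c * divx (\<lambda>x. q x s) x)"
    using assms by (intro psym_lin psym_divx)
  then show ?thesis
  proof (rule divx_unique)
    fix x
    have "p x s = p 0 s + x * divx (\<lambda>x. p x s) x" "q x s = q 0 s + x * divx (\<lambda>x. q x s) x"
      by (rule divx_decomp[OF assms(1)], rule divx_decomp[OF assms(2)])
    then have "p x s - p 0 s = x * divx (\<lambda>x. p x s) x" "q x s - q 0 s = x * divx (\<lambda>x. q x s) x"
      by (metis add_diff_cancel_left')+
    moreover have "p x s + c * q x s - (p 0 s + c * q 0 s) = (p x s - p 0 s) + c * (q x s - q 0 s)"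
      by (simp add: algebra_simps)
    ultimately show "p x s + c * q x s - (p 0 s + c * q 0 s)
      = x * (divx (\<lambda>x. p x s) x + c * divx (\<lambda>x. q x s) x)" by (simp only: distrib_left mult.left_commute[of c])
  qed
qed

lemma e_decompI:
  assumes "psym p" "\<And>x. p x 0 = 0" "\<And>x. p x 1 = 0"
  shows "p x s = s * (1 - s) * dive p x s"
  using dive_decomp[OF assms(1), of x s] assms(2,3) by simp

lemma hfamD: "hfam H \<Longrightarrow> psym_family (\<lambda>y. fst (H y))" "hfam H \<Longrightarrow> (\<lambda>y. snd (H y)) \<in> polyfun UNIV"
  by (auto simp: hfam_def)

lemma psym_family_zero: "psym_family p \<Longrightarrow> psym_family (\<lambda>y x s. p y x c)"
  by (rule psym_familyI) (auto intro: psym_family_eval polyfun_intros)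

section \<open>Lifting along the surjections of the resolution\<close>

text \<open>By \<open>sA_divx\<close> the ends of F are x f and (x + l) f for one f. The product
  om(x) f(x) rho(x + l) has the same ends, and \<open>yA\<close> is the cofactor of s (1 - s) in the
  difference.\<close>

definition yA :: "'k::field_char_0 hom \<Rightarrow> 'k sym" where
  "yA F = dive (\<lambda>x s. fst F x s - om x s * divx (\<lambda>x. fst F x 0) x * rho (x + snd F) s)"

text \<open>Together with \<open>hA\<close> a linear section of (G, H) \<mapsto> G rho + H e. The
  naive pair (om f, \<open>yA\<close>) may violate the \<open>sE\<close> condition in its second
  entry; adding a multiple of (e, - rho) repairs it in every degree because \<open>rho\<close> is 1
  at s = 0.\<close>

definition gA :: "'k::field_char_0 hom \<Rightarrow> 'k hom" where
  "gA F = (\<lambda>x s. om x s * divx (\<lambda>x. fst F x 0) x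
      + s * (1 - s) * ((1 - s) * (yA F x 0 - x * yA F x 1)), snd F)"

definition hA :: "'k::field_char_0 hom \<Rightarrow> 'k hom" where
  "hA F = (\<lambda>x s. yA F x s - (1 - s) * (yA F x 0 - x * yA F x 1) * rho (x + snd F) s, snd F)"

lemma psym_family_yA: assumes "hfam H" shows "psym_family (\<lambda>y. yA (H y))"
proof -
  note H = hfamD[OF assms]
  have f: "psym_family (\<lambda>y x s. divx (\<lambda>x. fst (H y) x 0) x)"
    by (rule psym_family_zero[OF psym_family_divx[OF H(1)]])
  show ?thesis unfolding yA_def om_def rho_def
    by (rule psym_family_dive, rule psym_familyI)
       (intro polyfun_intros psym_family_eval[OF H(1)] psym_family_eval[OF f] polyfun_eval[OF H(2)])
qed

lemma hfam_gA: assumes "hfam H" shows "hfam (\<lambda>y. gA (H y))"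
proof -
  note H = hfamD[OF assms]
  have f: "psym_family (\<lambda>y x s. divx (\<lambda>x. fst (H y) x 0) x)"
    by (rule psym_family_zero[OF psym_family_divx[OF H(1)]])
  show ?thesis unfolding hfam_def gA_def om_def fst_conv snd_conv
    by (intro conjI psym_familyI H(2))
       (intro polyfun_intros psym_family_eval[OF H(1)] psym_family_eval[OF f]
         psym_family_eval[OF psym_family_yA[OF assms]])
qed

lemma hfam_hA: assumes "hfam H" shows "hfam (\<lambda>y. hA (H y))"
proof -
  note H = hfamD[OF assms]
  show ?thesis unfolding hfam_def hA_def rho_def fst_conv snd_conv
    by (intro conjI psym_familyI H(2))
       (intro polyfun_intros polyfun_eval[OF H(2)] psym_family_eval[OF psym_family_yA[OF assms]])
qed

text \<open>The second formula follows by cancelling x in F(x,0) (x + l) = x F(x,1), which is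
  legitimate for x \<noteq> 0 and extends to x = 0 by continuation.\<close>

lemma sA_divx:
  assumes "F \<in> sA"
  shows "fst F x 0 = x * divx (\<lambda>x. fst F x 0) x" "fst F x 1 = (x + snd F) * divx (\<lambda>x. fst F x 0) x"
proof -
  define f where "f = divx (\<lambda>x. fst F x 0)"
  have F: "psym (fst F)" "fst F 0 0 = 0" "\<And>x. fst F x 0 * (x + snd F) = x * fst F x 1"
    using assms by (auto simp: sA_iff)
  have 0: "fst F x 0 = x * f x" for x using divx_decomp[OF F(1), of x 0] F(2) by (simp add: f_def)
  have "psym_family (\<lambda>(_::nat \<Rightarrow> 'a) x s. fst F x 1)" "psym_family (\<lambda>(_::nat \<Rightarrow> 'a) x s. (x + snd F) * f x)"
  proof -
    show "psym_family (\<lambda>(_::nat \<Rightarrow> 'a) x s. fst F x 1)" by (rule psym_family_zero[OF F(1)])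
    have f: "psym (\<lambda>x s. f x)" unfolding f_def by (rule psym_family_zero[OF psym_divx[OF F(1)]])
    show "psym_family (\<lambda>(_::nat \<Rightarrow> 'a) x s. (x + snd F) * f x)"
      by (rule psym_familyI) (intro polyfun_intros psym_eval[OF f])
  qed
  from psym_family_line_x[OF this(1)] psym_family_line_x[OF this(2)]
  obtain p q where pq: "\<And>x. fst F x 1 = poly p x" "\<And>x. (x + snd F) * f x = poly q x" by metis
  have "p = q"
  proof (rule poly_cofinite_eq[of "{0}"])
    fix x :: 'a assume "x \<notin> {0}"
    moreover have "x * fst F x 1 = x * ((x + snd F) * f x)"
      unfolding F(3)[symmetric] 0 by (simp only: mult_ac)
    ultimately have "fst F x 1 = (x + snd F) * f x" by auto
    then show "poly p x = poly q x" using pq[of x] by simp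
  qed simp
  then have 1: "fst F x 1 = (x + snd F) * f x" for x using pq by simp
  show "fst F x 0 = x * divx (\<lambda>x. fst F x 0) x" by (rule 0[unfolded f_def])
  show "fst F x 1 = (x + snd F) * divx (\<lambda>x. fst F x 0) x" by (rule 1[unfolded f_def])
qed

lemma gA_hA:
  assumes "F \<in> sA"
  shows "gA F \<in> sE" "hA F \<in> sE" "hadd 1 (rm rhoh (gA F)) (rm eh (hA F)) = F"
proof -
  define f where "f = divx (\<lambda>x. fst F x 0)"
  have F: "psym (fst F)" using assms by (simp add: sA_iff)
  have f: "fst F x 0 = x * f x" "fst F x 1 = (x + snd F) * f x" for x
    unfolding f_def by (rule sA_divx[OF assms])+
  have hF: "hfam (\<lambda>_. F)" by (rule hfam_const[OF F])
  have G: "psym (fst (gA F))" and H: "psym (fst (hA F))"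
    using hfam_gA[OF hF] hfam_hA[OF hF] by (auto simp: hfam_def)
  show "gA F \<in> sE" using G by (simp add: sE_iff gA_def om_def)
  show "hA F \<in> sE" using H by (simp add: sE_iff hA_def rho_def algebra_simps)
  have fp: "psym (\<lambda>x s. f x)" unfolding f_def by (rule psym_family_zero[OF psym_divx[OF F]])
  have p: "psym (\<lambda>x s. fst F x s - om x s * f x * rho (x + snd F) s)"
    unfolding om_def rho_def by (rule psym_familyI) (intro polyfun_intros psym_eval[OF F] psym_eval[OF fp])
  have y: "fst F x s - om x s * f x * rho (x + snd F) s = s * (1 - s) * yA F x s" for x s
    unfolding yA_def f_def[symmetric] using f by (intro e_decompI[OF p]) (simp_all add: om_def rho_def)
  show "hadd 1 (rm rhoh (gA F)) (rm eh (hA F)) = F"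
  proof (rule prod_eqI)
    show "fst (hadd 1 (rm rhoh (gA F)) (rm eh (hA F))) = fst F"
    proof (intro ext)
      fix x s
      define Z where "Z = (1 - s) * (yA F x 0 - x * yA F x 1)"
      have "fst (hadd 1 (rm rhoh (gA F)) (rm eh (hA F))) x s
        = (om x s * f x + s * (1 - s) * Z) * rho (x + snd F) s
          + (yA F x s - Z * rho (x + snd F) s) * (s * (1 - s))"
        by (simp add: hadd_def hmul_def rhoh_def eh_def gA_def hA_def Z_def f_def)
      also have "\<dots> = om x s * f x * rho (x + snd F) s + s * (1 - s) * yA F x s"
        by (simp only: distrib_right left_diff_distrib) (simp add: mult_ac)
      also have "\<dots> = fst F x s" unfolding y[symmetric] by simp
      finally show "fst (hadd 1 (rm rhoh (gA F)) (rm eh (hA F))) x s = fst F x s" .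
    qed
  qed (simp add: hadd_def hmul_def rhoh_def gA_def)
qed

lemma yA_hadd:
  assumes "psym (fst a)" "psym (fst b)" "snd a = snd b"
  shows "yA (hadd c a b) = (\<lambda>x s. yA a x s + c * yA b x s)"
proof -
  let ?P = "\<lambda>F x s. fst F x s - om x s * divx (\<lambda>x. fst F x 0) x * rho (x + snd F) s"
  have p: "psym (?P F)" if "psym (fst F)" for F :: "'a hom"
  proof -
    have fp: "psym (\<lambda>x s. divx (\<lambda>x. fst F x 0) x)" by (rule psym_family_zero[OF psym_divx[OF that]])
    show ?thesis
      unfolding om_def rho_def by (rule psym_familyI) (intro polyfun_intros psym_eval[OF that] psym_eval[OF fp])
  qed
  have "?P (hadd c a b) = (\<lambda>x s. ?P a x s + c * ?P b x s)"
    using divx_lin[OF assms(1,2), of 0 c] assms(3) by (intro ext) (simp add: hadd_def algebra_simps)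
  then show ?thesis unfolding yA_def using dive_lin[OF p[OF assms(1)] p[OF assms(2)], of c] by simp
qed

lemma slotmap_gA: "slotmap sA sE gA"
  unfolding slotmap_def
proof (intro conjI ballI allI impI)
  fix a b :: "'a hom" and c assume ab: "a \<in> sA" "b \<in> sA" "snd a = snd b"
  then have p: "psym (fst a)" "psym (fst b)" by (auto simp: sA_iff)
  show "gA (hadd c a b) = hadd c (gA a) (gA b)"
    unfolding gA_def yA_hadd[OF p ab(3)]
    using divx_lin[OF p, of 0 c] by (simp add: hadd_def fun_eq_iff algebra_simps)
qed (simp_all add: gA_hA hfam_gA, simp add: gA_def)

lemma slotmap_hA: "slotmap sA sE hA"
  unfolding slotmap_def
proof (intro conjI ballI allI impI)
  fix a b :: "'a hom" and c assume ab: "a \<in> sA" "b \<in> sA" "snd a = snd b"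
  then have p: "psym (fst a)" "psym (fst b)" by (auto simp: sA_iff)
  show "hA (hadd c a b) = hadd c (hA a) (hA b)"
    unfolding hA_def yA_hadd[OF p ab(3)]
    using ab(3) by (simp add: hadd_def fun_eq_iff algebra_simps)
qed (simp_all add: gA_hA hfam_hA, simp add: hA_def)

text \<open>The lift along \<open>sE \<times> sE \<rightarrow> sT\<close> exists only up to the multiple \<open>cT g\<close> of \<open>s (1 - s)\<^sup>2\<close>.\<close>

definition yT :: "'k::field_char_0 hom \<Rightarrow> 'k sym" where
  "yT g = dive (\<lambda>x s. fst g x s - om x s * fst g x 1 * om (x + snd g) s)"

text \<open>The obstruction in degree 0. If Z times (e, - om) is added to the naive lift, the
  \<open>sE\<close> condition of the second entry at x = 0 demands \<open>yT\<close>(0,0) = \<nu>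
  Z(0,0), with \<nu> the degree of g.\<close>

definition cT :: "'k::field_char_0 hom \<Rightarrow> 'k" where
  "cT g = yT g 0 0"

definition dT :: "'k::field_char_0 hom \<Rightarrow> 'k sym" where
  "dT g = (\<lambda>x s. divx (\<lambda>x. yT g x 0 - x * yT g x 1) x)"

text \<open>The correction is Z = - s \<open>dT\<close>. It vanishes at s = 0, where om(x + \<nu>)
  would bring in the degree, so the formula is uniform in \<nu> and leaves only the obstruction
  behind.\<close>

definition gT :: "'k::field_char_0 hom \<Rightarrow> 'k hom" where
  "gT g = (\<lambda>x s. om x s * fst g x 1 - s * (1 - s) * (s * dT g x 0), snd g)"

definition hT :: "'k::field_char_0 hom \<Rightarrow> 'k hom" where
  "hT g = (\<lambda>x s. yT g x s - (1 - s) * cT g + s * dT g x 0 * om (x + snd g) s, snd g)"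

lemma psym_family_yT: assumes "hfam H" shows "psym_family (\<lambda>y. yT (H y))"
proof -
  note H = hfamD[OF assms]
  show ?thesis unfolding yT_def om_def
    by (rule psym_family_dive, rule psym_familyI)
       (intro polyfun_intros psym_family_eval[OF H(1)] polyfun_eval[OF H(2)])
qed

lemma psym_family_dT: assumes "hfam H" shows "psym_family (\<lambda>y. dT (H y))"
  unfolding dT_def
  by (rule psym_family_divx[of "\<lambda>y x s. yT (H y) x 0 - x * yT (H y) x 1"], rule psym_familyI)
     (intro polyfun_intros psym_family_eval[OF psym_family_yT[OF assms]])

lemma polyfun_cT: assumes "hfam H" shows "(\<lambda>y. cT (H y)) \<in> polyfun UNIV"
  unfolding cT_def
  by (rule psym_family_eval[OF psym_family_yT[OF assms]]) (intro polyfun_intros)+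

lemma hfam_gT: assumes "hfam H" shows "hfam (\<lambda>y. gT (H y))"
proof -
  note H = hfamD[OF assms]
  show ?thesis unfolding hfam_def gT_def om_def fst_conv snd_conv
    by (intro conjI psym_familyI H(2))
       (intro polyfun_intros psym_family_eval[OF H(1)] psym_family_eval[OF psym_family_dT[OF assms]])
qed

lemma hfam_hT: assumes "hfam H" shows "hfam (\<lambda>y. hT (H y))"
proof -
  note H = hfamD[OF assms]
  show ?thesis unfolding hfam_def hT_def om_def fst_conv snd_conv
    by (intro conjI psym_familyI H(2))
       (intro polyfun_intros psym_family_eval[OF psym_family_yT[OF assms]] polyfun_eval[OF H(2)]
         psym_family_eval[OF psym_family_dT[OF assms]] polyfun_eval[OF polyfun_cT[OF assms]])
qed

lemma gT_hT:
  assumes "g \<in> sT"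
  shows "gT g \<in> sE" "hT g \<in> sE"
    "fst g x s = fst (gT g) x s * om (x + snd g) s + fst (hT g) x s * (s * (1 - s))
       + cT g * ((1 - s) * (s * (1 - s)))"
proof -
  have g: "psym (fst g)" "\<And>x. fst g x 0 = x * (x + snd g) * fst g x 1"
    using assms by (auto simp: sT_iff)
  have hF: "hfam (\<lambda>_. g)" by (rule hfam_const[OF g(1)])
  have G: "psym (fst (gT g))" and H: "psym (fst (hT g))" and Y: "psym (yT g)"
    using hfam_gT[OF hF] hfam_hT[OF hF] psym_family_yT[OF hF] by (auto simp: hfam_def)
  show "gT g \<in> sE" using G by (simp add: sE_iff gT_def om_def)
  have "psym (\<lambda>x s. yT g x 0 - x * yT g x 1)"
    by (rule psym_familyI) (intro polyfun_intros psym_eval[OF Y])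
  then have c: "yT g x 0 - x * yT g x 1 = cT g + x * dT g x 0" for x
    unfolding cT_def dT_def by (rule divx_decomp[THEN trans]) simp
  have "yT g x 0 - cT g = x * yT g x 1 + x * dT g x 0" for x
    using c[of x] by (simp add: algebra_simps)
  then show "hT g \<in> sE" using H by (simp add: sE_iff hT_def om_def distrib_left)
  have p: "psym (\<lambda>x s. fst g x s - om x s * fst g x 1 * om (x + snd g) s)"
    unfolding om_def by (rule psym_familyI) (intro polyfun_intros psym_eval[OF g(1)])
  have y: "fst g x s - om x s * fst g x 1 * om (x + snd g) s = s * (1 - s) * yT g x s"
    unfolding yT_def using g(2) by (intro e_decompI[OF p]) (simp_all add: om_def mult_ac)
  have "fst (gT g) x s * om (x + snd g) s + fst (hT g) x s * (s * (1 - s)) + cT g * ((1 - s) * (s * (1 - s)))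
     = om x s * fst g x 1 * om (x + snd g) s + s * (1 - s) * yT g x s"
    unfolding gT_def hT_def fst_conv by (simp add: algebra_simps)
  then show "fst g x s = fst (gT g) x s * om (x + snd g) s + fst (hT g) x s * (s * (1 - s))
       + cT g * ((1 - s) * (s * (1 - s)))" unfolding y[symmetric] by simp
qed

lemma yT_hadd:
  assumes "psym (fst a)" "psym (fst b)" "snd a = snd b"
  shows "yT (hadd c a b) = (\<lambda>x s. yT a x s + c * yT b x s)"
proof -
  let ?P = "\<lambda>g x s. fst g x s - om x s * fst g x 1 * om (x + snd g) s"
  have p: "psym (?P F)" if "psym (fst F)" for F :: "'a hom"
    unfolding om_def by (rule psym_familyI) (intro polyfun_intros psym_eval[OF that])
  have "?P (hadd c a b) = (\<lambda>x s. ?P a x s + c * ?P b x s)"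
    using assms(3) by (intro ext) (simp add: hadd_def algebra_simps)
  then show ?thesis unfolding yT_def using dive_lin[OF p[OF assms(1)] p[OF assms(2)], of c] by simp
qed

lemma dT_hadd:
  assumes "psym (fst a)" "psym (fst b)" "snd a = snd b"
  shows "dT (hadd c a b) = (\<lambda>x s. dT a x s + c * dT b x s)"
proof -
  have p: "psym (\<lambda>x s. yT g x 0 - x * yT g x 1)" if "psym (fst g)" for g :: "'a hom"
    by (rule psym_familyI) (intro polyfun_intros psym_eval[OF psym_family_yT[OF hfam_const[OF that]]])
  have "(\<lambda>x. yT (hadd c a b) x 0 - x * yT (hadd c a b) x 1)
      = (\<lambda>x. (yT a x 0 - x * yT a x 1) + c * (yT b x 0 - x * yT b x 1))"
    unfolding yT_hadd[OF assms] by (simp add: fun_eq_iff algebra_simps)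
  then show ?thesis unfolding dT_def using divx_lin[OF p[OF assms(1)] p[OF assms(2)], of c]
    by (simp add: fun_eq_iff)
qed

lemma cT_hadd:
  assumes "a \<in> sT" "b \<in> sT" "snd a = snd b"
  shows "cT (hadd c a b) = cT a + c * cT b"
  using assms yT_hadd[of a b c] by (simp add: cT_def sT_iff)

lemma slotmap_gT: "slotmap sT sE gT"
  unfolding slotmap_def
proof (intro conjI ballI allI impI)
  fix a b :: "'a hom" and c assume ab: "a \<in> sT" "b \<in> sT" "snd a = snd b"
  then have p: "psym (fst a)" "psym (fst b)" by (auto simp: sT_iff)
  show "gT (hadd c a b) = hadd c (gT a) (gT b)"
    unfolding gT_def dT_hadd[OF p ab(3)] by (simp add: hadd_def fun_eq_iff algebra_simps)
qed (simp_all add: gT_hT hfam_gT, simp add: gT_def)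

lemma slotmap_hT: "slotmap sT sE hT"
  unfolding slotmap_def
proof (intro conjI ballI allI impI)
  fix a b :: "'a hom" and c assume ab: "a \<in> sT" "b \<in> sT" "snd a = snd b"
  then have p: "psym (fst a)" "psym (fst b)" by (auto simp: sT_iff)
  show "hT (hadd c a b) = hadd c (hT a) (hT b)"
    unfolding hT_def yT_hadd[OF p ab(3)] dT_hadd[OF p ab(3)] cT_hadd[OF ab]
    using ab(3) by (simp add: hadd_def fun_eq_iff algebra_simps)
qed (simp_all add: gT_hT hfam_hT, simp add: hT_def)

section \<open>Extending cochains from submodules\<close>

text \<open>A linear retraction of g \<mapsto> g e from \<open>sT\<close> to \<open>sE\<close>:
  divide by e, then reset the value at s = 0 to the one prescribed by \<open>sT\<close>. It extends
  cochains from \<open>sT\<close> to \<open>sE\<close>; being merely linear is enough because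
  cochains, not cocycles, are extended.\<close>

definition pT :: "'k::field_char_0 hom \<Rightarrow> 'k hom" where
  "pT g = (\<lambda>x s. dive (fst g) x s
      - (1 - s) * (dive (fst g) x 0 - x * (x + snd g) * dive (fst g) x 1), snd g)"

text \<open>The analogous map for u \<mapsto> u e on \<open>sA1\<close>, except that it lands in
  \<open>sA\<close> and so drops the constant term. At s = 1 the value is reset to what the value at
  s = 0 prescribes.\<close>

definition pA :: "'k::field_char_0 hom \<Rightarrow> 'k hom" where
  "pA g = (\<lambda>x s. dive (fst g) x s - (1 - s) * dive (fst g) 0 0
      - s * (dive (fst g) x 1 - (x + snd g) * divx (\<lambda>x. dive (fst g) x 0) x), snd g)"

lemma slotmap_pT: "slotmap sE sT pT"
  unfolding slotmap_def
proof (intro conjI ballI allI impI)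
  have fam: "hfam (\<lambda>y. pT (H y))" if "hfam H" for H :: "(nat \<Rightarrow> 'a) \<Rightarrow> 'a hom"
  proof -
    note H = hfamD[OF that]
    show ?thesis unfolding hfam_def pT_def fst_conv snd_conv
      by (intro conjI psym_familyI H(2))
        (intro polyfun_intros psym_family_eval[OF psym_family_dive[OF H(1)]] polyfun_eval[OF H(2)])
  qed
  then show "hfam (\<lambda>y. pT (H y))" if "hfam H" for H :: "(nat \<Rightarrow> 'a) \<Rightarrow> 'a hom" using that .
  fix a :: "'a hom" assume a: "a \<in> sE"
  then have "hfam (\<lambda>_. pT a)" by (intro fam hfam_const) (simp add: sE_iff)
  then show "pT a \<in> sT" by (simp add: sT_iff hfam_def pT_def)
  fix b :: "'a hom" and c assume "b \<in> sE" "snd a = snd b"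
  then show "pT (hadd c a b) = hadd c (pT a) (pT b)" "snd (pT a) = snd (pT b)"
    using a dive_lin[of "fst a" "fst b" c] by (simp_all add: pT_def hadd_def sE_iff fun_eq_iff algebra_simps)
qed

lemma slotmap_pA: "slotmap sE sA pA"
  unfolding slotmap_def
proof (intro conjI ballI allI impI)
  have fam: "hfam (\<lambda>y. pA (H y))" if "hfam H" for H :: "(nat \<Rightarrow> 'a) \<Rightarrow> 'a hom"
  proof -
    note H = hfamD[OF that]
    note D = psym_family_dive[OF H(1)]
    show ?thesis unfolding hfam_def pA_def fst_conv snd_conv
      by (intro conjI psym_familyI H(2))
        (intro polyfun_intros psym_family_eval[OF D] polyfun_eval[OF H(2)]
          psym_family_eval[OF psym_family_zero[OF psym_family_divx[OF D]]])
  qed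
  then show "hfam (\<lambda>y. pA (H y))" if "hfam H" for H :: "(nat \<Rightarrow> 'a) \<Rightarrow> 'a hom" using that .
  fix a :: "'a hom" assume a: "a \<in> sE"
  then have p: "psym (fst a)" by (simp add: sE_iff)
  then have "hfam (\<lambda>_. pA a)" by (intro fam hfam_const)
  moreover have "dive (fst a) x 0 - dive (fst a) 0 0 = x * divx (\<lambda>x. dive (fst a) x 0) x" for x
    by (subst divx_decomp[OF psym_dive[OF p], of x 0]) simp
  ultimately show "pA a \<in> sA" by (simp add: sA_iff hfam_def pA_def mult_ac)
  fix b :: "'a hom" and c assume b: "b \<in> sE" "snd a = snd b"
  then have q: "psym (fst b)" by (simp add: sE_iff)
  show "snd (pA a) = snd (pA b)" using b by (simp add: pA_def)
  show "pA (hadd c a b) = hadd c (pA a) (pA b)"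
    using b(2) dive_lin[OF p q, of c] divx_lin[OF psym_dive[OF p] psym_dive[OF q], of 0 c]
    by (simp add: pA_def hadd_def fun_eq_iff algebra_simps)
qed

lemma dive_rm_eh: "psym (fst g) \<Longrightarrow> dive (fst (rm eh g)) = fst g"
  using dive_e[of "fst g"] by (simp add: hmul_def eh_def)

lemma pT_rm_eh: assumes "g \<in> sT" shows "pT (rm eh g) = g"
proof -
  have "psym (fst g)" "\<And>x. fst g x 0 = x * (x + snd g) * fst g x 1" using assms by (auto simp: sT_iff)
  moreover have "snd (rm eh g) = snd g" by (simp add: hmul_def eh_def)
  ultimately show ?thesis by (intro prod_eqI) (simp_all add: pT_def dive_rm_eh)
qed

text \<open>At x = 0 the condition of \<open>sA1\<close> says that the constant term times the
  degree is 0. A nonzero constant therefore occurs in degree 0 only, where subtracting it stays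
  inside the module.\<close>

lemma pA_rm_eh:
  assumes "u \<in> sA1"
  shows "pA (rm eh u) = ((\<lambda>x s. fst u x s - fst u 0 0), snd u)" "fst u 0 0 \<noteq> 0 \<Longrightarrow> snd u = 0"
proof -
  have u: "psym (fst u)" "\<And>x. fst u x 0 * (x + snd u) = x * fst u x 1" using assms by (auto simp: sA1_iff)
  show n: "snd u = 0" if "fst u 0 0 \<noteq> 0" using u(2)[of 0] that by simp
  have sn: "snd (rm eh u) = snd u" by (simp add: hmul_def eh_def)
  let ?v = "((\<lambda>x s. fst u x s + (- fst u 0 0) * 1), snd u) :: 'a hom"
  have "psym (\<lambda>x s. 1 :: 'a)" using psym_consts(4) by (simp add: oneh_def)
  from psym_lin[OF u(1) this, of "- fst u 0 0"] have pv: "psym (fst ?v)" by simp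
  have "(fst u x 0 - fst u 0 0) * (x + snd u) = x * (fst u x 1 - fst u 0 0)" for x
  proof (cases "fst u 0 0 = 0")
    case False
    then show ?thesis using u(2)[of x] n by (simp add: left_diff_distrib right_diff_distrib)
  qed (use u(2)[of x] in simp)
  then have "?v \<in> sA" using pv by (simp add: sA_iff)
  from sA_divx(2)[OF this] have "fst u x 1 - fst u 0 0 = (x + snd u) * divx (\<lambda>x. fst u x 0 - fst u 0 0) x" for x
    by simp
  moreover have "divx (\<lambda>x. fst u x 0 - fst u 0 0) = divx (\<lambda>x. fst u x 0)" by (simp add: divx_def)
  ultimately have v: "fst u x 1 - fst u 0 0 = (x + snd u) * divx (\<lambda>x. fst u x 0) x" for x by metis
  show "pA (rm eh u) = ((\<lambda>x s. fst u x s - fst u 0 0), snd u)"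
    unfolding pA_def dive_rm_eh[OF u(1)] sn
  proof (intro prod_eqI ext)
    fix x s
    have "fst u x 1 - (x + snd u) * divx (\<lambda>x. fst u x 0) x = fst u 0 0"
      unfolding v[symmetric] by simp
    then show "fst (\<lambda>x s. fst u x s - (1 - s) * fst u 0 0 - s * (fst u x 1 - (x + snd u) * divx (\<lambda>x. fst u x 0) x), snd u) x s
      = fst (\<lambda>x s. fst u x s - fst u 0 0, snd u) x s"
      by (simp only: fst_conv) (simp add: left_diff_distrib)
  qed simp
qed

section \<open>Vanishing for cochains on shift operators\<close>

lemma hcob_diff: "hcob \<Delta> (\<lambda>l x. f l x - g l x) l x = hcob \<Delta> f l x - hcob \<Delta> g l x"
  using hcob_lin[of \<Delta> f "-1" g l x] by simp

lemma hcob_scale: "hcob \<Delta> (\<lambda>l x. c * f l x) l x = c * hcob \<Delta> f l x"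
proof -
  have "(\<lambda>l x. f l x + (c - 1) * f l x) = (\<lambda>l x. c * f l x)"
    by (simp add: fun_eq_iff algebra_simps)
  then show ?thesis using hcob_lin[of \<Delta> f "c - 1" f l x] by (simp add: left_diff_distrib)
qed

lemma good_last_lin:
  assumes "good (slots m X) f" "fits l (replicate m sA)" "g \<in> X" "h \<in> X" "snd g = snd h"
  shows "f (l @ [hadd c g h]) x = f (l @ [g]) x + c * f (l @ [h]) x"
  using assms by (intro mlin_last[of m X]) (simp_all add: good_def)

text \<open>Last step of the resolution: \<open>sA1\<close> embeds in \<open>sE \<times> sE\<close> by \<open>u \<mapsto> (u e, - u om)\<close>, and cocycles
  extend because \<open>e(\<Delta>)\<close> and \<open>om(x, \<Delta>)\<close> generate the unit ideal when \<open>\<Delta> \<noteq> 0\<close>.\<close>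

lemma extend_from_unit_0:
  fixes \<Delta> :: "'k::field_char_0"
  assumes \<Delta>: "\<Delta> \<noteq> 0" and f: "good (slots 0 sA1) f"
    and cf: "\<And>l x. fits l (slots (Suc 0) sA1) \<Longrightarrow> hcob \<Delta> f l x = 0"
  shows "\<exists>k1 k2. good (slots 0 sE) k1 \<and> good (slots 0 sE) k2 \<and>
    (\<forall>l x. fits l (slots (Suc 0) sE) \<longrightarrow> hcob \<Delta> k1 l x = 0 \<and> hcob \<Delta> k2 l x = 0) \<and>
    (\<forall>l u x. fits (l @ [u]) (slots 0 sA1) \<longrightarrow>
       k1 (l @ [rm eh u]) x - k2 (l @ [rm omh u]) x = f (l @ [u]) x)"
proof -
  define m where "m = f [oneh]"
  define k where "k = (\<lambda>l. hact \<Delta> (last l) m)"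
  have good: "good (slots 0 sE) k"
    unfolding good_def
  proof
    show "mlin (slots 0 sE) k"
      unfolding mlin_def slots_0 k_def
      by (auto simp: list_all2_Cons2 append_eq_Cons_conv hact_def hadd_def algebra_simps)
    show "pfam (slots 0 sE) (\<lambda>_. k)"
      unfolding pfam_def slots_0
    proof (intro allI impI)
      fix L :: "((nat \<Rightarrow> 'k) \<Rightarrow> 'k hom) list" and \<xi> :: "(nat \<Rightarrow> 'k) \<Rightarrow> 'k"
      assume L: "\<forall>H\<in>set L. hfam H" "\<forall>y. fits (map (\<lambda>H. H y) L) [sE]" "\<xi> \<in> polyfun UNIV"
      then obtain H where H: "L = [H]" "hfam H" by (cases L) (auto simp: list_all2_Cons2)
      have "(\<lambda>y. f (map (\<lambda>H. H y) [\<lambda>_. oneh]) (\<xi> y + snd (H y))) \<in> polyfun UNIV"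
        using f oneh_sA1 L(3) H(2) unfolding good_def slots_0
        by (intro pfamD[of "[sA1]" "\<lambda>_. f"]) (auto simp: hfam_const hfam_def intro: polyfun_intros)
      moreover have "(\<lambda>y. fst (H y) (\<xi> y) \<Delta>) \<in> polyfun UNIV"
        by (rule psym_family_eval[OF hfamD(1)[OF H(2)]]) (intro polyfun_intros L(3))+
      ultimately show "(\<lambda>y. k (map (\<lambda>H. H y) L) (\<xi> y)) \<in> polyfun UNIV"
        by (simp add: k_def H(1) hact_def m_def pf_mult)
    qed
  qed
  have kc: "hcob \<Delta> k l x = 0" if l: "fits l (slots (Suc 0) sE)" for l x
  proof -
    obtain a g where "l = [a, g]" using l by (auto simp: slots_Suc slots_0 list_all2_Cons2)
    then show ?thesis by (simp add: k_def hact_hmul)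
  qed
  \<comment> \<open>The value at the unit determines f: on \<open>sA\<close> by the cocycle
    condition with the unit in the last slot, on \<open>sA1\<close> by splitting off the constant
    term, which exists in degree 0 only.\<close>
  have fu: "f [u] x = hact \<Delta> u m x" if u: "u \<in> sA1" for u x
  proof -
    have fA: "f [a] x = hact \<Delta> a m x" if "a \<in> sA" for a
    proof -
      have "hcob \<Delta> f [a, oneh] x = 0"
        using that oneh_sA1 by (intro cf) (simp add: slots_Suc slots_0)
      then show ?thesis by (simp add: m_def)
    qed
    define c where "c = fst u 0 0"
    let ?v = "((\<lambda>x s. fst u x s - c), snd u)"
    have v: "?v \<in> sA"
      using slotmapD(1)[OF slotmap_pA, of "rm eh u"] pA_rm_eh(1)[OF u] rm_eh(2)[of u] u
      by (simp add: sA1_iff c_def)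
    show ?thesis
    proof (cases "c = 0")
      case True
      then show ?thesis using fA[OF v] by simp
    next
      case False
      then have s0: "snd u = 0" using pA_rm_eh(2)[OF u] by (simp add: c_def)
      have "hadd c ?v oneh = u" by (cases u) (simp add: hadd_def oneh_def)
      moreover have "?v \<in> sA1" using v sA_sA1 by blast
      ultimately have "f [u] x = f [?v] x + c * f [oneh] x"
        using good_last_lin[OF f, of "[]" ?v oneh c x] oneh_sA1 s0 by (simp add: oneh_def)
      also have "\<dots> = hact \<Delta> u m x"
        using fA[OF v] s0 by (simp add: hact_def m_def algebra_simps)
      finally show ?thesis .
    qed
  qed
  \<comment> \<open>For \<Delta> \<noteq> 0, 1 the number e(\<Delta>) is invertible. At \<Delta> = 1
    it vanishes but \<open>om\<close> becomes 1. At \<Delta> = 0 it vanishes while \<open>om\<close>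
    becomes x, which is no unit.\<close>
  define c1 where "c1 = (if \<Delta> = 1 then 0 else 1 / (\<Delta> * (1 - \<Delta>)))"
  define c2 :: 'k where "c2 = (if \<Delta> = 1 then -1 else 0)"
  have unit: "\<Delta> * (1 - \<Delta>) * c1 - om x \<Delta> * c2 = 1" for x
    using \<Delta> by (simp add: c1_def c2_def om_def)
  let ?k1 = "\<lambda>l x. c1 * k l x" and ?k2 = "\<lambda>l x. c2 * k l x"
  have ksc: "hcob \<Delta> (\<lambda>l x. c * k l x) l x = 0" if "fits l (slots (Suc 0) sE)" for c l x
    using kc[OF that, of x] by (simp add: hcob_scale)
  show ?thesis
  proof (rule exI[of _ ?k1], rule exI[of _ ?k2], intro conjI allI impI)
    show "good (slots 0 sE) ?k1" "good (slots 0 sE) ?k2" by (intro good_scale good)+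
    fix l :: "'k hom list" and u x
    assume "fits (l @ [u]) (slots 0 sA1)"
    then have u: "l = []" "u \<in> sA1" by (auto simp: slots_0 append_eq_Cons_conv list_all2_Cons2)
    have "c1 * k [rm eh u] x - c2 * k [rm omh u] x
        = fst u x \<Delta> * m (x + snd u) * (\<Delta> * (1 - \<Delta>) * c1 - om (x + snd u) \<Delta> * c2)"
      by (simp add: k_def hact_def hmul_def eh_def omh_def algebra_simps)
    also have "\<dots> = f [u] x" unfolding unit fu[OF u(2)] by (simp add: hact_def)
    finally show "c1 * k (l @ [rm eh u]) x - c2 * k (l @ [rm omh u]) x = f (l @ [u]) x"
      using u(1) by simp
  qed (auto simp: ksc)
qed

text \<open>Putting the unit into the last slot is a contracting homotopy over \<open>sA1\<close>.
  Transported to \<open>sE\<close> by \<open>pA\<close> it gives k; its coboundary is automatically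
  a cocycle and restricts to f along u \<mapsto> u e.\<close>

lemma extend_from_unit_Suc:
  fixes \<Delta> :: "'k::field_char_0"
  assumes f: "good (slots (Suc j) sA1) f"
    and cf: "\<And>l x. fits l (slots (Suc (Suc j)) sA1) \<Longrightarrow> hcob \<Delta> f l x = 0"
  shows "\<exists>k1. good (slots (Suc j) sE) k1 \<and>
    (\<forall>l x. hcob \<Delta> k1 l x = 0) \<and>
    (\<forall>l u x. fits (l @ [u]) (slots (Suc j) sA1) \<longrightarrow> k1 (l @ [rm eh u]) x = f (l @ [u]) x)"
proof -
  let ?I = "\<lambda>l. f (l @ [oneh])"
  have I: "good (slots j sA) ?I" by (rule good_append[OF oneh_sA1 _ f]) simp
  define k where "k = (\<lambda>l x. (-1) ^ Suc j * onlast pA ?I l x)"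
  have k: "good (slots j sE) k" unfolding k_def by (intro good_scale good_onlast[OF slotmap_pA] I)
  have main: "hcob \<Delta> k (l @ [rm eh u]) x = f (l @ [u]) x" if lu: "fits (l @ [u]) (slots (Suc j) sA1)" for l u x
  proof -
    obtain l' a where l: "l = l' @ [a]" "fits l' (replicate j sA)" "a \<in> sA" "u \<in> sA1"
    proof -
      obtain l1 a u1 where "l @ [u] = l1 @ [a, u1]" "fits l1 (replicate j sA)" "a \<in> sA" "u1 \<in> sA1"
        using fits_slots_SucE[OF lu] by blast
      then show ?thesis using that by simp
    qed
    have len: "length l' = j" using l(2) by (auto dest: list_all2_lengthD)
    define c where "c = fst u 0 0"
    define v where "v = ((\<lambda>x s. fst u x s - c), snd u)"
    have pu: "psym (fst u)" using l(4) by (simp add: sA1_iff)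
    have v: "pA (rm eh u) = v" using pA_rm_eh(1)[OF l(4)] by (simp add: c_def v_def)
    have vA: "v \<in> sA" using slotmapD(1)[OF slotmap_pA rm_eh(2)[OF pu]] v by simp
    have vA1: "v \<in> sA1" using vA sA_sA1 by blast
    have au: "hmul a u \<in> sA1" by (rule amodD(1)[OF amod_sA1 l(3,4)])
    have au0: "fst (hmul a u) 0 0 = 0" using l(3) by (simp add: hmul_def sA_iff)
    have pau: "pA (rm eh (hmul a u)) = hmul a u"
      unfolding pA_rm_eh(1)[OF au] au0 by (simp add: prod_eqI)
    have la: "fits (l' @ [a]) (replicate (Suc j) sA)"
      using l(2,3) fits_slots_snoc[of l' a j sA] by (simp add: slots_sA)
    have aone: "fits (l' @ [w]) (replicate (Suc j) sA)" if "w \<in> sA" for w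
      using l(2) that fits_slots_snoc[of l' w j sA] by (simp add: slots_sA)
    have fu: "f (l @ [u]) x = f (l @ [v]) x + c * f (l @ [oneh]) x"
      and Iau: "?I (l' @ [hmul a u]) x = ?I (l' @ [hmul a v]) x + c * ?I (l' @ [a]) x"
    proof -
      have "f (l @ [u]) x = f (l @ [v]) x + c * f (l @ [oneh]) x
        \<and> ?I (l' @ [hmul a u]) x = ?I (l' @ [hmul a v]) x + c * ?I (l' @ [a]) x"
      proof (cases "c = 0")
        case True
        then have "v = u" by (simp add: v_def)
        then show ?thesis using True by simp
      next
        case False
        then have s0: "snd u = 0" using pA_rm_eh(2)[OF l(4)] by (simp add: c_def)
        have uv: "hadd c v oneh = u" by (cases u) (simp add: v_def hadd_def oneh_def)
        have sv: "snd v = snd (oneh :: 'k hom)" using s0 by (simp add: v_def oneh_def)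
        have 1: "f (l @ [u]) x = f (l @ [v]) x + c * f (l @ [oneh]) x"
          using good_last_lin[OF f la vA1 oneh_sA1 sv, of c x] uv l(1) by simp
        have "hmul a u = hadd c (hmul a v) a"
          unfolding uv[symmetric] hmul_hadd rm_oneh ..
        moreover have "hmul a v \<in> sA" by (rule amodD(1)[OF amod_sA l(3) vA])
        moreover have "snd (hmul a v) = snd a" using sv by (simp add: hmul_def oneh_def)
        ultimately have "?I (l' @ [hmul a u]) x = ?I (l' @ [hmul a v]) x + c * ?I (l' @ [a]) x"
          using good_last_lin[OF I l(2) _ l(3), of "hmul a v" c x] by simp
        then show ?thesis using 1 by blast
      qed
      then show "f (l @ [u]) x = f (l @ [v]) x + c * f (l @ [oneh]) x"
        "?I (l' @ [hmul a u]) x = ?I (l' @ [hmul a v]) x + c * ?I (l' @ [a]) x" by blast+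
    qed
    let ?s = "(-1 :: 'k) ^ Suc j"
    have ss: "?s * ?s = 1" by (simp add: power_mult_distrib[symmetric])
    have "hcob \<Delta> k (l @ [rm eh u]) x
      = hcob \<Delta> (\<lambda>l. k (l @ [rm eh u])) (l' @ [a]) x - (-1) ^ j * k (l' @ [hmul a (rm eh u)]) x"
      unfolding l(1) append_assoc append_Cons append_Nil hcob_snoc len ..
    also have "(\<lambda>l. k (l @ [rm eh u])) = (\<lambda>l x. ?s * f (l @ [v, oneh]) x)"
      by (simp add: k_def v)
    also have "hcob \<Delta> (\<lambda>l x. ?s * f (l @ [v, oneh]) x) (l' @ [a]) x
       = ?s * hcob \<Delta> (\<lambda>l. f (l @ [v, oneh])) (l' @ [a]) x"
      by (rule hcob_scale)
    also have "k (l' @ [hmul a (rm eh u)]) x = ?s * f (l' @ [hmul a u, oneh]) x"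
      using pau by (simp add: k_def hmul_assoc[symmetric])
    finally have A: "hcob \<Delta> k (l @ [rm eh u]) x
      = ?s * hcob \<Delta> (\<lambda>l. f (l @ [v, oneh])) (l' @ [a]) x - (-1) ^ j * (?s * f (l' @ [hmul a u, oneh]) x)" .
    have "hcob \<Delta> f ((l' @ [a]) @ [v, oneh]) x = 0"
      using la vA oneh_sA1 fits_snoc2[of "l' @ [a]" v oneh "Suc j" sA1] by (intro cf) simp
    then have B: "hcob \<Delta> ?I (l' @ [a, v]) x = ?s * f (l' @ [a, v]) x"
      using hcob_append[of \<Delta> f oneh "l' @ [a]" v x] len by simp
    have C: "hcob \<Delta> ?I (l' @ [a, v]) x
       = hcob \<Delta> (\<lambda>l. f (l @ [v, oneh])) (l' @ [a]) x - (-1) ^ j * f (l' @ [hmul a v, oneh]) x"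
      unfolding hcob_snoc len by simp
    have D: "f (l' @ [hmul a u, oneh]) x = f (l' @ [hmul a v, oneh]) x + c * f (l' @ [a, oneh]) x"
      using Iau by simp
    have P: "hcob \<Delta> (\<lambda>l. f (l @ [v, oneh])) (l' @ [a]) x
        = ?s * f (l' @ [a, v]) x + (-1) ^ j * f (l' @ [hmul a v, oneh]) x"
      unfolding B[symmetric] C by (simp only: diff_add_cancel)
    have "hcob \<Delta> k (l @ [rm eh u]) x = ?s * (?s * f (l' @ [a, v]) x + ?s * c * f (l' @ [a, oneh]) x)"
      unfolding A D P by (simp add: algebra_simps)
    also have "\<dots> = (?s * ?s) * (f (l' @ [a, v]) x + c * f (l' @ [a, oneh]) x)"
      by (simp add: algebra_simps)
    also have "\<dots> = f (l @ [u]) x" using fu unfolding ss l(1) by simp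
    finally show ?thesis .
  qed
  show ?thesis
    by (intro exI[of _ "hcob \<Delta> k"] conjI allI impI good_hcob[OF amod_sE k] hcob_hcob main)
qed

section \<open>Descent of a pair of cochains from two copies of \<open>sE\<close> to
  \<open>sT\<close>\<close>

lemma sE_basic: "(\<lambda>x s. s * (1 - s), n) \<in> sE" "(om, n) \<in> sE"
  using psym_e psym_om by (simp_all add: sE_iff om_def[abs_def])

text \<open>The pair (e, - om) in degree t maps to t (1 - s) e in \<open>sT\<close>. So this is t
  times the value that a descended cochain must take at (1 - s) e, and \<open>kquot\<close> is that
  value.\<close>

definition kdiff :: "('k::field_char_0 hom list \<Rightarrow> 'k \<Rightarrow> 'k) \<Rightarrow> ('k hom list \<Rightarrow> 'k \<Rightarrow> 'k)
    \<Rightarrow> 'k hom list \<Rightarrow> 'k \<Rightarrow> 'k \<Rightarrow> 'k" where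
  "kdiff f1 f2 l t x = f1 (l @ [(\<lambda>x s. s * (1 - s), t)]) x - f2 (l @ [(om, t)]) x"

definition kquot :: "('k::field_char_0 hom list \<Rightarrow> 'k \<Rightarrow> 'k) \<Rightarrow> ('k hom list \<Rightarrow> 'k \<Rightarrow> 'k)
    \<Rightarrow> 'k hom list \<Rightarrow> 'k \<Rightarrow> 'k \<Rightarrow> 'k" where
  "kquot f1 f2 l t x = pquot (\<lambda>t. t) (\<lambda>t. kdiff f1 f2 l t x) t"

definition descT :: "('k::field_char_0 hom list \<Rightarrow> 'k \<Rightarrow> 'k) \<Rightarrow> ('k hom list \<Rightarrow> 'k \<Rightarrow> 'k)
    \<Rightarrow> 'k hom list \<Rightarrow> 'k \<Rightarrow> 'k" where
  "descT f1 f2 l x = onlast gT f1 l x + onlast hT f2 l x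
      + cT (last l) * kquot f1 f2 (butlast l) (snd (last l)) x"

lemma hfam_shift:
  assumes "hfam H" shows "hfam (\<lambda>y. H (\<lambda>i. y (Suc i)))"
proof -
  note H = hfamD[OF assms]
  show ?thesis unfolding hfam_def
    by (intro conjI psym_familyI psym_family_eval[OF H(1)] polyfun_eval[OF H(2)])
       (auto intro: polyfun_UNIV_var)
qed

text \<open>For \<open>\<nu> \<noteq> 0\<close> the map \<open>sE \<times> sE \<rightarrow> sT\<close> is onto in degree \<open>\<nu>\<close>; in degree \<open>0\<close> it is not, and the
  descended cochain is defined there by polynomial continuation in \<open>\<nu>\<close>.\<close>

locale descent_T =
  fixes \<Delta> :: "'k::field_char_0" and k :: nat and f1 f2 f :: "'k hom list \<Rightarrow> 'k \<Rightarrow> 'k"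
  assumes g1: "good (slots k sE) f1" and g2: "good (slots k sE) f2" and gf: "good (slots (Suc k) sT) f"
    and d1: "fits (l @ [a, g]) (slots (Suc k) sE) \<Longrightarrow> hcob \<Delta> f1 (l @ [a, g]) x = f (l @ [a, rm omh g]) x"
    and d2: "fits (l @ [a, g]) (slots (Suc k) sE) \<Longrightarrow> hcob \<Delta> f2 (l @ [a, g]) x = f (l @ [a, rm eh g]) x"
    and comp: "fits (l @ [u]) (slots k sA1) \<Longrightarrow> f1 (l @ [rm eh u]) x = f2 (l @ [rm omh u]) x"
begin

text \<open>In degree 0 the pair (e, - om) is the image of the unit of \<open>sA1\<close>, on which
  f1 and f2 are compatible.\<close>

lemma kdiff_0: assumes "fits l (replicate k sA)" shows "kdiff f1 f2 l 0 x = 0"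
proof -
  have "f1 (l @ [rm eh oneh]) x = f2 (l @ [rm omh oneh]) x"
    using assms oneh_sA1 by (intro comp) (simp add: fits_slots_snoc)
  then show ?thesis by (simp add: kdiff_def hmul_def oneh_def eh_def omh_def)
qed

text \<open>The degree t becomes a new variable in front of the parameters. Dividing by it as a
  variable keeps the quotient jointly polynomial, including at t = 0.\<close>

lemma kquot_family:
  assumes L: "\<And>H. H \<in> set L \<Longrightarrow> hfam H" "\<And>y. fits (map (\<lambda>H. H y) L) (replicate k sA)"
    and \<xi>: "\<xi> \<in> polyfun UNIV"
  shows "\<exists>F\<in>polyfun UNIV. \<forall>z t. kdiff f1 f2 (map (\<lambda>H. H z) L) t (\<xi> z) = t * F (case_nat t z) \<and>
     kquot f1 f2 (map (\<lambda>H. H z) L) t (\<xi> z) = F (case_nat t z)"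
proof -
  let ?sh = "\<lambda>(y :: nat \<Rightarrow> 'k) i. y (Suc i)"
  let ?L = "map (\<lambda>H y. H (?sh y)) L"
  have m: "map (\<lambda>H. H y) ?L = map (\<lambda>H. H (?sh y)) L" for y by simp
  have sl: "hfam H" if "H \<in> set ?L" for H using that L(1) by (auto intro: hfam_shift)
  have \<xi>': "(\<lambda>y. \<xi> (?sh y)) \<in> polyfun UNIV" by (rule polyfun_eval[OF \<xi>]) (rule polyfun_UNIV_var)
  have P: "(\<lambda>y. h (map (\<lambda>H. H y) (?L @ [\<lambda>y. (w, y 0)])) (\<xi> (?sh y))) \<in> polyfun UNIV"
    if h: "good (slots k sE) h" "\<And>n. (w, n) \<in> sE" for h and w :: "'k sym"
  proof (rule pfamD[of "slots k sE" "\<lambda>_. h"])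
    show "pfam (slots k sE) (\<lambda>_. h)" using h(1) by (simp add: good_def)
    have "psym w" using h(2)[of 0] by (simp add: sE_iff)
    then have "hfam (\<lambda>y. (w, y 0))" by (simp add: hfam_def polyfun_UNIV_var)
    then show "hfam H" if "H \<in> set (?L @ [\<lambda>y. (w, y 0)])" for H using that sl by auto
    show "fits (map (\<lambda>H. H y) (?L @ [\<lambda>y. (w, y 0)])) (slots k sE)" for y
      using L(2)[of "?sh y"] h(2) by (simp add: fits_slots_snoc comp_def)
  qed (rule \<xi>')
  define F0 where "F0 = (\<lambda>y. kdiff f1 f2 (map (\<lambda>H. H (?sh y)) L) (y 0) (\<xi> (?sh y)))"
  have "F0 \<in> polyfun UNIV"
    using polyfun_diff[OF P[OF g1 sE_basic(1)] P[OF g2 sE_basic(2)]]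
    by (simp add: F0_def kdiff_def comp_def)
  from polyfun_divide[OF this pf_const[of 0], of 0] obtain F where F: "F \<in> polyfun UNIV"
    "\<And>y. F0 y - F0 (y(0 := 0)) = y 0 * F y" by auto
  have "F0 (y(0 := 0)) = 0" for y
    using kdiff_0[OF L(2)[of "?sh y"]] by (simp add: F0_def)
  then have F0: "F0 y = y 0 * F y" for y using F(2)[of y] by simp
  have kd: "kdiff f1 f2 (map (\<lambda>H. H z) L) t (\<xi> z) = t * F (case_nat t z)" for z t
    using F0[of "case_nat t z"] by (simp add: F0_def)
  have "kquot f1 f2 (map (\<lambda>H. H z) L) t (\<xi> z) = F (case_nat t z)" for z t
  proof -
    obtain p where p: "\<And>t. F ((case_nat 0 z)(0 := t)) = poly p t"
      using polyfun_line_upd[OF F(1), of "case_nat 0 z" 0] by blast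
    have "(case_nat 0 z)(0 := t) = case_nat t z" for t
      by (auto simp: fun_eq_iff split: nat.split)
    then have p': "F (case_nat t z) = poly p t" for t using p[of t] by simp
    show ?thesis unfolding kquot_def p' by (rule pquot_eq) (simp_all add: kd p')
  qed
  then show ?thesis using F(1) kd by blast
qed

lemma kquot_poly:
  assumes l: "fits l (replicate k sA)"
  shows "\<exists>p. \<forall>t. kdiff f1 f2 l t x = t * poly p t \<and> kquot f1 f2 l t x = poly p t"
proof -
  let ?L = "map (\<lambda>a (_ :: nat \<Rightarrow> 'k). a) l"
  have ps: "psym (fst a)" if "a \<in> set l" for a
    using that l by (metis in_set_conv_nth list_all2_conv_all_nth nth_replicate sA_iff length_replicate)
  have "\<exists>F\<in>polyfun UNIV. \<forall>z t. kdiff f1 f2 (map (\<lambda>H. H z) ?L) t ((\<lambda>_. x) z) = t * F (case_nat t z) \<and>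
     kquot f1 f2 (map (\<lambda>H. H z) ?L) t ((\<lambda>_. x) z) = F (case_nat t z)"
    using l ps by (intro kquot_family pf_const) (auto simp: comp_def intro: hfam_const)
  then obtain F where F: "F \<in> polyfun UNIV"
    "\<forall>z t. kdiff f1 f2 l t x = t * F (case_nat t z) \<and> kquot f1 f2 l t x = F (case_nat t z)"
    by (simp add: comp_def) blast
  obtain p where p: "\<And>t. F ((case_nat 0 (\<lambda>_. 0))(0 := t)) = poly p t"
    using polyfun_line_upd[OF F(1), of "case_nat 0 (\<lambda>_. 0)" 0] by blast
  have "(case_nat 0 (\<lambda>_. 0))(0 := t) = case_nat t (\<lambda>_. 0 :: 'k)" for t
    by (auto simp: fun_eq_iff split: nat.split)
  then have "F (case_nat t (\<lambda>_. 0)) = poly p t" for t using p[of t] by simp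
  then show ?thesis using F(2) by metis
qed

lemma kquot_lin:
  assumes "fits (l1 @ a # l2) (replicate k sA)" "fits (l1 @ b # l2) (replicate k sA)" "snd a = snd b"
  shows "kquot f1 f2 (l1 @ hadd c a b # l2) t x = kquot f1 f2 (l1 @ a # l2) t x + c * kquot f1 f2 (l1 @ b # l2) t x"
proof -
  obtain p where p: "\<And>t. kdiff f1 f2 (l1 @ a # l2) t x = t * poly p t" "\<And>t. kquot f1 f2 (l1 @ a # l2) t x = poly p t"
    using kquot_poly[OF assms(1)] by blast
  obtain q where q: "\<And>t. kdiff f1 f2 (l1 @ b # l2) t x = t * poly q t" "\<And>t. kquot f1 f2 (l1 @ b # l2) t x = poly q t"
    using kquot_poly[OF assms(2)] by blast
  have lin: "h (l1 @ hadd c a b # l2 @ [w]) x = h (l1 @ a # l2 @ [w]) x + c * h (l1 @ b # l2 @ [w]) x"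
    if "good (slots k sE) h" "w \<in> sE" for h w
    using that fits_slots_snoc[of "l1 @ a # l2" w k sE] fits_slots_snoc[of "l1 @ b # l2" w k sE] assms
    by (intro mlinD[of "slots k sE" h]) (simp_all add: good_def)
  have "kdiff f1 f2 (l1 @ hadd c a b # l2) t x = t * poly (p + smult c q) t" for t
  proof -
    have "kdiff f1 f2 (l1 @ hadd c a b # l2) t x = kdiff f1 f2 (l1 @ a # l2) t x + c * kdiff f1 f2 (l1 @ b # l2) t x"
      using lin[OF g1 sE_basic(1), of t] lin[OF g2 sE_basic(2), of t]
      by (simp add: kdiff_def algebra_simps)
    then show ?thesis unfolding p(1) q(1) by (simp add: algebra_simps)
  qed
  then have "kquot f1 f2 (l1 @ hadd c a b # l2) t x = poly (p + smult c q) t"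
    unfolding kquot_def by (intro pquot_eq) simp_all
  then show ?thesis unfolding p(2) q(2) by simp
qed

lemma good_descT: "good (slots k sT) (descT f1 f2)"
proof -
  define r where "r = (\<lambda>l. \<lambda>x. cT (last l) * kquot f1 f2 (butlast l) (snd (last l)) x)"
  have "mlin (slots k sT) r"
    unfolding mlin_def
  proof (intro allI impI)
    fix l1 l2 :: "'k hom list" and a b c x
    assume f: "fits (l1 @ a # l2) (slots k sT)" "fits (l1 @ b # l2) (slots k sT)" "snd a = snd b"
    show "r (l1 @ hadd c a b # l2) x = r (l1 @ a # l2) x + c * r (l1 @ b # l2) x"
    proof (cases l2 rule: rev_cases)
      case Nil
      then have "a \<in> sT" "b \<in> sT" using f by (simp_all add: fits_slots_snoc)
      then have "cT (hadd c a b) = cT a + c * cT b" by (rule cT_hadd[OF _ _ f(3)])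
      moreover have "snd (hadd c a b) = snd b" using f(3) by (simp add: hadd_def)
      ultimately show ?thesis using f(3) by (simp add: r_def Nil algebra_simps)
    next
      case (snoc l2' g)
      have "fits ((l1 @ a # l2') @ [g]) (slots k sT)" "fits ((l1 @ b # l2') @ [g]) (slots k sT)"
        using f snoc by simp_all
      then have "fits (l1 @ a # l2') (replicate k sA)" "fits (l1 @ b # l2') (replicate k sA)"
        unfolding fits_slots_snoc by auto
      from kquot_lin[OF this f(3)] show ?thesis
        using butlast_append[of "_ # l2'" "[g]"] by (simp add: r_def snoc butlast_append algebra_simps)
    qed
  qed
  moreover have "pfam (slots k sT) (\<lambda>_. r)"
    unfolding pfam_def
  proof (intro allI impI)
    fix L :: "((nat \<Rightarrow> 'k) \<Rightarrow> 'k hom) list" and \<xi> :: "(nat \<Rightarrow> 'k) \<Rightarrow> 'k"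
    assume L: "\<forall>H\<in>set L. hfam H" "\<forall>y. fits (map (\<lambda>H. H y) L) (slots k sT)" "\<xi> \<in> polyfun UNIV"
    have "L \<noteq> []" using L(2) by (cases L) (simp_all add: slots_def)
    then obtain L' G where LG: "L = L' @ [G]" by (cases L rule: rev_cases) simp_all
    have m: "fits (map (\<lambda>H. H y) L') (replicate k sA)" for y
      using L(2) by (simp_all add: LG fits_slots_snoc)
    have hL: "hfam H" if "H \<in> set L'" for H using that L(1) LG by simp
    obtain F where F: "F \<in> polyfun UNIV" "\<And>z t. kquot f1 f2 (map (\<lambda>H. H z) L') t (\<xi> z) = F (case_nat t z)"
      using kquot_family[OF hL m L(3)] by blast
    have G: "hfam G" using L(1) LG by simp
    have "(\<lambda>y. case_nat (snd (G y)) y i) \<in> polyfun UNIV" for i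
      by (cases i) (simp_all add: hfamD(2)[OF G] polyfun_UNIV_var)
    then have "(\<lambda>y. F (case_nat (snd (G y)) y)) \<in> polyfun UNIV" by (rule polyfun_eval[OF F(1)])
    then show "(\<lambda>y. r (map (\<lambda>H. H y) L) (\<xi> y)) \<in> polyfun UNIV"
      using pf_mult[OF polyfun_cT[OF G]] by (simp add: r_def LG F(2))
  qed
  ultimately have "good (slots k sT) r" by (simp add: good_def)
  then have "good (slots k sT) (\<lambda>l x. onlast gT f1 l x + onlast hT f2 l x + r l x)"
    by (intro good_add good_onlast[OF slotmap_gT g1] good_onlast[OF slotmap_hT g2])
  then show ?thesis by (simp add: descT_def[abs_def] r_def)
qed

text \<open>Exactness: at s = 1 the relation forces U = 0, the \<open>sE\<close> condition then
  gives U = 0 at s = 0, so U = u e. Cancelling e leaves V = - u om, the \<open>sE\<close> condition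
  of V puts u into \<open>sA1\<close>, and \<open>comp\<close> applies.\<close>

lemma kernel:
  assumes U: "U \<in> sE" "V \<in> sE" "snd U = snd V"
    and z: "\<And>x s. fst U x s * om (x + snd U) s + fst V x s * (s * (1 - s)) = 0"
    and l: "fits l (replicate k sA)"
  shows "f1 (l @ [U]) x + f2 (l @ [V]) x = 0"
proof -
  have pU: "psym (fst U)" and pV: "psym (fst V)"
    and U0: "\<And>x. fst U x 0 = x * fst U x 1" and V0: "\<And>x. fst V x 0 = x * fst V x 1"
    using U by (auto simp: sE_iff)
  have U1: "fst U x 1 = 0" for x using z[of x 1] by (simp add: om_def)
  have Ue: "fst U x s = s * (1 - s) * dive (fst U) x s" for x s
    by (rule e_decompI[OF pU]) (simp_all add: U0 U1)
  define u where "u = (dive (fst U), snd U)"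
  have pu: "psym (fst u)" using psym_dive[OF pU] by (simp add: u_def)
  have eu: "rm eh u = U" using Ue by (intro prod_eqI ext) (simp_all add: hmul_def eh_def u_def mult_ac)
  have pw: "psym (\<lambda>x s. - (fst u x s * om (x + snd u) s))"
    unfolding om_def by (rule psym_familyI) (intro polyfun_intros psym_eval[OF pu])
  have Vw: "fst V x s = - (fst u x s * om (x + snd u) s)" for x s
  proof -
    obtain p where p: "\<And>s. fst V x s = poly p s" using psym_family_line_s[OF pV] by blast
    obtain q where q: "\<And>s. - (fst u x s * om (x + snd u) s) = poly q s"
      using psym_family_line_s[OF pw] by blast
    have "p = q"
    proof (rule poly_cofinite_eq[OF finite_e_roots])
      fix s :: 'k assume "s \<notin> {s. s * (1 - s) = 0}"
      then have s: "s * (1 - s) \<noteq> 0" by simp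
      have "s * (1 - s) * (fst u x s * om (x + snd u) s + fst V x s) = 0"
        using z[of x s] Ue[of x s] by (simp add: u_def algebra_simps)
      then have "fst u x s * om (x + snd u) s + fst V x s = 0" using s by simp
      then show "poly p s = poly q s" unfolding p[symmetric] q[symmetric]
        by (simp add: eq_neg_iff_add_eq_0 add.commute)
    qed
    then show ?thesis using p q by simp
  qed
  have "fst u x 0 * (x + snd u) = x * fst u x 1" for x
    using V0[of x] by (simp add: Vw om_def)
  then have uA: "u \<in> sA1" using pu by (simp add: sA1_iff)
  define W where "W = rm omh u"
  have W: "W \<in> sE" unfolding W_def by (rule rm_sA1[OF uA])
  \<comment> \<open>V is - W, written as W - 2 W so that linearity in the form of
    \<open>hadd\<close> gives f2 at - W.\<close>
  have "hadd (- 2) W W = V"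
    using U(3) by (intro prod_eqI ext) (simp_all add: hadd_def W_def hmul_def omh_def Vw, simp add: u_def)
  then have "f2 (l @ [V]) x = - f2 (l @ [W]) x"
    using good_last_lin[OF g2 l W W refl, of "- 2" x] by simp
  moreover have "f1 (l @ [U]) x = f2 (l @ [W]) x"
    using comp[of l u x] l uA by (simp add: eu W_def fits_slots_snoc)
  ultimately show ?thesis by simp
qed

text \<open>In nonzero degree \<nu> the obstruction is absorbed by adding \<open>cT\<close> / \<nu>
  times (e, - om), so \<open>gs\<close> and \<open>hs\<close> form a true preimage of g.\<close>

definition gs :: "'k hom \<Rightarrow> 'k hom" where
  "gs g = hadd (cT g / snd g) (gT g) (\<lambda>x s. s * (1 - s), snd g)"

definition hs :: "'k hom \<Rightarrow> 'k hom" where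
  "hs g = hadd (- (cT g / snd g)) (hT g) (om, snd g)"

lemma gs_hs:
  assumes g: "g \<in> sT" "snd g \<noteq> 0"
  shows "gs g \<in> sE" "hs g \<in> sE" "snd (gs g) = snd g" "snd (hs g) = snd g"
    "hadd 1 (rm omh (gs g)) (rm eh (hs g)) = g"
    "fits l (replicate k sA) \<Longrightarrow> descT f1 f2 (l @ [g]) x = f1 (l @ [gs g]) x + f2 (l @ [hs g]) x"
proof -
  have s: "snd (gT g) = snd g" "snd (hT g) = snd g" by (simp_all add: gT_def hT_def)
  show "gs g \<in> sE" unfolding gs_def
    using gT_hT(1)[OF g(1)] sE_basic(1) s by (intro amodD(3)[OF amod_sE]) simp_all
  show "hs g \<in> sE" unfolding hs_def
    using gT_hT(2)[OF g(1)] sE_basic(2) s by (intro amodD(3)[OF amod_sE]) simp_all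
  show s2: "snd (gs g) = snd g" "snd (hs g) = snd g" by (simp_all add: gs_def hs_def hadd_def s)
  show "hadd 1 (rm omh (gs g)) (rm eh (hs g)) = g"
  proof (intro prod_eqI ext)
    fix x s
    define c where "c = cT g / snd g"
    have cg: "cT g = c * snd g" using g(2) by (simp add: c_def)
    have "fst (hadd 1 (rm omh (gs g)) (rm eh (hs g))) x s
      = (fst (gT g) x s + c * (s * (1 - s))) * om (x + snd g) s + (fst (hT g) x s - c * om x s) * (s * (1 - s))"
      by (simp add: gs_def hs_def hadd_def hmul_def omh_def eh_def s c_def)
    also have "\<dots> = fst (gT g) x s * om (x + snd g) s + fst (hT g) x s * (s * (1 - s))
        + c * (om (x + snd g) s - om x s) * (s * (1 - s))" by (simp add: algebra_simps)
    also have "c * (om (x + snd g) s - om x s) = cT g * (1 - s)"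
      unfolding cg by (simp add: om_def algebra_simps)
    also have "fst (gT g) x s * om (x + snd g) s + fst (hT g) x s * (s * (1 - s))
        + cT g * (1 - s) * (s * (1 - s)) = fst g x s"
      using gT_hT(3)[OF g(1), of x s] by (simp add: mult.assoc)
    finally show "fst (hadd 1 (rm omh (gs g)) (rm eh (hs g))) x s = fst g x s" .
  qed (simp add: hadd_def hmul_def s2 omh_def)
  assume l: "fits l (replicate k sA)"
  obtain p where p: "\<And>t. kdiff f1 f2 l t x = t * poly p t" "\<And>t. kquot f1 f2 l t x = poly p t"
    using kquot_poly[OF l] by blast
  have "kquot f1 f2 l (snd g) x = kdiff f1 f2 l (snd g) x / snd g"
    unfolding p using g(2) by simp
  then have "descT f1 f2 (l @ [g]) x = f1 (l @ [gT g]) x + f2 (l @ [hT g]) x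
      + cT g / snd g * kdiff f1 f2 l (snd g) x" by (simp add: descT_def)
  also have "\<dots> = f1 (l @ [gs g]) x + f2 (l @ [hs g]) x"
    unfolding gs_def hs_def
    using good_last_lin[OF g1 l gT_hT(1)[OF g(1)] sE_basic(1)[of "snd g"], of "cT g / snd g" x]
      good_last_lin[OF g2 l gT_hT(2)[OF g(1)] sE_basic(2)[of "snd g"], of "- (cT g / snd g)" x] s
    by (simp add: kdiff_def algebra_simps)
  finally show "descT f1 f2 (l @ [g]) x = f1 (l @ [gs g]) x + f2 (l @ [hs g]) x" .
qed

text \<open>Two preimages of g differ by an element of the kernel, on which the pair of cochains
  vanishes.\<close>

lemma descT_eq:
  assumes g: "g \<in> sT" "snd g \<noteq> 0" and G: "G \<in> sE" and H: "H \<in> sE" and s: "snd G = snd H"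
    and gGH: "hadd 1 (rm omh G) (rm eh H) = g" and l: "fits l (replicate k sA)"
  shows "descT f1 f2 (l @ [g]) x = f1 (l @ [G]) x + f2 (l @ [H]) x"
proof -
  note gh = gs_hs[OF g]
  have sG: "snd G = snd g" using arg_cong[OF gGH, of snd] by (simp add: hadd_def hmul_def omh_def)
  let ?U = "hadd (- 1) G (gs g)" and ?V = "hadd (- 1) H (hs g)"
  have "f1 (l @ [?U]) x + f2 (l @ [?V]) x = 0"
  proof (rule kernel[OF _ _ _ _ l])
    show "?U \<in> sE" using G gh sG by (intro amodD(3)[OF amod_sE]) simp_all
    show "?V \<in> sE" using H gh sG s by (intro amodD(3)[OF amod_sE]) simp_all
    show "snd ?U = snd ?V" using s by (simp add: hadd_def)
    fix x s
    have "fst G x s * om (x + snd g) s + fst H x s * (s * (1 - s)) = fst g x s"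
      using arg_cong[OF gGH, of "\<lambda>h. fst h x s"] sG by (simp add: hadd_def hmul_def omh_def eh_def)
    moreover have "fst (gs g) x s * om (x + snd g) s + fst (hs g) x s * (s * (1 - s)) = fst g x s"
      using arg_cong[OF gh(5), of "\<lambda>h. fst h x s"] gh(3) by (simp add: hadd_def hmul_def omh_def eh_def)
    moreover have "fst ?U x s * om (x + snd ?U) s + fst ?V x s * (s * (1 - s))
      = (fst G x s * om (x + snd g) s + fst H x s * (s * (1 - s)))
        - (fst (gs g) x s * om (x + snd g) s + fst (hs g) x s * (s * (1 - s)))"
      using sG by (simp add: hadd_def algebra_simps)
    ultimately show "fst ?U x s * om (x + snd ?U) s + fst ?V x s * (s * (1 - s)) = 0" by simp
  qed
  moreover have "f1 (l @ [?U]) x = f1 (l @ [G]) x - f1 (l @ [gs g]) x"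
    using good_last_lin[OF g1 l G gh(1), of "- 1" x] sG gh(3) by simp
  moreover have "f2 (l @ [?V]) x = f2 (l @ [H]) x - f2 (l @ [hs g]) x"
    using good_last_lin[OF g2 l H gh(2), of "- 1" x] sG gh(4) s by simp
  ultimately show ?thesis unfolding gh(6)[OF l] by (simp add: algebra_simps)
qed

text \<open>Both degrees have to be nonzero because g as well as a g is replaced by a
  preimage.\<close>

lemma hcob_descT_generic:
  assumes l: "fits l (replicate k sA)" "a \<in> sA" "g \<in> sT" and n: "snd g \<noteq> 0" "snd a + snd g \<noteq> 0"
  shows "hcob \<Delta> (descT f1 f2) (l @ [a, g]) x = f (l @ [a, g]) x"
proof -
  note gh = gs_hs[OF l(3) n(1)]
  have "hcob \<Delta> (descT f1 f2) (l @ [a, g]) x = hcob \<Delta> f1 (l @ [a, gs g]) x + hcob \<Delta> f2 (l @ [a, hs g]) x"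
  proof (rule hcob_descend[OF l(1,2)])
    show "descT f1 f2 (l @ [g]) = (\<lambda>x. f1 (l @ [gs g]) x + f2 (l @ [hs g]) x)"
      if "fits l (replicate k sA)" for l using gh(6)[OF that] by (intro ext)
    show "descT f1 f2 (l @ [hmul a g]) x = f1 (l @ [hmul a (gs g)]) x + f2 (l @ [hmul a (hs g)]) x"
    proof (rule descT_eq)
      show "hadd 1 (rm omh (hmul a (gs g))) (rm eh (hmul a (hs g))) = hmul a g"
        unfolding hmul_assoc hmul_hadd[symmetric] gh(5) ..
      show "snd (hmul a g) \<noteq> 0" "snd (hmul a (gs g)) = snd (hmul a (hs g))"
        using n(2) gh(3,4) by (simp_all add: hmul_def)
    qed (use l gh amodD(1)[OF amod_sT] amodD(1)[OF amod_sE] in blast)+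
  qed
  also have "\<dots> = f (l @ [a, rm omh (gs g)]) x + f (l @ [a, rm eh (hs g)]) x"
    using l gh d1[of l a "gs g" x] d2[of l a "hs g" x] by (simp add: fits_snoc2)
  also have "\<dots> = f ((l @ [a]) @ [hadd 1 (rm omh (gs g)) (rm eh (hs g))]) x"
  proof -
    have "fits (l @ [a]) (replicate (Suc k) sA)"
      using l fits_slots_snoc[of l a k sA] by (simp add: slots_sA)
    moreover have "rm omh (gs g) \<in> sT" "rm eh (hs g) \<in> sT"
      using rm_sE(2)[OF gh(1)] rm_eh(3)[OF amodD(2)[OF amod_sE gh(2)]] by blast+
    moreover have "snd (rm omh (gs g)) = snd (rm eh (hs g))" using gh by (simp add: hmul_def omh_def eh_def)
    ultimately show ?thesis
      using good_last_lin[OF gf, of "l @ [a]" "rm omh (gs g)" "rm eh (hs g)" 1 x] by simp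
  qed
  finally show ?thesis unfolding gh(5) by simp
qed

text \<open>The element g is moved inside \<open>sT\<close> through all degrees t. The error is
  polynomial in t and vanishes outside t = 0 and t = - snd a, hence also at the original
  degree.\<close>

lemma hcob_descT:
  assumes l: "fits l (slots (Suc k) sT)"
  shows "hcob \<Delta> (descT f1 f2) l x = f l x"
proof -
  obtain l' a g where l': "l = l' @ [a, g]" "fits l' (replicate k sA)" "a \<in> sA" "g \<in> sT"
    using fits_slots_SucE[OF l] by blast
  \<comment> \<open>The added term vanishes at s = 1 and at s = 0 replaces the factor x + snd g by x
    + t.\<close>
  define gt where "gt = (\<lambda>t. (\<lambda>x s. fst g x s + (1 - s) * x * (t - snd g) * fst g x 1, t))"
  have pg: "psym (fst g)" and g0: "\<And>x. fst g x 0 = x * (x + snd g) * fst g x 1"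
    using l'(4) by (auto simp: sT_iff)
  have hg: "hfam (\<lambda>y. gt (y 0))"
    unfolding hfam_def gt_def fst_conv snd_conv
    by (intro conjI psym_familyI polyfun_UNIV_var) (intro polyfun_intros psym_eval[OF pg], assumption)
  have gtT: "gt t \<in> sT" for t
  proof -
    have "psym (fst (gt t))"
      unfolding gt_def fst_conv by (rule psym_familyI) (intro polyfun_intros psym_eval[OF pg])
    then show ?thesis by (simp add: sT_iff gt_def g0 algebra_simps)
  qed
  let ?D = "\<lambda>l x. hcob \<Delta> (descT f1 f2) l x - f l x"
  have D: "good (slots (Suc k) sT) ?D"
    by (intro good_diff good_hcob[OF amod_sT] good_descT gf)
  have "(\<lambda>y. ?D (map (\<lambda>H. H y) (map (\<lambda>a _. a) (l' @ [a]) @ [\<lambda>y. gt (y 0)])) ((\<lambda>_. x) y)) \<in> polyfun UNIV"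
  proof (rule pfamD[of "slots (Suc k) sT" "\<lambda>_. ?D"])
    show "pfam (slots (Suc k) sT) (\<lambda>_. ?D)" using D by (simp add: good_def)
    have "psym (fst b)" if "b \<in> set l'" for b
      using that l'(2) by (metis in_set_conv_nth list_all2_conv_all_nth nth_replicate sA_iff length_replicate)
    moreover have "psym (fst a)" using l'(3) by (simp add: sA_iff)
    ultimately show "hfam H" if "H \<in> set (map (\<lambda>a _. a) (l' @ [a]) @ [\<lambda>y. gt (y 0)])" for H
      using that hg by (auto intro: hfam_const)
    show "fits (map (\<lambda>H. H y) (map (\<lambda>a _. a) (l' @ [a]) @ [\<lambda>y. gt (y 0)])) (slots (Suc k) sT)" for y
      using l' gtT by (simp add: comp_def fits_snoc2)
  qed (rule pf_const)
  then have "(\<lambda>y. ?D (l' @ [a, gt (y 0)]) x) \<in> polyfun UNIV" by (simp add: comp_def)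
  from polyfun_line_upd[OF this, of "\<lambda>_. 0" 0] obtain p where p: "\<And>t. ?D (l' @ [a, gt t]) x = poly p t" by auto
  have "p = 0"
  proof (rule poly_cofinite_eq[of "{0, - snd a}"])
    fix t :: 'k assume "t \<notin> {0, - snd a}"
    then have "snd (gt t) \<noteq> 0" "snd a + snd (gt t) \<noteq> 0"
      by (auto simp: gt_def eq_neg_iff_add_eq_0 add.commute)
    from hcob_descT_generic[OF l'(2,3) gtT this] show "poly p t = poly 0 t"
      unfolding p[symmetric] by simp
  qed simp
  moreover have "gt (snd g) = g" by (simp add: gt_def)
  ultimately show ?thesis using p[of "snd g"] unfolding l'(1) by simp
qed

end

lemma psym_sA: "g \<in> sA \<Longrightarrow> psym (fst g)" and psym_sA1: "g \<in> sA1 \<Longrightarrow> psym (fst g)"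
  and psym_sE: "g \<in> sE \<Longrightarrow> psym (fst g)" and psym_sT: "g \<in> sT \<Longrightarrow> psym (fst g)"
  by (simp_all add: sA_iff sA1_iff sE_iff sT_iff)

lemma extend_from_unit:
  assumes "\<Delta> \<noteq> 0" and f: "good (slots k sA1) f"
    and cf: "\<And>l x. fits l (slots (Suc k) sA1) \<Longrightarrow> hcob \<Delta> f l x = 0"
  shows "\<exists>k1 k2. good (slots k sE) k1 \<and> good (slots k sE) k2 \<and>
    (\<forall>l x. fits l (slots (Suc k) sE) \<longrightarrow> hcob \<Delta> k1 l x = 0 \<and> hcob \<Delta> k2 l x = 0) \<and>
    (\<forall>l u x. fits (l @ [u]) (slots k sA1) \<longrightarrow>
       k1 (l @ [rm eh u]) x - k2 (l @ [rm omh u]) x = f (l @ [u]) x)"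
proof (cases k)
  case 0
  then show ?thesis using extend_from_unit_0[OF assms(1)] f cf by simp
next
  case (Suc j)
  obtain k1 where k1: "good (slots k sE) k1" "\<And>l x. hcob \<Delta> k1 l x = 0"
    "\<And>l u x. fits (l @ [u]) (slots k sA1) \<Longrightarrow> k1 (l @ [rm eh u]) x = f (l @ [u]) x"
    using extend_from_unit_Suc[of j f \<Delta>] f cf unfolding Suc by blast
  have "good (slots k sE) (\<lambda>l x. 0 * k1 l x)" by (intro good_scale k1)
  moreover have "hcob \<Delta> (\<lambda>l x. 0) l x = 0" for l x using hcob_scale[of \<Delta> 0 k1 l x] by simp
  ultimately show ?thesis using k1 by (intro exI[of _ k1] exI[of _ "\<lambda>l x. 0 * k1 l x"]) simp
qed

text \<open>\<open>0 \<rightarrow> sA1 \<rightarrow> sE\<^sup>2 \<rightarrow> sE\<^sup>2 \<rightarrow> sA1 \<rightarrow> k \<rightarrow> 0\<close> is a projective resolution of the trivial module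
  with second syzygy \<open>sT\<close>; the cocycle is pulled back along it and its primitives are corrected
  so that they descend.\<close>

theorem shift_vanishing:
  fixes \<Delta> :: "'k::field_char_0"
  assumes \<Delta>: "\<Delta> \<noteq> 0" and good_f: "good (slots (Suc (Suc k)) sA) f"
    and cf: "\<And>l x. fits l (slots (Suc (Suc (Suc k))) sA) \<Longrightarrow> hcob \<Delta> f l x = 0"
  shows "\<exists>g. good (slots (Suc k) sA) g \<and>
    (\<forall>l x. fits l (slots (Suc (Suc k)) sA) \<longrightarrow> hcob \<Delta> g l x = f l x)"
proof -
  have smE: "slotmap sE sA (rm rhoh)" "slotmap sE sA (rm eh)" "slotmap sE sT (rm omh)" "slotmap sE sT (rm eh)"
    "slotmap sT sE (rm eh)" "slotmap sT sE (rm rhoh)" "slotmap sA1 sE (rm eh)" "slotmap sA1 sE (rm omh)"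
    by (intro slotmap_rm psym_consts rm_sE rm_eh rm_sT rm_sA1 psym_sE psym_sT psym_sA1, assumption)+
  \<comment> \<open>The cocycle is pulled back to the two copies of \<open>sE\<close>; acyclicity
    there supplies the primitives \<open>e1\<close> and \<open>e2\<close>.\<close>
  define fr where "fr = onlast (rm rhoh) f"
  define fe where "fe = onlast (rm eh) f"
  have fr: "good (slots (Suc (Suc k)) sE) fr" and fe: "good (slots (Suc (Suc k)) sE) fe"
    unfolding fr_def fe_def by (intro good_onlast[OF smE(1) good_f] good_onlast[OF smE(2) good_f])+
  have cc: "hcob \<Delta> (onlast (rm w) f) l x = 0"
    if w: "\<And>g. g \<in> sE \<Longrightarrow> rm w g \<in> sA" and l: "fits l (slots (Suc (Suc (Suc k))) sE)" for w l x
  proof -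
    obtain l' a g where l': "l = l' @ [a, g]" "fits l' (replicate (Suc (Suc k)) sA)" "a \<in> sA" "g \<in> sE"
      using fits_slots_SucE[OF l] by blast
    then show ?thesis using w[OF l'(4)] unfolding l'(1) hcob_onlast_rm by (intro cf) (simp add: fits_snoc2)
  qed
  have cfr: "hcob \<Delta> fr l x = 0" and cfe: "hcob \<Delta> fe l x = 0" if "fits l (slots (Suc (Suc (Suc k))) sE)" for l x
    unfolding fr_def fe_def using that rm_sE(1) rm_eh(1)[OF psym_sE] by (intro cc; blast)+
  define e1 where "e1 = contr (Suc k) fr"
  define e2 where "e2 = contr (Suc k) fe"
  have e1: "good (slots (Suc k) sE) e1" "\<And>l x. fits l (slots (Suc (Suc k)) sE) \<Longrightarrow> hcob \<Delta> e1 l x = fr l x"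
    unfolding e1_def by (intro good_contr fr, intro hcob_contr fr cfr)
  have e2: "good (slots (Suc k) sE) e2" "\<And>l x. fits l (slots (Suc (Suc k)) sE) \<Longrightarrow> hcob \<Delta> e2 l x = fe l x"
    unfolding e2_def by (intro good_contr fe, intro hcob_contr fe cfe)
  \<comment> \<open>Failure of \<open>e1\<close> and \<open>e2\<close> to descend to
    \<open>sA\<close>, measured on the kernel pairs (g e, - g rho) with g in \<open>sT\<close>. It
    is a cocycle one degree lower.\<close>
  define et where "et = (\<lambda>l x. onlast (rm eh) e1 l x - onlast (rm rhoh) e2 l x)"
  have et: "good (slots (Suc k) sT) et"
    unfolding et_def by (intro good_diff good_onlast[OF smE(5) e1(1)] good_onlast[OF smE(6) e2(1)])
  have cet: "hcob \<Delta> et l x = 0" if l: "fits l (slots (Suc (Suc k)) sT)" for l x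
  proof -
    obtain l' a g where l': "l = l' @ [a, g]" "fits l' (replicate (Suc k) sA)" "a \<in> sA" "g \<in> sT"
      using fits_slots_SucE[OF l] by blast
    have "hcob \<Delta> et l x = hcob \<Delta> e1 (l' @ [a, rm eh g]) x - hcob \<Delta> e2 (l' @ [a, rm rhoh g]) x"
      unfolding et_def hcob_diff l'(1) hcob_onlast_rm ..
    also have "\<dots> = fr (l' @ [a, rm eh g]) x - fe (l' @ [a, rm rhoh g]) x"
      using l' rm_eh(2)[OF psym_sT[OF l'(4)]] rm_sT[OF l'(4)]
        e1(2)[of "l' @ [a, rm eh g]" x] e2(2)[of "l' @ [a, rm rhoh g]" x]
      by (simp add: fits_snoc2)
    also have "\<dots> = 0"
      using onlast_snoc[of "rm rhoh" f "l' @ [a]" "rm eh g"] onlast_snoc[of "rm eh" f "l' @ [a]" "rm rhoh g"]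
      by (simp add: fr_def fe_def rm_comm(1))
    finally show ?thesis .
  qed
  have cet': "hcob \<Delta> (onlast (rm w) et) l x = 0"
    if w: "\<And>g. g \<in> sE \<Longrightarrow> rm w g \<in> sT" and l: "fits l (slots (Suc (Suc k)) sE)" for w l x
  proof -
    obtain l' a g where l': "l = l' @ [a, g]" "fits l' (replicate (Suc k) sA)" "a \<in> sA" "g \<in> sE"
      using fits_slots_SucE[OF l] by blast
    then show ?thesis using w[OF l'(4)] unfolding l'(1) hcob_onlast_rm by (intro cet) (simp add: fits_snoc2)
  qed
  \<comment> \<open>The same shift once more, now along the map (G, H) \<mapsto> G om + H e into
    \<open>sT\<close>.\<close>
  define t1 where "t1 = contr k (onlast (rm omh) et)"
  define t2 where "t2 = contr k (onlast (rm eh) et)"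
  have gto: "good (slots (Suc k) sE) (onlast (rm omh) et)" "good (slots (Suc k) sE) (onlast (rm eh) et)"
    by (intro good_onlast[OF smE(3) et] good_onlast[OF smE(4) et])+
  have t1: "good (slots k sE) t1"
    "\<And>l x. fits l (slots (Suc k) sE) \<Longrightarrow> hcob \<Delta> t1 l x = onlast (rm omh) et l x"
    unfolding t1_def by (intro good_contr gto, intro hcob_contr gto cet' rm_sE(2))
  have t2: "good (slots k sE) t2"
    "\<And>l x. fits l (slots (Suc k) sE) \<Longrightarrow> hcob \<Delta> t2 l x = onlast (rm eh) et l x"
    unfolding t2_def by (intro good_contr gto, intro hcob_contr gto cet' rm_eh(3) psym_sE)
  \<comment> \<open>Failure to descend to \<open>sT\<close>, measured on the kernel pairs (u e, - u
    om) with u in \<open>sA1\<close>.\<close>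
  define t0 where "t0 = (\<lambda>l x. onlast (rm eh) t1 l x - onlast (rm omh) t2 l x)"
  have t0: "good (slots k sA1) t0"
    unfolding t0_def by (intro good_diff good_onlast[OF smE(7) t1(1)] good_onlast[OF smE(8) t2(1)])
  have ct0: "hcob \<Delta> t0 l x = 0" if l: "fits l (slots (Suc k) sA1)" for l x
  proof -
    obtain l' a g where l': "l = l' @ [a, g]" "fits l' (replicate k sA)" "a \<in> sA" "g \<in> sA1"
      using fits_slots_SucE[OF l] by blast
    have "hcob \<Delta> t0 l x = hcob \<Delta> t1 (l' @ [a, rm eh g]) x - hcob \<Delta> t2 (l' @ [a, rm omh g]) x"
      unfolding t0_def hcob_diff l'(1) hcob_onlast_rm ..
    also have "\<dots> = onlast (rm omh) et (l' @ [a, rm eh g]) x - onlast (rm eh) et (l' @ [a, rm omh g]) x"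
      using l' rm_eh(2)[OF psym_sA1[OF l'(4)]] rm_sA1[OF l'(4)]
        t1(2)[of "l' @ [a, rm eh g]" x] t2(2)[of "l' @ [a, rm omh g]" x]
      by (simp add: fits_snoc2)
    also have "\<dots> = 0"
      using onlast_snoc[of "rm omh" et "l' @ [a]" "rm eh g"] onlast_snoc[of "rm eh" et "l' @ [a]" "rm omh g"]
      by (simp add: rm_comm(2))
    finally show ?thesis .
  qed
  obtain k1 k2 where k: "good (slots k sE) k1" "good (slots k sE) k2"
    "\<And>l x. fits l (slots (Suc k) sE) \<Longrightarrow> hcob \<Delta> k1 l x = 0"
    "\<And>l x. fits l (slots (Suc k) sE) \<Longrightarrow> hcob \<Delta> k2 l x = 0"
    "\<And>l u x. fits (l @ [u]) (slots k sA1) \<Longrightarrow> k1 (l @ [rm eh u]) x - k2 (l @ [rm omh u]) x = t0 (l @ [u]) x"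
    using extend_from_unit[OF \<Delta> t0 ct0] by blast
  \<comment> \<open>Subtracting cocycles keeps the coboundaries of \<open>t1\<close> and
    \<open>t2\<close> and makes the pair vanish on the kernel.\<close>
  define u1 where "u1 = (\<lambda>l x. t1 l x - k1 l x)"
  define u2 where "u2 = (\<lambda>l x. t2 l x - k2 l x)"
  have dT: "descent_T \<Delta> k u1 u2 et"
  proof
    show "good (slots k sE) u1" "good (slots k sE) u2"
      unfolding u1_def u2_def by (intro good_diff t1 t2 k)+
    show "good (slots (Suc k) sT) et" by (rule et)
    show "hcob \<Delta> u1 (l @ [a, g]) x = et (l @ [a, rm omh g]) x"
      if "fits (l @ [a, g]) (slots (Suc k) sE)" for l a g x
      using that t1(2)[OF that] k(3)[OF that] onlast_snoc[of "rm omh" et "l @ [a]" g]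
      by (simp add: u1_def hcob_diff)
    show "hcob \<Delta> u2 (l @ [a, g]) x = et (l @ [a, rm eh g]) x"
      if "fits (l @ [a, g]) (slots (Suc k) sE)" for l a g x
      using that t2(2)[OF that] k(4)[OF that] onlast_snoc[of "rm eh" et "l @ [a]" g]
      by (simp add: u2_def hcob_diff)
    show "u1 (l @ [rm eh u]) x = u2 (l @ [rm omh u]) x" if "fits (l @ [u]) (slots k sA1)" for l u x
      using k(5)[OF that, of x] by (simp add: u1_def u2_def t0_def algebra_simps)
  qed
  define th where "th = descT u1 u2"
  have th: "good (slots k sT) th" and cth: "\<And>l x. fits l (slots (Suc k) sT) \<Longrightarrow> hcob \<Delta> th l x = et l x"
    unfolding th_def by (rule descent_T.good_descT[OF dT], rule descent_T.hcob_descT[OF dT])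
  define tE where "tE = onlast pT th"
  have tE: "good (slots k sE) tE" unfolding tE_def by (rule good_onlast[OF slotmap_pT th])
  have ctE: "hcob \<Delta> tE (l @ [a, rm eh g]) x = hcob \<Delta> th (l @ [a, g]) x" if "a \<in> sA" "g \<in> sT" for l a g x
  proof -
    have ag: "hmul a g \<in> sT" by (rule amodD(1)[OF amod_sT that])
    show ?thesis unfolding hcob_snoc tE_def onlast_snoc hmul_assoc[symmetric] pT_rm_eh[OF that(2)] pT_rm_eh[OF ag] ..
  qed
  \<comment> \<open>The coboundary of the extended \<open>th\<close> restricts to \<open>et\<close>
    on \<open>sT\<close>. After subtracting it, \<open>h1\<close> is still a primitive of
    \<open>fr\<close> and now matches \<open>e2\<close> on the kernel of the map onto
    \<open>sA\<close>.\<close>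
  define h1 where "h1 = (\<lambda>l x. e1 l x - hcob \<Delta> tE l x)"
  have h1: "good (slots (Suc k) sE) h1"
    unfolding h1_def by (intro good_diff e1 good_hcob[OF amod_sE tE])
  have ch1: "hcob \<Delta> h1 l x = fr l x" if "fits l (slots (Suc (Suc k)) sE)" for l x
    using e1(2)[OF that] hcob_hcob[of \<Delta> tE l x] by (simp add: h1_def hcob_diff)
  have comp: "h1 (l @ [rm eh g]) x = e2 (l @ [rm rhoh g]) x"
    if "fits l (replicate (Suc k) sA)" "g \<in> sT" for l g x
  proof -
    have lg: "fits (l @ [g]) (slots (Suc k) sT)" using that by (simp add: fits_slots_snoc)
    obtain l' a where l': "l = l' @ [a]" "a \<in> sA" "fits l' (replicate k sA)"
      using fits_slots_SucE[OF lg] by (metis append.assoc append_Cons append_Nil append1_eq_conv)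
    have "hcob \<Delta> tE (l @ [rm eh g]) x = et (l @ [g]) x"
      using ctE[OF l'(2) that(2), of l' x] cth[OF lg, of x] l'(1) by simp
    then show ?thesis by (simp add: h1_def et_def)
  qed
  define p where "p = (\<lambda>l x. onlast gA h1 l x + onlast hA e2 l x)"
  have pg: "good (slots (Suc k) sA) p"
    unfolding p_def by (intro good_add good_onlast[OF slotmap_gA h1] good_onlast[OF slotmap_hA e2(1)])
  \<comment> \<open>Independence of the decomposition F = G rho + H e: the difference of two is (g
    e, - g rho) with g in \<open>sT\<close>, where \<open>comp\<close> gives 0. This is applied to a
    F, whose decomposition comes from that of F.\<close>
  have p_eq: "p (l @ [F]) x = h1 (l @ [G]) x + e2 (l @ [H]) x"
    if F: "F \<in> sA" and G: "G \<in> sE" and H: "H \<in> sE" and s: "snd G = snd H"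
      and e: "hadd 1 (rm rhoh G) (rm eh H) = F" and l: "fits l (replicate (Suc k) sA)" for F G H l x
  proof -
    note gh = gA_hA[OF F]
    have sG: "snd G = snd F" using arg_cong[OF e, of snd] by (simp add: hadd_def hmul_def rhoh_def)
    have sg: "snd (gA F) = snd F" "snd (hA F) = snd F" by (simp_all add: gA_def hA_def)
    let ?U = "hadd (- 1) G (gA F)" and ?V = "hadd (- 1) H (hA F)"
    have U: "?U \<in> sE" "?V \<in> sE" using G H gh sG sg s by (auto intro!: amodD(3)[OF amod_sE])
    have z: "fst ?U x s * rho (x + snd F) s + fst ?V x s * (s * (1 - s)) = 0" for x s
    proof -
      have "fst G x s * rho (x + snd F) s + fst H x s * (s * (1 - s)) = fst F x s"
        using arg_cong[OF e, of "\<lambda>h. fst h x s"] sG by (simp add: hadd_def hmul_def rhoh_def eh_def)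
      moreover have "fst (gA F) x s * rho (x + snd F) s + fst (hA F) x s * (s * (1 - s)) = fst F x s"
        using arg_cong[OF gh(3), of "\<lambda>h. fst h x s"] sg by (simp add: hadd_def hmul_def rhoh_def eh_def)
      moreover have "fst ?U x s * rho (x + snd F) s + fst ?V x s * (s * (1 - s))
        = (fst G x s * rho (x + snd F) s + fst H x s * (s * (1 - s)))
          - (fst (gA F) x s * rho (x + snd F) s + fst (hA F) x s * (s * (1 - s)))"
        by (simp add: hadd_def algebra_simps)
      ultimately show ?thesis by simp
    qed
    have pU: "psym (fst ?U)" and pV: "psym (fst ?V)" using U by (auto simp: sE_iff)
    have U1: "fst ?U x 0 = x * fst ?U x 1" and V1: "fst ?V x 0 = x * fst ?V x 1" for x
      using U unfolding sE_iff by blast+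
    have U00: "fst ?U x 0 = 0" for x using z[of x 0] by (simp add: rho_def)
    have "fst ?U x 1 = 0" for x
    proof -
      obtain q where q: "\<And>x. fst ?U x 1 = poly q x" using psym_family_line_x[OF pU] by blast
      have "q = 0"
      proof (rule poly_cofinite_eq[of "{0}"])
        fix x :: 'k assume "x \<notin> {0}"
        then show "poly q x = poly 0 x" using U1[of x] U00[of x] unfolding q by simp
      qed simp
      then show ?thesis using q by simp
    qed
    then have Ue: "fst ?U x s = s * (1 - s) * dive (fst ?U) x s" for x s
      using U00 by (intro e_decompI[OF pU])
    define g where "g = (dive (fst ?U), snd F)"
    have sU: "snd ?U = snd F" using sG by (simp add: hadd_def)
    have eg: "rm eh g = ?U"
    proof (intro prod_eqI ext)
      show "fst (rm eh g) x s = fst ?U x s" for x s using Ue[of x s] by (simp add: hmul_def eh_def g_def mult_ac)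
      show "snd (rm eh g) = snd ?U" by (simp add: hmul_def eh_def g_def sU)
    qed
    have pg: "psym (fst g)" using psym_dive[OF pU] by (simp add: g_def)
    have Vw: "fst ?V x s = - (fst g x s * rho (x + snd F) s)" for x s
    proof -
      obtain q where q: "\<And>s. fst ?V x s = poly q s" using psym_family_line_s[OF pV] by blast
      have "psym (\<lambda>x s. - (fst g x s * rho (x + snd F) s))"
        unfolding rho_def by (rule psym_familyI) (intro polyfun_intros psym_eval[OF pg])
      then obtain r where r: "\<And>s. - (fst g x s * rho (x + snd F) s) = poly r s"
        using psym_family_line_s by blast
      have "q = r"
      proof (rule poly_cofinite_eq[OF finite_e_roots])
        fix s :: 'k assume "s \<notin> {s. s * (1 - s) = 0}"
        then have s: "s * (1 - s) \<noteq> 0" by simp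
        have "s * (1 - s) * (fst g x s * rho (x + snd F) s + fst ?V x s) = 0"
          using z[of x s] unfolding Ue[of x s] by (simp add: g_def algebra_simps)
        then have "fst g x s * rho (x + snd F) s + fst ?V x s = 0" using s by (metis mult_eq_0_iff)
        then show "poly q s = poly r s" unfolding q[symmetric] r[symmetric]
          by (simp add: eq_neg_iff_add_eq_0 add.commute)
      qed
      then show ?thesis using q r by simp
    qed
    have "fst g x 0 = x * (x + snd g) * fst g x 1" for x
      using V1[of x] unfolding Vw by (simp add: rho_def g_def mult_ac)
    then have gT: "g \<in> sT" using pg by (simp add: sT_iff)
    define W where "W = rm rhoh g"
    have W: "W \<in> sE" unfolding W_def by (rule rm_sT[OF gT])
    have V: "hadd (- 2) W W = ?V"
    proof (intro prod_eqI ext)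
      show "fst (hadd (- 2) W W) x s = fst ?V x s" for x s
        unfolding Vw by (simp add: hadd_def W_def hmul_def rhoh_def g_def)
      show "snd (hadd (- 2) W W) = snd ?V" using s sG by (simp add: hadd_def W_def hmul_def rhoh_def g_def)
    qed
    have "e2 (l @ [?V]) x = - e2 (l @ [W]) x"
      unfolding V[symmetric] using good_last_lin[OF e2(1) l W W refl, of "- 2" x] by simp
    moreover have "h1 (l @ [?U]) x = e2 (l @ [W]) x"
      using comp[OF l gT, of x] by (simp only: eg W_def)
    moreover have "h1 (l @ [?U]) x = h1 (l @ [G]) x - h1 (l @ [gA F]) x"
      using good_last_lin[OF h1 l G gh(1), of "- 1" x] sG sg by simp
    moreover have "e2 (l @ [?V]) x = e2 (l @ [H]) x - e2 (l @ [hA F]) x"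
      using good_last_lin[OF e2(1) l H gh(2), of "- 1" x] sG sg s by simp
    ultimately show ?thesis by (simp add: p_def algebra_simps)
  qed
  have "hcob \<Delta> p l x = f l x" if l: "fits l (slots (Suc (Suc k)) sA)" for l x
  proof -
    obtain l' a F where l': "l = l' @ [a, F]" "fits l' (replicate (Suc k) sA)" "a \<in> sA" "F \<in> sA"
      using fits_slots_SucE[OF l] by blast
    note gh = gA_hA[OF l'(4)]
    have sg: "snd (gA F) = snd F" "snd (hA F) = snd F" by (simp_all add: gA_def hA_def)
    have "hcob \<Delta> p (l' @ [a, F]) x = hcob \<Delta> h1 (l' @ [a, gA F]) x + hcob \<Delta> e2 (l' @ [a, hA F]) x"
    proof (rule hcob_descend[OF l'(2,3)])
      show "p (l @ [F]) = (\<lambda>x. h1 (l @ [gA F]) x + e2 (l @ [hA F]) x)" for l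
        by (simp add: p_def)
      have "hadd 1 (rm rhoh (hmul a (gA F))) (rm eh (hmul a (hA F))) = hmul a F"
        unfolding hmul_assoc hmul_hadd[symmetric] gh(3) ..
      moreover have "snd (hmul a (gA F)) = snd (hmul a (hA F))" using sg by (simp add: hmul_def)
      ultimately show "p (l' @ [hmul a F]) x = h1 (l' @ [hmul a (gA F)]) x + e2 (l' @ [hmul a (hA F)]) x"
        using l' gh amodD(1)[OF amod_sA] amodD(1)[OF amod_sE] by (intro p_eq)
    qed
    also have "\<dots> = fr (l' @ [a, gA F]) x + fe (l' @ [a, hA F]) x"
      using l' gh ch1[of "l' @ [a, gA F]" x] e2(2)[of "l' @ [a, hA F]" x] by (simp add: fits_snoc2)
    also have "\<dots> = f ((l' @ [a]) @ [rm rhoh (gA F)]) x + f ((l' @ [a]) @ [rm eh (hA F)]) x"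
      using onlast_snoc[of "rm rhoh" f "l' @ [a]" "gA F"] onlast_snoc[of "rm eh" f "l' @ [a]" "hA F"]
      by (simp add: fr_def fe_def)
    also have "\<dots> = f ((l' @ [a]) @ [hadd 1 (rm rhoh (gA F)) (rm eh (hA F))]) x"
    proof -
      have "fits (l' @ [a]) (replicate (Suc (Suc k)) sA)"
        using l'(2,3) fits_slots_snoc[of l' a "Suc k" sA] by (simp add: slots_sA)
      then show ?thesis
        using good_last_lin[OF good_f _ rm_sE(1)[OF gh(1)] rm_eh(1)[OF psym_sE[OF gh(2)]], of "l' @ [a]" 1 x] sg
        by (simp add: hmul_def rhoh_def eh_def)
    qed
    finally show ?thesis unfolding gh(3) l'(1) by simp
  qed
  then show ?thesis using pg by blast
qed

section \<open>The conformal algebra of symbols\<close>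

text \<open>The leading argument is the value \<nu> of the formal variable; the derivation acts as
  multiplication by - \<nu>. Fixing \<nu> = l gives the symbol of an operator of degree l.\<close>

type_synonym 'k sym3 = "'k \<Rightarrow> 'k \<Rightarrow> 'k \<Rightarrow> 'k"

definition psym3 :: "'k::field_char_0 sym3 \<Rightarrow> bool" where
  "psym3 F \<longleftrightarrow> psym_family (\<lambda>y. F (y 0))"

lemma psym3_eval:
  assumes "psym3 F" "\<nu> \<in> polyfun UNIV" "\<xi> \<in> polyfun UNIV" "\<sigma> \<in> polyfun UNIV"
  shows "(\<lambda>y. F (\<nu> y) (\<xi> y) (\<sigma> y)) \<in> polyfun UNIV"
  using psym_family_eval[OF assms(1)[unfolded psym3_def], of "\<lambda>y i. \<nu> y"] assms(2-4) by simp

lemma psym3I: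
  assumes "\<And>(\<nu> :: (nat \<Rightarrow> 'k::field_char_0) \<Rightarrow> 'k) \<xi> \<sigma>. \<nu> \<in> polyfun UNIV \<Longrightarrow> \<xi> \<in> polyfun UNIV \<Longrightarrow>
    \<sigma> \<in> polyfun UNIV \<Longrightarrow> (\<lambda>y. F (\<nu> y) (\<xi> y) (\<sigma> y)) \<in> polyfun UNIV"
  shows "psym3 F"
  unfolding psym3_def by (rule psym_familyI, rule assms) auto

definition fscale :: "'k::field_char_0 \<Rightarrow> 'k sym3 \<Rightarrow> 'k sym3" where
  "fscale c F = (\<lambda>\<nu> x s. c * F \<nu> x s)"

definition mon3 :: "nat \<times> nat \<times> nat \<Rightarrow> 'k::field_char_0 sym3" where
  "mon3 t \<nu> x s = \<nu> ^ fst t * x ^ fst (snd t) * s ^ snd (snd t)"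

lemma vector_space_fscale: "vector_space (fscale :: 'k::field_char_0 \<Rightarrow> _)"
  by unfold_locales (simp_all add: fscale_def fun_eq_iff algebra_simps)

interpretation fs: vector_space fscale
  by (rule vector_space_fscale)

lemma span_mon3_mult:
  assumes "A \<in> fs.span (range mon3)" "B \<in> fs.span (range mon3)"
  shows "(\<lambda>\<nu> x s. A \<nu> x s * B \<nu> x s) \<in> fs.span (range mon3)"
proof -
  let ?S = "fs.span (range (mon3 :: _ \<Rightarrow> 'a sym3))"
  have sub: "fs.subspace {A. (\<lambda>\<nu> x s. A \<nu> x s * B \<nu> x s) \<in> ?S}" for B :: "'a sym3"
  proof (rule fs.subspaceI)
    show "0 \<in> {A. (\<lambda>\<nu> x s. A \<nu> x s * B \<nu> x s) \<in> ?S}"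
      using fs.span_zero[of "range mon3"] by (simp add: zero_fun_def)
    fix A1 A2 assume a: "A1 \<in> {A. (\<lambda>\<nu> x s. A \<nu> x s * B \<nu> x s) \<in> ?S}"
    show "fscale c A1 \<in> {A. (\<lambda>\<nu> x s. A \<nu> x s * B \<nu> x s) \<in> ?S}" for c
      using fs.span_scale[of _ "range mon3" c] a by (simp add: fscale_def mult.assoc)
    assume b: "A2 \<in> {A. (\<lambda>\<nu> x s. A \<nu> x s * B \<nu> x s) \<in> ?S}"
    show "A1 + A2 \<in> {A. (\<lambda>\<nu> x s. A \<nu> x s * B \<nu> x s) \<in> ?S}"
      using fs.span_add[of _ "range mon3"] a b by (force simp: plus_fun_def distrib_right)
  qed
  have mm: "(\<lambda>\<nu> x s. mon3 t \<nu> x s * mon3 u \<nu> x s) \<in> ?S" for t u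
  proof -
    have "(\<lambda>\<nu> x s. mon3 t \<nu> x s * mon3 u \<nu> x s :: 'a)
        = mon3 (fst t + fst u, fst (snd t) + fst (snd u), snd (snd t) + snd (snd u))"
      by (simp add: mon3_def fun_eq_iff power_add mult_ac)
    then show ?thesis by (simp add: fs.span_base)
  qed
  have Am: "(\<lambda>\<nu> x s. A \<nu> x s * mon3 u \<nu> x s) \<in> ?S" if "A \<in> ?S" for A u
    using fs.span_minimal[OF _ sub, of "range mon3" "mon3 u"] mm that by blast
  have "(\<lambda>\<nu> x s. B \<nu> x s * A \<nu> x s) \<in> ?S"
  proof -
    have "range mon3 \<subseteq> {B. (\<lambda>\<nu> x s. B \<nu> x s * A \<nu> x s) \<in> ?S}"
      using Am[OF assms(1)] by (auto simp: mult.commute)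
    from fs.span_minimal[OF this sub] show ?thesis using assms(2) by blast
  qed
  then show ?thesis by (simp add: mult.commute)
qed

text \<open>Countably many monomials span, so a vector space with a countably infinite independent
  family maps linearly onto the polynomial symbols.\<close>

lemma span_mon3: "fs.span (range mon3) = {F :: 'k::field_char_0 sym3. psym3 F}"
proof
  show "fs.span (range mon3) \<subseteq> {F :: 'k sym3. psym3 F}"
  proof (rule fs.span_minimal)
    show "range mon3 \<subseteq> {F :: 'k sym3. psym3 F}"
      by (auto intro!: psym3I polyfun_intros simp: mon3_def)
    show "fs.subspace {F :: 'k sym3. psym3 F}"
    proof (rule fs.subspaceI)
      show "0 \<in> {F :: 'k sym3. psym3 F}" by (simp add: psym3I zero_fun_def pf_const)
      fix F G :: "'k sym3" assume F: "F \<in> {F. psym3 F}"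
      then have F': "psym3 F" by simp
      show "fscale c F \<in> {F. psym3 F}" for c
        unfolding fscale_def mem_Collect_eq by (intro psym3I polyfun_intros psym3_eval[OF F'])
      assume "G \<in> {F. psym3 F}"
      then have G': "psym3 G" by simp
      show "F + G \<in> {F. psym3 F}"
        unfolding plus_fun_def mem_Collect_eq by (intro psym3I polyfun_intros psym3_eval[OF F'] psym3_eval[OF G'])
    qed
  qed
  show "{F :: 'k sym3. psym3 F} \<subseteq> fs.span (range mon3)"
  proof
    fix F :: "'k sym3" assume "F \<in> {F. psym3 F}"
    then have F: "psym3 F" by simp
    let ?g = "\<lambda>\<nu> x s i. if i = (0::nat) then x else if i = 1 then s else (\<nu> :: 'k)"
    have "(\<lambda>\<nu> x s. f (?g \<nu> x s)) \<in> fs.span (range mon3)" if "f \<in> polyfun UNIV" for f :: "(nat \<Rightarrow> 'k) \<Rightarrow> 'k"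
      using that
    proof induction
      case (pf_const c)
      have "(\<lambda>\<nu> x s. c) = fscale c (mon3 (0, 0, 0))" by (simp add: fscale_def mon3_def fun_eq_iff)
      then show ?case by (simp add: fs.span_base fs.span_scale)
    next
      case (pf_var i)
      have "(\<lambda>\<nu> x s. ?g \<nu> x s i) = mon3 (if i = 0 then (0, 1, 0) else if i = 1 then (0, 0, 1) else (1, 0, 0))"
        by (simp add: mon3_def fun_eq_iff)
      then show ?case by (simp only:) (rule fs.span_base, blast)
    next
      case (pf_add p q)
      then show ?case using fs.span_add[of _ "range mon3"] by (force simp: plus_fun_def)
    next
      case (pf_mult p q)
      show ?case using span_mon3_mult[OF pf_mult.IH] by simp
    qed
    from this[OF F[unfolded psym3_def psym_family_def]] show "F \<in> fs.span (range mon3)" by simp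
  qed
qed

text \<open>The degree bound is uniform in the parameters: it makes the n-products vanish
  identically from some n on, which is the locality axiom.\<close>

lemma polyfun_coeffs:
  assumes "f \<in> polyfun UNIV"
  shows "\<exists>Q d. (\<forall>y t. f (y(i := t)) = poly (Q y) t) \<and> (\<forall>n. (\<lambda>y. coeff (Q y) n) \<in> polyfun UNIV) \<and>
    (\<forall>y. degree (Q y) \<le> d)"
  using assms
proof induction
  case (pf_const c)
  show ?case by (rule exI[of _ "\<lambda>_. [:c:]"], rule exI[of _ 0]) (auto intro: polyfun_intros)
next
  case (pf_var j)
  show ?case
  proof (cases "j = i")
    case True
    then show ?thesis by (intro exI[of _ "\<lambda>_. [:0, 1:]"] exI[of _ 1]) (auto intro: polyfun_intros)
  next
    case False
    have "(\<lambda>y. coeff [:y j:] n) \<in> polyfun UNIV" for n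
      by (cases n) (auto intro: polyfun_intros)
    then show ?thesis using False by (intro exI[of _ "\<lambda>y. [:y j:]"] exI[of _ 0]) auto
  qed
next
  case (pf_add p q)
  obtain P d Q e where P: "\<And>y t. p (y(i := t)) = poly (P y) t" "\<And>n. (\<lambda>y. coeff (P y) n) \<in> polyfun UNIV" "\<And>y. degree (P y) \<le> d"
    and Q: "\<And>y t. q (y(i := t)) = poly (Q y) t" "\<And>n. (\<lambda>y. coeff (Q y) n) \<in> polyfun UNIV" "\<And>y. degree (Q y) \<le> e"
    using pf_add.IH by blast
  show ?case
  proof (rule exI[of _ "\<lambda>y. P y + Q y"], rule exI[of _ "max d e"], intro conjI allI)
    show "p (y(i := t)) + q (y(i := t)) = poly (P y + Q y) t" for y t by (simp only: P Q poly_add)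
    show "(\<lambda>y. coeff (P y + Q y) n) \<in> polyfun UNIV" for n
      unfolding coeff_add by (intro polyfun.pf_add P Q)
    show "degree (P y + Q y) \<le> max d e" for y
      by (rule order.trans[OF degree_add_le_max]) (intro max.mono P Q)
  qed
next
  case (pf_mult p q)
  obtain P d Q e where P: "\<And>y t. p (y(i := t)) = poly (P y) t" "\<And>n. (\<lambda>y. coeff (P y) n) \<in> polyfun UNIV" "\<And>y. degree (P y) \<le> d"
    and Q: "\<And>y t. q (y(i := t)) = poly (Q y) t" "\<And>n. (\<lambda>y. coeff (Q y) n) \<in> polyfun UNIV" "\<And>y. degree (Q y) \<le> e"
    using pf_mult.IH by blast
  show ?case
  proof (rule exI[of _ "\<lambda>y. P y * Q y"], rule exI[of _ "d + e"], intro conjI allI)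
    show "p (y(i := t)) * q (y(i := t)) = poly (P y * Q y) t" for y t by (simp only: P Q poly_mult)
    show "(\<lambda>y. coeff (P y * Q y) n) \<in> polyfun UNIV" for n
      unfolding coeff_mult by (intro polyfun_sum polyfun.pf_mult P Q)
    show "degree (P y * Q y) \<le> d + e" for y
      by (rule order.trans[OF degree_mult_le]) (intro add_mono P Q)
  qed
qed

text \<open>\<open>lcoef F G n\<close> is the \<open>n\<close>-th product of the symbols \<open>F\<close> and \<open>G\<close> in \<open>Cend\<^sub>1[s]\<close>.\<close>

definition lcoef :: "'k::field_char_0 sym3 \<Rightarrow> 'k sym3 \<Rightarrow> nat \<Rightarrow> 'k sym3" where
  "lcoef F G n = (\<lambda>\<nu> x s. fact n * coeff (THE q. \<forall>t. poly q t = F t x s * G (\<nu> - t) (x + t) s) n)"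

lemma lcoef_eq:
  assumes "\<And>t. poly q t = F t x s * G (\<nu> - t) (x + t) s"
  shows "lcoef F G n \<nu> x s = fact n * coeff q n"
proof -
  have "(THE q. \<forall>t. poly q t = F t x s * G (\<nu> - t) (x + t) s) = q"
    using assms by (intro the_equality) (auto intro: poly_cofinite_eq[of "{}"])
  then show ?thesis by (simp add: lcoef_def)
qed

lemma lcoef_family:
  assumes F: "psym3 F" and G: "psym3 G"
  shows "\<exists>Q d. (\<forall>\<nu> x s t. poly (Q \<nu> x s) t = F t x s * G (\<nu> - t) (x + t) s) \<and>
    (\<forall>n. psym3 (\<lambda>\<nu> x s. coeff (Q \<nu> x s) n)) \<and> (\<forall>\<nu> x s. degree (Q \<nu> x s) \<le> d)"
proof -
  have "(\<lambda>y. F (y 3) (y 0) (y 1) * G (y 2 - y 3) (y 0 + y 3) (y 1)) \<in> polyfun UNIV"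
    by (intro polyfun_intros psym3_eval[OF F] psym3_eval[OF G])
  from polyfun_coeffs[OF this, of 3] obtain Q d where
    Q: "\<And>y t. F t (y 0) (y 1) * G (y 2 - t) (y 0 + t) (y 1) = poly (Q y) t"
      "\<And>n. (\<lambda>y. coeff (Q y) n) \<in> polyfun UNIV" "\<And>y. degree (Q y) \<le> d" by auto
  let ?g = "\<lambda>\<nu> x s i. if i = (0::nat) then x else if i = 1 then s else (\<nu> :: 'a)"
  have "psym3 (\<lambda>\<nu> x s. coeff (Q (?g \<nu> x s)) n)" for n
    by (rule psym3I, rule polyfun_eval[OF Q(2)]) (auto intro!: polyfun_if)
  moreover have "poly (Q (?g \<nu> x s)) t = F t x s * G (\<nu> - t) (x + t) s" for \<nu> x s t
    using Q(1)[of t "?g \<nu> x s"] by simp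
  ultimately show ?thesis using Q(3) by (intro exI[of _ "\<lambda>\<nu> x s. Q (?g \<nu> x s)"] exI[of _ d]) blast
qed

lemma lcoef_props:
  assumes F: "psym3 F" and G: "psym3 G"
  shows "\<exists>d. (\<forall>n. psym3 (lcoef F G n)) \<and> (\<forall>n>d. lcoef F G n = 0) \<and>
    (\<forall>l \<nu> x s. (\<Sum>n\<le>d. l ^ n / fact n * lcoef F G n \<nu> x s) = F l x s * G (\<nu> - l) (x + l) s)"
proof -
  obtain Q d where Q: "\<And>\<nu> x s t. poly (Q \<nu> x s) t = F t x s * G (\<nu> - t) (x + t) s"
    "\<And>n. psym3 (\<lambda>\<nu> x s. coeff (Q \<nu> x s) n)" "\<And>\<nu> x s. degree (Q \<nu> x s) \<le> d"
    using lcoef_family[OF F G] by blast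
  have L: "lcoef F G n \<nu> x s = fact n * coeff (Q \<nu> x s) n" for n \<nu> x s
    by (rule lcoef_eq[OF Q(1)])
  have "psym3 (lcoef F G n)" for n
  proof -
    have "lcoef F G n = (\<lambda>\<nu> x s. fact n * coeff (Q \<nu> x s) n)" using L by (simp add: fun_eq_iff)
    then show ?thesis by (simp only:) (intro psym3I polyfun_intros psym3_eval[OF Q(2)])
  qed
  moreover have "lcoef F G n = 0" if "n > d" for n
    using that Q(3) by (simp add: fun_eq_iff L) (meson coeff_eq_0 le_less_trans)
  moreover have "(\<Sum>n\<le>d. l ^ n / fact n * lcoef F G n \<nu> x s) = F l x s * G (\<nu> - l) (x + l) s" for l \<nu> x s
  proof -
    have "(\<Sum>n\<le>d. l ^ n / fact n * lcoef F G n \<nu> x s) = (\<Sum>n\<le>d. coeff (Q \<nu> x s) n * l ^ n)"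
      unfolding L by (intro sum.cong) auto
    also have "\<dots> = (\<Sum>n\<le>degree (Q \<nu> x s). coeff (Q \<nu> x s) n * l ^ n)"
      using Q(3) by (intro sum.mono_neutral_right) (auto simp: coeff_eq_0)
    also have "\<dots> = poly (Q \<nu> x s) l" by (simp add: poly_altdef)
    finally show ?thesis unfolding Q(1) .
  qed
  ultimately show ?thesis by blast
qed

lemma lcoef_add_scale:
  assumes "psym3 F" "psym3 G" "psym3 H"
  shows "lcoef (F + fscale c H) G n = lcoef F G n + fscale c (lcoef H G n)"
    "lcoef G (F + fscale c H) n = lcoef G F n + fscale c (lcoef G H n)"
proof -
  have ex: "\<exists>q. \<forall>t. poly q t = F t x s * G (\<nu> - t) (x + t) s" if "psym3 F" "psym3 G" for F G :: "'a sym3" and \<nu> x s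
    using lcoef_family[OF that] by metis
  show "lcoef (F + fscale c H) G n = lcoef F G n + fscale c (lcoef H G n)"
  proof (intro ext)
    fix \<nu> x s
    obtain p q where p: "\<And>t. poly p t = F t x s * G (\<nu> - t) (x + t) s" and q: "\<And>t. poly q t = H t x s * G (\<nu> - t) (x + t) s"
      using ex assms by metis
    have "lcoef (F + fscale c H) G n \<nu> x s = fact n * coeff (p + smult c q) n"
      by (rule lcoef_eq) (simp add: p q fscale_def algebra_simps)
    then show "lcoef (F + fscale c H) G n \<nu> x s = (lcoef F G n + fscale c (lcoef H G n)) \<nu> x s"
      by (simp add: lcoef_eq[where F = F and G = G and x = x and s = s and \<nu> = \<nu>, OF p]
        lcoef_eq[where F = H and G = G and x = x and s = s and \<nu> = \<nu>, OF q] fscale_def algebra_simps)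
  qed
  show "lcoef G (F + fscale c H) n = lcoef G F n + fscale c (lcoef G H n)"
  proof (intro ext)
    fix \<nu> x s
    obtain p q where p: "\<And>t. poly p t = G t x s * F (\<nu> - t) (x + t) s" and q: "\<And>t. poly q t = G t x s * H (\<nu> - t) (x + t) s"
      using ex assms by metis
    have "lcoef G (F + fscale c H) n \<nu> x s = fact n * coeff (p + smult c q) n"
      by (rule lcoef_eq) (simp add: p q fscale_def algebra_simps)
    then show "lcoef G (F + fscale c H) n \<nu> x s = (lcoef G F n + fscale c (lcoef G H n)) \<nu> x s"
      by (simp add: lcoef_eq[where F = G and G = F and x = x and s = s and \<nu> = \<nu>, OF p]
        lcoef_eq[where F = G and G = H and x = x and s = s and \<nu> = \<nu>, OF q] fscale_def algebra_simps)
  qed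
qed

definition vsym :: "'k::field_char_0 sym3" where
  "vsym \<nu> x s = x + s * \<nu>"

lemma psym3_vsym: "psym3 vsym"
  unfolding vsym_def by (intro psym3I polyfun_intros)

lemma lcoef_vsym:
  "n \<ge> 3 \<Longrightarrow> lcoef vsym vsym n = 0"
  "lcoef vsym vsym 1 = (\<lambda>\<nu> x s. x + s * s * \<nu>)"
  "lcoef vsym vsym 2 = (\<lambda>\<nu> x s. 2 * (s * (1 - s)))"
proof -
  \<comment> \<open>The coefficients are those of (x + s t) (x + t + s (\<nu> - t)) as a polynomial
    in t.\<close>
  have L: "lcoef vsym vsym n \<nu> x s = fact n * coeff [:x * (x + s * \<nu>), x + s * s * \<nu>, s * (1 - s):] n" for n \<nu> x s
    by (rule lcoef_eq) (simp add: vsym_def algebra_simps)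
  show "n \<ge> 3 \<Longrightarrow> lcoef vsym vsym n = 0"
    by (simp add: fun_eq_iff L coeff_eq_0)
  show "lcoef vsym vsym 1 = (\<lambda>\<nu> x s. x + s * s * \<nu>)" by (simp add: fun_eq_iff L)
  show "lcoef vsym vsym 2 = (\<lambda>\<nu> x s. 2 * (s * (1 - s)))"
    by (simp add: fun_eq_iff L numeral_2_eq_2)
qed

text \<open>Universality of \<open>U(3)\<close> is only stated for structures on the given vector space, so the conformal
  algebra of symbols is transported there along a partial section of a surjection.\<close>

theorem U3_symbol_hom:
  fixes scale :: "'k::field_char_0 \<Rightarrow> 'c::ab_group_add \<Rightarrow> 'c"
  assumes U3: "is_U3 scale D nprod v"
    and ind: "inj b" "\<not> module.dependent scale (range (b :: nat \<Rightarrow> 'c))"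
  shows "\<exists>h :: 'c \<Rightarrow> 'k sym3. (\<forall>a. psym3 (h a)) \<and> (\<forall>a b. h (a + b) = h a + h b) \<and>
    (\<forall>c a. h (scale c a) = fscale c (h a)) \<and> (\<forall>a \<nu> x s. h (D a) \<nu> x s = - \<nu> * h a \<nu> x s) \<and>
    (\<forall>a b l \<nu> x s. h (lprod scale nprod a b l) \<nu> x s = h a l x s * h b (\<nu> - l) (x + l) s) \<and> h v = vsym"
proof -
  have AC: "assoc_conformal_algebra scale D nprod" using U3 by (simp add: is_U3_def)
  then have vs: "vector_space scale" and fin: "\<And>a b. finite {n. nprod n a b \<noteq> 0}"
    by (auto simp: assoc_conformal_algebra_def)
  interpret vs: vector_space scale by (rule vs)
  interpret vp: vector_space_pair scale fscale ..
  define B where "B = range b"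
  have iB: "vs.independent B" using ind(2) by (simp add: B_def)
  \<comment> \<open>Decoding pairs twice turns the index of a basis vector into a triple of
    exponents, so every monomial is hit.\<close>
  define f where "f = (\<lambda>c. mon3 (apsnd prod_decode (prod_decode (inv b c))) :: 'k sym3)"
  define p where "p = vp.construct B f"
  have fB: "f ` B = range mon3"
  proof -
    have "f ` B = (\<lambda>n. mon3 (apsnd prod_decode (prod_decode n))) ` UNIV"
      using ind(1) by (auto simp: f_def B_def image_image)
    also have "\<dots> = range mon3"
    proof -
      have "range (\<lambda>n. apsnd prod_decode (prod_decode n)) = (UNIV :: (nat \<times> nat \<times> nat) set)"
      proof (rule surjI[of _ "\<lambda>t. prod_encode (apsnd prod_encode t)"])
        show "apsnd prod_decode (prod_decode (prod_encode (apsnd prod_encode t))) = t" for t :: "nat \<times> nat \<times> nat"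
          by (cases t) simp
      qed
      moreover have "range (\<lambda>n. mon3 (apsnd prod_decode (prod_decode n)))
          = mon3 ` range (\<lambda>n. apsnd prod_decode (prod_decode n))" by (simp only: image_image)
      ultimately show ?thesis by simp
    qed
    finally show ?thesis .
  qed
  have lp: "Vector_Spaces.linear scale fscale p" unfolding p_def by (rule vp.linear_construct[OF iB])
  have rp: "range p = {F. psym3 F}"
  proof -
    have "range p = fs.span (f ` B)"
      unfolding p_def by (rule vp.range_construct_eq_span[OF iB])
    then show ?thesis unfolding fB span_mon3 .
  qed
  then have pp: "psym3 (p a)" for a by blast
  have "\<exists>g. g ` UNIV \<subseteq> UNIV \<and> Vector_Spaces.linear fscale scale g \<and> (\<forall>F\<in>p ` UNIV. p (g F) = F)"
    by (rule vp.linear_exists_right_inverse_on[OF lp vs.subspace_UNIV])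
  then obtain j where lj: "Vector_Spaces.linear fscale scale j" and pj: "\<And>F. psym3 F \<Longrightarrow> p (j F) = F"
    unfolding rp by auto
  have p_add: "p (a + b) = p a + p b" and p_scale: "p (scale c a) = fscale c (p a)" for a b c
    using lp by (auto simp: Vector_Spaces.linear_iff)
  have j_add: "j (F + G) = j F + j G" and j_scale: "j (fscale c F) = scale c (j F)" for F G c
    using lj by (auto simp: Vector_Spaces.linear_iff)
  have j_0: "j 0 = 0" using j_add[of 0 0] by simp
  have j_sum: "j (\<Sum>i\<in>I. g i) = (\<Sum>i\<in>I. j (g i))" for g and I :: "nat set"
    using sum_comp_morphism[of j g I, OF j_0 j_add] by (simp only: comp_def)
  \<comment> \<open>Each operation reads its arguments through \<open>p\<close> and returns through
    \<open>j\<close>. As \<open>p\<close> inverts \<open>j\<close> on polynomial symbols, the axioms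
    reduce to identities between symbols.\<close>
  define D' where "D' = (\<lambda>a. j (\<lambda>\<nu> x s. - \<nu> * p a \<nu> x s))"
  define n' where "n' = (\<lambda>n a b. j (lcoef (p a) (p b) n))"
  define w where "w = j vsym"
  have pD: "p (D' a) = (\<lambda>\<nu> x s. - \<nu> * p a \<nu> x s)" for a
    unfolding D'_def by (intro pj psym3I polyfun_intros psym3_eval[OF pp])
  have pw: "p w = vsym" unfolding w_def by (rule pj[OF psym3_vsym])
  have fin': "finite {n. n' n a b \<noteq> 0}" for a b
  proof -
    obtain d where "\<And>n. n > d \<Longrightarrow> lcoef (p a) (p b) n = 0" using lcoef_props[OF pp pp] by blast
    then have "{n. n' n a b \<noteq> 0} \<subseteq> {..d}" by (auto simp: n'_def j_0 not_less[symmetric])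
    then show ?thesis using finite_subset by blast
  qed
  have lp': "lprod scale n' a b l = j (\<lambda>\<nu> x s. p a l x s * p b (\<nu> - l) (x + l) s)" for a b l
  proof -
    obtain d where d: "\<And>n. n > d \<Longrightarrow> lcoef (p a) (p b) n = 0"
      "\<And>l \<nu> x s. (\<Sum>n\<le>d. l ^ n / fact n * lcoef (p a) (p b) n \<nu> x s) = p a l x s * p b (\<nu> - l) (x + l) s"
      using lcoef_props[OF pp pp] by blast
    have "lprod scale n' a b l = (\<Sum>n\<le>d. scale (l ^ n / fact n) (n' n a b))"
      unfolding lprod_def
      using d(1) by (intro sum.mono_neutral_left) (auto simp: n'_def j_0 not_less[symmetric])
    also have "\<dots> = j (\<Sum>n\<le>d. fscale (l ^ n / fact n) (lcoef (p a) (p b) n))"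
      unfolding j_sum n'_def j_scale ..
    also have "(\<Sum>n\<le>d. fscale (l ^ n / fact n) (lcoef (p a) (p b) n)) = (\<lambda>\<nu> x s. p a l x s * p b (\<nu> - l) (x + l) s)"
    proof (intro ext)
      fix \<nu> x s
      have "(\<Sum>n\<in>I. fscale (l ^ n / fact n) (lcoef (p a) (p b) n)) \<nu> x s
        = (\<Sum>n\<in>I. l ^ n / fact n * lcoef (p a) (p b) n \<nu> x s)" for I :: "nat set"
        by (induction I rule: infinite_finite_induct) (simp_all add: fscale_def)
      then show "(\<Sum>n\<le>d. fscale (l ^ n / fact n) (lcoef (p a) (p b) n)) \<nu> x s = p a l x s * p b (\<nu> - l) (x + l) s"
        by (simp only: d(2))
    qed
    finally show ?thesis .
  qed
  have plp: "p (lprod scale n' a b l) = (\<lambda>\<nu> x s. p a l x s * p b (\<nu> - l) (x + l) s)" for a b l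
    unfolding lp' by (intro pj psym3I polyfun_intros psym3_eval[OF pp])
  have lin: "Vector_Spaces.linear scale scale T"
    if "\<And>a b. T (a + b) = T a + T b" "\<And>c a. T (scale c a) = scale c (T a)" for T
    using that vs by (simp add: Vector_Spaces.linear_iff)
  have one: "F + fscale 1 G = F + G" "(0 :: 'k sym3) + fscale c G = fscale c G" for F G c
    by (simp_all add: fscale_def fun_eq_iff)
  have p0: "psym3 0" by (simp add: psym3I zero_fun_def pf_const)
  have lc0: "lcoef 0 G n = 0" "lcoef G 0 n = 0" for G :: "'k sym3" and n
    by (simp_all add: fun_eq_iff lcoef_eq[of 0])
  have AC': "assoc_conformal_algebra scale D' n'"
    unfolding assoc_conformal_algebra_def
  proof (intro conjI allI)
    show "vector_space scale" by (rule vs)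
    show "Vector_Spaces.linear scale scale D'"
    proof (rule lin)
      show "D' (a + b) = D' a + D' b" for a b
        unfolding D'_def p_add j_add[symmetric] by (rule arg_cong[of _ _ j]) (simp add: fun_eq_iff algebra_simps)
      show "D' (scale c a) = scale c (D' a)" for a c
        unfolding D'_def p_scale j_scale[symmetric] by (rule arg_cong[of _ _ j]) (simp add: fun_eq_iff fscale_def)
    qed
    show "Vector_Spaces.linear scale scale (n' n a)" for n a
    proof (rule lin)
      show "n' n a (b + c) = n' n a b + n' n a c" for b c
        unfolding n'_def p_add j_add[symmetric] using lcoef_add_scale(2)[of "p b" "p a" "p c" 1 n, OF pp pp pp] by (simp add: one)
      show "n' n a (scale c b) = scale c (n' n a b)" for b c
        unfolding n'_def p_scale j_scale[symmetric] using lcoef_add_scale(2)[of 0 "p a" "p b" c n, OF p0 pp pp] by (simp add: one lc0)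
    qed
    show "Vector_Spaces.linear scale scale (\<lambda>a. n' n a b)" for n b
    proof (rule lin)
      show "n' n (a + c) b = n' n a b + n' n c b" for a c
        unfolding n'_def p_add j_add[symmetric] using lcoef_add_scale(1)[of "p a" "p b" "p c" 1 n, OF pp pp pp] by (simp add: one)
      show "n' n (scale c a) b = scale c (n' n a b)" for a c
        unfolding n'_def p_scale j_scale[symmetric] using lcoef_add_scale(1)[of 0 "p b" "p a" c n, OF p0 pp pp] by (simp add: one lc0)
    qed
    show "finite {n. n' n a b \<noteq> 0}" for a b by (rule fin')
    show "lprod scale n' (D' a) b l = scale (- l) (lprod scale n' a b l)" for a b l
      unfolding lp' pD j_scale[symmetric] by (simp add: fscale_def mult.assoc)
    show "lprod scale n' a (D' b) l = D' (lprod scale n' a b l) + scale l (lprod scale n' a b l)" for a b l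
      unfolding D'_def plp lp' pD[unfolded D'_def] j_scale[symmetric] j_add[symmetric]
      by (rule arg_cong[of _ _ j]) (simp add: fun_eq_iff fscale_def plp[unfolded lp'] algebra_simps)
    show "lprod scale n' a (lprod scale n' b c m) l = lprod scale n' (lprod scale n' a b l) c (l + m)" for a b c l m
      unfolding lp'[of a "lprod scale n' b c m"] lp'[of "lprod scale n' a b l"] plp
      by (simp add: algebra_simps)
  qed
  have REL': "U3_relations scale D' n' w"
    unfolding U3_relations_def
  proof
    show "\<forall>n\<ge>3. n' n w w = 0" by (simp add: n'_def pw lcoef_vsym(1) j_0)
    have ps: "psym3 (lcoef vsym vsym n)" for n using lcoef_props[OF psym3_vsym psym3_vsym] by blast
    have "scale 2 (n' 1 w w) = D' (n' 2 w w) + scale 2 w"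
      unfolding D'_def n'_def w_def pw[unfolded w_def] pj[OF ps[of 2], unfolded lcoef_vsym(3)] j_scale[symmetric] j_add[symmetric] lcoef_vsym(2,3)
      by (rule arg_cong[of _ _ j]) (simp add: fun_eq_iff fscale_def vsym_def algebra_simps)
    then show "scale 2 (n' 1 w w) - D' (n' 2 w w) = scale 2 w" by simp
  qed
  obtain h0 where h0: "conformal_hom scale D nprod D' n' h0" "h0 v = w"
    using U3 AC' REL' unfolding is_U3_def by blast
  have h0_add: "h0 (a + b) = h0 a + h0 b" and h0_scale: "h0 (scale c a) = scale c (h0 a)" for a b c
    using h0(1) by (auto simp: conformal_hom_def Vector_Spaces.linear_iff)
  have h0D: "h0 (D a) = D' (h0 a)" and h0n: "h0 (nprod n a b) = n' n (h0 a) (h0 b)" for a b n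
    using h0(1) by (auto simp: conformal_hom_def)
  have h00: "h0 0 = 0" using h0_add[of 0 0] by simp
  have h0_sum: "h0 (\<Sum>i\<in>I. g i) = (\<Sum>i\<in>I. h0 (g i))" for g and I :: "nat set"
    by (induction I rule: infinite_finite_induct) (simp_all add: h00 h0_add)
  have h0l: "h0 (lprod scale nprod a b l) = lprod scale n' (h0 a) (h0 b) l" for a b l
    unfolding lprod_def h0_sum h0_scale h0n
  proof (rule sum.mono_neutral_right)
    show "{n. n' n (h0 a) (h0 b) \<noteq> 0} \<subseteq> {n. nprod n a b \<noteq> 0}"
      using h0n[of _ a b] h00 by auto (metis h00)
  qed (use fin in auto)
  show ?thesis
    by (rule exI[of _ "\<lambda>a. p (h0 a)"])
       (simp add: pp h0_add p_add h0_scale p_scale h0D pD h0l plp h0(2) pw)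
qed

section \<open>The structure of U(3)\<close>

lemma scalar_poly_zero:
  fixes w :: "nat \<Rightarrow> 'k::field_char_0"
  assumes "finite E" "\<And>s. s \<notin> E \<Longrightarrow> (\<Sum>j<N. w j * s ^ j) = 0" "j < N"
  shows "w j = 0"
proof -
  define p where "p = (\<Sum>j<N. monom (w j) j)"
  have "p = 0"
    using assms(1,2) by (intro poly_cofinite_eq[of E]) (simp_all add: p_def poly_sum poly_monom)
  moreover have "coeff p j = w j"
    using assms(3) by (simp add: p_def coeff_sum)
  ultimately show ?thesis by simp
qed

text \<open>Subtracting \<open>2\<^sup>k f(l)\<close> from \<open>f(2l)\<close> kills the coefficient of \<open>l\<^sup>k\<close>.\<close>

lemma (in vector_space) vector_poly_coeffs:
  assumes "finite S" "subspace W" "\<And>l. (\<Sum>n\<in>S. scale (l ^ n) (c n)) \<in> W" "n \<in> S"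
    and char: "\<And>i j. (2 :: 'a) ^ i = 2 ^ j \<Longrightarrow> i = j"
  shows "c n \<in> W"
  using assms(1,3,4)
proof (induction S arbitrary: c n rule: finite_induct)
  case empty
  then show ?case by simp
next
  case (insert k S)
  have others: "c n \<in> W" if n: "n \<in> S" for n
  proof -
    have "(\<Sum>n\<in>S. scale (l ^ n) (scale (2 ^ n - 2 ^ k) (c n))) \<in> W" for l
    proof -
      have "(\<Sum>n\<in>insert k S. scale ((2 * l) ^ n) (c n)) - scale (2 ^ k) (\<Sum>n\<in>insert k S. scale (l ^ n) (c n)) \<in> W"
        using insert.prems(1) assms(2) by (intro subspace_diff subspace_scale)
      moreover have "(\<Sum>n\<in>insert k S. scale ((2 * l) ^ n) (c n)) - scale (2 ^ k) (\<Sum>n\<in>insert k S. scale (l ^ n) (c n))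
          = (\<Sum>n\<in>insert k S. scale (l ^ n) (scale (2 ^ n - 2 ^ k) (c n)))"
        unfolding scale_sum_right sum_subtractf[symmetric]
        by (rule sum.cong) (simp_all add: power_mult_distrib algebra_simps)
      ultimately show ?thesis using insert.hyps by simp
    qed
    from insert.IH[OF this n] have "scale (inverse (2 ^ n - 2 ^ k)) (scale (2 ^ n - 2 ^ k) (c n)) \<in> W"
      by (rule subspace_scale[OF assms(2)])
    moreover have "n \<noteq> k" using n insert.hyps by auto
    then have "(2 :: 'a) ^ n - 2 ^ k \<noteq> 0" using char by auto
    then have "scale (inverse (2 ^ n - 2 ^ k)) (scale (2 ^ n - 2 ^ k) (c n)) = c n" by simp
    ultimately show ?thesis by metis
  qed
  have "(\<Sum>n\<in>insert k S. scale (1 ^ n) (c n)) \<in> W" by (rule insert.prems(1))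
  then have "c k + (\<Sum>n\<in>S. c n) \<in> W" using insert.hyps by simp
  moreover have "(\<Sum>n\<in>S. c n) \<in> W" using others assms(2) by (intro subspace_sum)
  ultimately have "c k + (\<Sum>n\<in>S. c n) - (\<Sum>n\<in>S. c n) \<in> W" using assms(2) by (intro subspace_diff)
  then have "c k \<in> W" by simp
  then show ?case using others insert.prems(2) by blast
qed

lemma two_power_inj: "(2 :: 'k::field_char_0) ^ i = 2 ^ j \<Longrightarrow> i = j"
proof -
  assume "(2 :: 'k) ^ i = 2 ^ j"
  then have "of_nat (2 ^ i) = (of_nat (2 ^ j) :: 'k)" by simp
  then have "(2::nat) ^ i = 2 ^ j" by (rule of_nat_eq_iff[THEN iffD1])
  then show "i = j" by simp
qed

locale U3_module =
  fixes scale :: "'k::field_char_0 \<Rightarrow> 'c::ab_group_add \<Rightarrow> 'c"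
    and D :: "'c \<Rightarrow> 'c" and nprod :: "nat \<Rightarrow> 'c \<Rightarrow> 'c \<Rightarrow> 'c" and v :: 'c
    and \<Delta> :: 'k
    and act :: "'c \<Rightarrow> ((nat \<Rightarrow> 'k) \<Rightarrow> 'k) \<Rightarrow> ((nat \<Rightarrow> 'k) \<Rightarrow> 'k)"
  assumes U3: "is_U3 scale D nprod v" and M: "is_M0Delta scale D nprod v \<Delta> act"
begin

abbreviation "L \<equiv> lprod scale nprod"

lemma AC: "assoc_conformal_algebra scale D nprod"
  using U3 by (simp add: is_U3_def)

sublocale vs: vector_space scale
  using AC by (simp add: assoc_conformal_algebra_def)

lemma D_add: "D (a + b) = D a + D b" and D_scale: "D (scale c a) = scale c (D a)"
  using AC by (auto simp: assoc_conformal_algebra_def Vector_Spaces.linear_iff)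

lemma nprod_add: "nprod n a (b + c) = nprod n a b + nprod n a c" "nprod n (a + b) c = nprod n a c + nprod n b c"
  and nprod_scale: "nprod n a (scale r b) = scale r (nprod n a b)" "nprod n (scale r a) b = scale r (nprod n a b)"
  using AC by (auto simp: assoc_conformal_algebra_def Vector_Spaces.linear_iff)

lemma nprod_finite: "finite {n. nprod n a b \<noteq> 0}"
  using AC by (auto simp: assoc_conformal_algebra_def)

lemma L_D: "L (D a) b l = scale (- l) (L a b l)" "L a (D b) l = D (L a b l) + scale l (L a b l)"
  and L_assoc: "L a (L b c m) l = L (L a b l) c (l + m)"
  using AC by (auto simp: assoc_conformal_algebra_def)

lemma L_eq:
  assumes "finite S" "{n. nprod n a b \<noteq> 0} \<subseteq> S"
  shows "L a b l = (\<Sum>n\<in>S. scale (l ^ n / fact n) (nprod n a b))"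
  unfolding lprod_def using assms by (intro sum.mono_neutral_left) auto

lemma L_add: "L a (b + c) l = L a b l + L a c l" "L (a + b) c l = L a c l + L b c l"
proof -
  let ?S = "{n. nprod n a b \<noteq> 0} \<union> {n. nprod n a c \<noteq> 0} \<union> {n. nprod n a (b + c) \<noteq> 0}"
  have S: "finite ?S" using nprod_finite by blast
  show "L a (b + c) l = L a b l + L a c l"
    by (subst (1 2 3) L_eq[OF S]) (auto simp: nprod_add vs.scale_right_distrib sum.distrib)
  let ?S = "{n. nprod n a c \<noteq> 0} \<union> {n. nprod n b c \<noteq> 0} \<union> {n. nprod n (a + b) c \<noteq> 0}"
  have S: "finite ?S" using nprod_finite by blast
  show "L (a + b) c l = L a c l + L b c l"
    by (subst (1 2 3) L_eq[OF S]) (auto simp: nprod_add vs.scale_right_distrib sum.distrib)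
qed

lemma L_scale: "L a (scale r b) l = scale r (L a b l)" "L (scale r a) b l = scale r (L a b l)"
proof -
  let ?S = "{n. nprod n a b \<noteq> 0} \<union> {n. nprod n a (scale r b) \<noteq> 0}"
  have S: "finite ?S" using nprod_finite by blast
  show "L a (scale r b) l = scale r (L a b l)"
    by (subst (1 2) L_eq[OF S]) (auto simp: nprod_scale vs.scale_sum_right mult.commute)
  let ?S = "{n. nprod n a b \<noteq> 0} \<union> {n. nprod n (scale r a) b \<noteq> 0}"
  have S: "finite ?S" using nprod_finite by blast
  show "L (scale r a) b l = scale r (L a b l)"
    by (subst (1 2) L_eq[OF S]) (auto simp: nprod_scale vs.scale_sum_right mult.commute)
qed

section \<open>Products with the generator v\<close>

definition X :: "'c \<Rightarrow> 'c" where "X a = nprod 0 v a"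

lemma L_at_0: "L a b 0 = nprod 0 a b"
proof -
  have "L a b 0 = (\<Sum>n\<in>insert 0 {n. nprod n a b \<noteq> 0}. scale (0 ^ n / fact n) (nprod n a b))"
    using nprod_finite by (intro L_eq) auto
  also have "\<dots> = (\<Sum>n\<in>{0}. scale (0 ^ n / fact n) (nprod n a b))"
    using nprod_finite by (intro sum.mono_neutral_right) auto
  finally show ?thesis by simp
qed

lemma L_v_0: "L v a 0 = X a"
  by (simp add: X_def L_at_0)

lemma X_add: "X (a + b) = X a + X b" and X_scale: "X (scale r a) = scale r (X a)" and X_D: "X (D a) = D (X a)"
  using L_D(2)[of v a 0] by (simp_all add: X_def nprod_add nprod_scale L_at_0)

text \<open>Its symbol is s (1 - s) by \<open>h_e0\<close>, and \<open>X\<close> is multiplication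
  by x on symbols by \<open>h_X\<close>.\<close>

definition e0 :: 'c where "e0 = scale (1 / 2) (nprod 2 v v)"

lemma L_v_v: "L v v l = X v + scale l (v + D e0) + scale (l ^ 2) e0"
proof -
  have rel: "nprod n v v = 0" if "n \<ge> 3" for n using U3 that by (auto simp: is_U3_def U3_relations_def)
  have "L v v l = (\<Sum>n\<in>{0, 1, 2}. scale (l ^ n / fact n) (nprod n v v))"
  proof (rule L_eq)
    show "{n. nprod n v v \<noteq> 0} \<subseteq> {0, 1, 2}"
    proof
      fix n assume "n \<in> {n. nprod n v v \<noteq> 0}"
      then have "\<not> n \<ge> 3" using rel by auto
      then show "n \<in> {0, 1, 2}" by auto
    qed
  qed simp
  also have "\<dots> = nprod 0 v v + (scale l (nprod 1 v v) + scale (l ^ 2 / 2) (nprod 2 v v))"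
    by (simp add: numeral_2_eq_2)
  also have "nprod 1 v v = v + D e0"
  proof -
    have "scale 2 (nprod 1 v v) - D (nprod 2 v v) = scale 2 v"
      using U3 by (auto simp: is_U3_def U3_relations_def)
    then have "scale 2 (nprod 1 v v) = scale 2 v + D (nprod 2 v v)" by (simp add: algebra_simps)
    then have "scale (1 / 2) (scale 2 (nprod 1 v v)) = scale (1 / 2) (scale 2 v + D (nprod 2 v v))" by simp
    then show ?thesis by (simp add: e0_def D_scale vs.scale_right_distrib)
  qed
  also have "scale (l ^ 2 / 2) (nprod 2 v v) = scale (l ^ 2) e0" by (simp add: e0_def)
  finally show ?thesis by (simp add: X_def)
qed

text \<open>Associativity with v \<lambda> v expanded and the derivative turned into - (l + m). The
  cases m = 0 and l = 0 give the two rules for moving \<open>X\<close> through a product.\<close>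

lemma vv_assoc:
  "L v (L v w m) l = L (X v) w (l + m) + scale l (L v w (l + m)) - scale (l * m) (L e0 w (l + m))"
proof -
  have "L v (L v w m) l = L (L v v l) w (l + m)" by (rule L_assoc)
  also have "\<dots> = L (X v) w (l + m) + scale l (L v w (l + m))
      + (scale (l * (- (l + m))) (L e0 w (l + m)) + scale (l ^ 2) (L e0 w (l + m)))"
    unfolding L_v_v by (simp add: L_add L_scale L_D vs.scale_right_distrib)
  also have "scale (l * (- (l + m))) (L e0 w (l + m)) + scale (l ^ 2) (L e0 w (l + m))
      = - scale (l * m) (L e0 w (l + m))"
    unfolding vs.scale_left_distrib[symmetric] vs.scale_minus_left[symmetric]
    by (simp add: algebra_simps power2_eq_square)
  finally show ?thesis by simp
qed

lemma L_Xv: "L (X v) w l = X (L v w l)"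
  using vv_assoc[of w l 0] L_v_0 by simp

lemma L_v_X: "L v (X w) l = X (L v w l) + scale l (L v w l)"
  using vv_assoc[of w 0 l] by (simp add: L_v_0 L_Xv)

lemma vv:
  "L v (L v w m) l = X (L v w (l + m)) + scale l (L v w (l + m)) - scale (l * m) (L e0 w (l + m))"
  unfolding vv_assoc L_Xv ..

text \<open>The symbol of e_j is s (1 - s) s^j by \<open>h_ej\<close>. Since v \<lambda> e_j turns
  out to be affine in \<lambda> with constant term X e_j, its slope is read off at \<lambda> =
  1.\<close>

fun ej :: "nat \<Rightarrow> 'c" where
  "ej 0 = e0"
| "ej (Suc j) = L v (ej j) 1 - X (ej j)"

text \<open>Comparing both sides of associativity as functions of \<open>m\<close> forces \<open>e \<^sub>\<nu> v\<close> to be affine, and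
  \<open>e \<^sub>\<nu> e\<^sub>j\<close> to be constant, in \<open>\<nu>\<close>; hence \<open>v\<^sub>(\<^sub>n\<^sub>) e = 0\<close> for \<open>n \<ge> 2\<close>.\<close>

lemma L_v_e0: "L v e0 l = X e0 + scale l (ej 1)"
proof -
  define R where "R = (\<lambda>\<nu>. L e0 v \<nu>)"
  define Q where "Q = (\<lambda>l. L v e0 l)"
  define \<beta> where "\<beta> = (\<lambda>l. X e0 + scale l e0 - Q l)"
  define \<alpha> where "\<alpha> = (\<lambda>l. X (v + D e0) + scale l (v + D e0) + scale (2 * l) (X e0 + scale l e0)
      - L v v l - D (Q l) - scale l (Q l))"
  have key: "scale l (R (l + m)) = \<alpha> l + scale m (\<beta> l)" if m: "m \<noteq> 0" for l m
  proof -
    define A where "A = v + D e0"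
    have "L v (L v v m) l = L v (X v + scale m A + scale (m ^ 2) e0) l"
      unfolding L_v_v A_def ..
    also have "\<dots> = X (L v v l) + scale l (L v v l) + scale m (L v v l + D (Q l) + scale l (Q l)) + scale (m ^ 2) (Q l)"
      by (simp add: L_add L_scale L_v_X L_D A_def Q_def)
    finally have 1: "L v (L v v m) l = X (L v v l) + scale l (L v v l) + scale m (L v v l + D (Q l) + scale l (Q l)) + scale (m ^ 2) (Q l)" .
    have 2: "L v (L v v m) l = X (L v v (l + m)) + scale l (L v v (l + m)) - scale (l * m) (R (l + m))"
      unfolding vv R_def ..
    have 3: "L v v (l + m) = L v v l + scale m (A + scale (2 * l) e0 + scale m e0)"
      unfolding L_v_v A_def[symmetric]
      by (simp add: vs.scale_left_distrib vs.scale_right_distrib power2_eq_square algebra_simps)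
    have "scale (m * l) (R (l + m)) = X (scale m (A + scale (2 * l) e0 + scale m e0))
       + scale l (scale m (A + scale (2 * l) e0 + scale m e0))
       - scale m (L v v l + D (Q l) + scale l (Q l)) - scale (m ^ 2) (Q l)"
      using 1 2 unfolding 3 X_add vs.scale_right_distrib[of l "L v v l"] by (simp add: algebra_simps)
    also have "\<dots> = scale m (\<alpha> l + scale m (\<beta> l))"
      unfolding \<alpha>_def \<beta>_def A_def[symmetric]
      by (simp add: X_add X_scale vs.scale_left_distrib vs.scale_right_distrib vs.scale_right_diff_distrib
          power2_eq_square algebra_simps)
    finally have "scale m (scale l (R (l + m))) = scale m (\<alpha> l + scale m (\<beta> l))" by simp
    then show ?thesis by (rule vs.scale_left_imp_eq[OF m])
  qed
  have Rl: "R (1 + m) = \<alpha> 1 + scale m (\<beta> 1)" if "m \<noteq> 0" for m using key[OF that, of 1] by simp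
  \<comment> \<open>At l = 1 the key identity makes R affine away from one point. Substituting this
    for general l and comparing two admissible values of m shows that \<beta> is linear, so Q is
    affine.\<close>
  have \<beta>: "\<beta> l = scale l (\<beta> 1)" for l
  proof (cases "l = 0")
    case True
    then show ?thesis by (simp add: \<beta>_def Q_def L_v_0)
  next
    case False
    obtain m m' :: 'k where mm: "m \<notin> {0, 1 - l, m'}" "m' \<notin> {0, 1 - l}"
      using ex_new_if_finite[OF infinite_UNIV_char_0, of "{0, 1 - l}"]
        ex_new_if_finite[OF infinite_UNIV_char_0, of "{0, 1 - l, _}"] by (metis finite.emptyI finite_insert)
    have a: "\<alpha> l + scale m (\<beta> l) = scale l (\<alpha> 1 + scale (l + m - 1) (\<beta> 1))" if "m \<notin> {0, 1 - l}" for m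
    proof -
      have "l + m - 1 \<noteq> 0" "1 + (l + m - 1) = l + m" using that by (auto simp: eq_diff_eq add.commute)
      then have "R (l + m) = \<alpha> 1 + scale (l + m - 1) (\<beta> 1)" using Rl[of "l + m - 1"] by simp
      then show ?thesis using key[of m l] that by simp
    qed
    have "scale (m - m') (\<beta> l) = (\<alpha> l + scale m (\<beta> l)) - (\<alpha> l + scale m' (\<beta> l))"
      by (simp add: vs.scale_left_diff_distrib)
    also have "\<dots> = scale (m - m') (scale l (\<beta> 1))"
    proof -
      have mn: "m \<notin> {0, 1 - l}" using mm by auto
      show ?thesis unfolding a[OF mn] a[OF mm(2)]
        by (simp add: vs.scale_left_diff_distrib vs.scale_right_diff_distrib vs.scale_left_distrib
            vs.scale_right_distrib algebra_simps)
    qed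
    finally have "scale (m - m') (\<beta> l) = scale (m - m') (scale l (\<beta> 1))" .
    moreover have "m - m' \<noteq> 0" using mm by simp
    ultimately show ?thesis by (metis vs.scale_left_imp_eq)
  qed
  have "Q l = X e0 + scale l (e0 - \<beta> 1)" for l
  proof -
    have "Q l = X e0 + scale l e0 - \<beta> l" by (simp add: \<beta>_def)
    then show ?thesis unfolding \<beta>[of l] by (simp add: vs.scale_right_diff_distrib)
  qed
  note Q = this
  have "ej 1 = e0 - \<beta> 1" using Q[of 1] by (simp add: Q_def)
  then show ?thesis using Q[of l] by (simp add: Q_def)
qed

lemma L_v_ej: "L v (ej j) l = X (ej j) + scale l (ej (Suc j))"
proof (induction j arbitrary: l)
  case 0
  then show ?case using L_v_e0[of l] by simp
next
  case (Suc j)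
  let ?e = "ej j" and ?f = "ej (Suc j)"
  define R where "R = (\<lambda>\<nu>. L e0 ?e \<nu>)"
  have key: "L v ?f l = X ?f + scale l ?f - scale l (R (l + m))" if m: "m \<noteq> 0" for l m
  proof -
    have 1: "L v (L v ?e m) l = X (X ?e + scale l ?f) + scale l (X ?e + scale l ?f) + scale m (L v ?f l)"
      unfolding Suc.IH[of m] by (simp add: L_add L_scale L_v_X Suc.IH del: ej.simps)
    have 2: "L v (L v ?e m) l = X (X ?e + scale (l + m) ?f) + scale l (X ?e + scale (l + m) ?f) - scale (l * m) (R (l + m))"
      using vv[of ?e m l] unfolding R_def Suc.IH[of "l + m"] .
    have "scale m (L v ?f l) = scale m (X ?f + scale l ?f - scale l (R (l + m)))"
      using 1 2 by (simp add: X_add X_scale vs.scale_left_distrib vs.scale_right_distrib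
          vs.scale_right_diff_distrib algebra_simps del: ej.simps)
    then show ?thesis by (rule vs.scale_left_imp_eq[OF m])
  qed
  \<comment> \<open>At l = 1 the left side of the key identity is free of m, so R is constant away
    from 1; below, m is chosen with l + m \<noteq> 1.\<close>
  have Rc: "R (1 + m) = R 2" if "m \<noteq> 0" for m
    using key[OF that, of 1] key[of 1 1] by (simp del: ej.simps)
  have fl: "L v ?f l = X ?f + scale l (?f - R 2)" for l
  proof -
    obtain m where m: "m \<notin> {0, 1 - l}"
      using ex_new_if_finite[OF infinite_UNIV_char_0, of "{0, 1 - l}"] by auto
    then have "R (l + m) = R 2" using Rc[of "l + m - 1"] by (simp add: algebra_simps)
    then show ?thesis using key[of m l] m by (simp add: vs.scale_right_diff_distrib del: ej.simps)
  qed
  have "ej (Suc (Suc j)) = ?f - R 2" using fl[of 1] by simp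
  then show ?case using fl[of l] by (simp only:)
qed

end

context U3_module
begin

section \<open>A spanning set of U(3) over k[\<partial>]\<close>

text \<open>The n-products are, up to factorials, the coefficients of a vector-valued polynomial
  whose values all lie in W. Thus statements about n-products can be checked on
  \<lambda>-products.\<close>

lemma nprod_in:
  assumes W: "vs.subspace W" and L: "\<And>l. L a b l \<in> W"
  shows "nprod n a b \<in> W"
proof (cases "nprod n a b = 0")
  case True
  then show ?thesis using vs.subspace_0[OF W] by simp
next
  case False
  let ?S = "{n. nprod n a b \<noteq> 0}"
  have "(\<Sum>n\<in>?S. scale (l ^ n) (scale (1 / fact n) (nprod n a b))) \<in> W" for l
    using L[of l] by (simp add: lprod_def)
  then have "scale (1 / fact n) (nprod n a b) \<in> W"
    using False two_power_inj
    by (intro vs.vector_poly_coeffs[OF nprod_finite[of a b] W, where c = "\<lambda>n. scale (1 / fact n) (nprod n a b)" and n = n]) simp_all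
  then have "scale (fact n) (scale (1 / fact n) (nprod n a b)) \<in> W" by (rule vs.subspace_scale[OF W])
  then show ?thesis by simp
qed

inductive_set Sp :: "'c set" where
  Sp_v: "(X ^^ i) v \<in> Sp"
| Sp_e: "(X ^^ i) (ej j) \<in> Sp"
| Sp_add: "a \<in> Sp \<Longrightarrow> b \<in> Sp \<Longrightarrow> a + b \<in> Sp"
| Sp_scale: "a \<in> Sp \<Longrightarrow> scale c a \<in> Sp"
| Sp_D: "a \<in> Sp \<Longrightarrow> D a \<in> Sp"

lemma Sp_subspace: "vs.subspace Sp"
  using Sp_scale[OF Sp_v[of 0], of 0] by (intro vs.subspaceI) (auto intro: Sp_add Sp_scale)

lemma Sp_X: "w \<in> Sp \<Longrightarrow> X w \<in> Sp"
proof (induction rule: Sp.induct)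
  case (Sp_v i)
  show ?case using Sp.Sp_v[of "Suc i"] by simp
next
  case (Sp_e i j)
  show ?case using Sp.Sp_e[of "Suc i"] by simp
qed (simp_all add: X_add X_scale X_D Sp.Sp_add Sp.Sp_scale Sp.Sp_D)

lemma Sp_L_v: "w \<in> Sp \<Longrightarrow> L v w l \<in> Sp"
proof (induction rule: Sp.induct)
  case (Sp_v i)
  show ?case
  proof (induction i)
    case 0
    have "v \<in> Sp" "e0 \<in> Sp" using Sp.Sp_v[of 0] Sp.Sp_e[of 0 0] by simp_all
    then show ?case by (simp add: L_v_v Sp.Sp_add Sp.Sp_scale Sp.Sp_D Sp_X)
  qed (simp add: L_v_X Sp.Sp_add Sp.Sp_scale Sp_X)
next
  case (Sp_e i j)
  show ?case
  proof (induction i)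
    case 0
    have "ej j \<in> Sp" "ej (Suc j) \<in> Sp" using Sp.Sp_e[of 0] by (metis funpow_0)+
    then show ?case by (simp add: L_v_ej Sp.Sp_add Sp.Sp_scale Sp_X del: ej.simps)
  qed (simp add: L_v_X Sp.Sp_add Sp.Sp_scale Sp_X)
qed (simp_all add: L_add L_scale L_D Sp.Sp_add Sp.Sp_scale Sp.Sp_D)

lemma L_sum: "L (\<Sum>n\<in>S. g n) w l = (\<Sum>n\<in>S. L (g n) w l)" if "finite S" for g :: "nat \<Rightarrow> 'c"
proof -
  have L0: "L 0 w l = 0" using L_add(2)[of 0 0 w l] by simp
  show ?thesis using that by (induction S rule: finite_induct) (simp_all add: L_add L0)
qed

lemma Sp_L:
  assumes "a \<in> generated scale D nprod v"
  shows "w \<in> Sp \<Longrightarrow> L a w l \<in> Sp"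
  using assms
proof (induction arbitrary: w l rule: generated.induct)
  case gen_base
  then show ?case by (rule Sp_L_v)
next
  case (gen_prod a b n)
  let ?S = "{n. nprod n a b \<noteq> 0}"
  show ?case
  proof (cases "nprod n a b = 0")
    case True
    have "L 0 w l = 0" using L_add(2)[of 0 0 w l] by simp
    then show ?thesis using True vs.subspace_0[OF Sp_subspace] by simp
  next
    case False
    have "(\<Sum>n\<in>?S. scale (m ^ n) (scale (1 / fact n) (L (nprod n a b) w l))) \<in> Sp" for m
    proof -
      \<comment> \<open>The inner parameter l - m keeps the total parameter at l while m varies, so
        the n-products of a and b appear as coefficients in m.\<close>
      have "L a (L b w (l - m)) m \<in> Sp" using gen_prod by blast
      then have "L (L a b m) w l \<in> Sp" by (simp add: L_assoc)
      then show ?thesis unfolding lprod_def[of scale nprod a b] L_sum[OF nprod_finite] by (simp add: L_scale)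
    qed
    then have "scale (1 / fact n) (L (nprod n a b) w l) \<in> Sp"
      using False two_power_inj
      by (intro vs.vector_poly_coeffs[OF nprod_finite[of a b] Sp_subspace,
            where c = "\<lambda>n. scale (1 / fact n) (L (nprod n a b) w l)" and n = n]) simp_all
    then have "scale (fact n) (scale (1 / fact n) (L (nprod n a b) w l)) \<in> Sp" by (rule Sp_scale)
    then show ?thesis by simp
  qed
qed (simp_all add: L_add L_scale L_D Sp.Sp_add Sp.Sp_scale vs.subspace_neg[OF Sp_subspace])

lemma all_generated: "a \<in> generated scale D nprod v"
  using U3 by (simp add: is_U3_def)

lemma all_Sp: "a \<in> Sp"
  using all_generated[of a]
proof induction
  case gen_base
  then show ?case using Sp_v[of 0] by simp
next
  case (gen_prod a b n)
  then show ?case using nprod_in[OF Sp_subspace] Sp_L[OF all_generated] by blast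
qed (simp_all add: Sp_add Sp_scale Sp_D)

subsection \<open>The action on the module\<close>

definition A :: "'c \<Rightarrow> (nat \<Rightarrow> 'k) \<Rightarrow> 'k" where
  "A a = act a (\<lambda>x. 1)"

lemma CM: "conformal_module_M scale D nprod act" and act_v: "act v (\<lambda>x. 1) = (\<lambda>x. x 0 + \<Delta> * x 1)"
  using M by (auto simp: is_M0Delta_def)

lemma act_props:
  assumes m: "m \<in> polyfun {0}"
  shows "act a m \<in> polyfun {0, 1}"
    "act (a + b) m = (\<lambda>x. act a m x + act b m x)"
    "act (scale c a) m = (\<lambda>x. c * act a m x)"
    "m' \<in> polyfun {0} \<Longrightarrow> act a (\<lambda>x. m x + m' x) = (\<lambda>x. act a m x + act a m' x)"
    "act a (\<lambda>x. c * m x) = (\<lambda>x. c * act a m x)"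
    "act (D a) m = (\<lambda>x. - x 1 * act a m x)"
    "act a (\<lambda>x. x 0 * m x) = (\<lambda>x. (x 0 + x 1) * act a m x)"
    "act a (\<lambda>y. act b m (y(1 := x 2))) x = act (L a b (x 1)) m (x(1 := x 1 + x 2))"
proof -
  note C = CM[unfolded conformal_module_M_def]
  show "act a m \<in> polyfun {0, 1}" by (rule C[THEN conjunct1, rule_format, OF m])
  show "act (a + b) m = (\<lambda>x. act a m x + act b m x)" by (rule C[THEN conjunct2, THEN conjunct1, rule_format, OF m])
  show "act (scale c a) m = (\<lambda>x. c * act a m x)" by (rule C[THEN conjunct2, THEN conjunct2, THEN conjunct1, rule_format, OF m])
  show "act a (\<lambda>x. m x + m' x) = (\<lambda>x. act a m x + act a m' x)" if "m' \<in> polyfun {0}"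
    by (rule C[THEN conjunct2, THEN conjunct2, THEN conjunct2, THEN conjunct1, rule_format, OF m that])
  show "act a (\<lambda>x. c * m x) = (\<lambda>x. c * act a m x)" by (rule C[THEN conjunct2, THEN conjunct2, THEN conjunct2, THEN conjunct2, THEN conjunct1, rule_format, OF m])
  show "act (D a) m = (\<lambda>x. - x 1 * act a m x)" by (rule C[THEN conjunct2, THEN conjunct2, THEN conjunct2, THEN conjunct2, THEN conjunct2, THEN conjunct1, rule_format, OF m])
  show "act a (\<lambda>x. x 0 * m x) = (\<lambda>x. (x 0 + x 1) * act a m x)" by (rule C[THEN conjunct2, THEN conjunct2, THEN conjunct2, THEN conjunct2, THEN conjunct2, THEN conjunct2, THEN conjunct1, rule_format, OF m])
  have "(\<lambda>x. act a (\<lambda>y. act b m (y(1 := x 2))) x) = (\<lambda>x. act (L a b (x 1)) m (x(1 := x 1 + x 2)))"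
    by (rule C[THEN conjunct2, THEN conjunct2, THEN conjunct2, THEN conjunct2, THEN conjunct2, THEN conjunct2, THEN conjunct2, rule_format, OF m])
  then show "act a (\<lambda>y. act b m (y(1 := x 2))) x = act (L a b (x 1)) m (x(1 := x 1 + x 2))"
    by (rule fun_cong)
qed

lemma A_add: "A (a + b) y = A a y + A b y" and A_scale: "A (scale c a) y = c * A a y"
  and A_D: "A (D a) y = - y 1 * A a y" and A_v: "A v y = y 0 + \<Delta> * y 1"
  by (simp_all only: A_def act_props(2,3,6)[OF pf_const] act_v)

lemma A_sum: "finite S \<Longrightarrow> A (\<Sum>n\<in>S. g n) y = (\<Sum>n\<in>S. A (g n) y)" for g :: "nat \<Rightarrow> 'c"
proof -
  have A0: "A 0 y = 0" using A_add[of 0 0 y] by simp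
  show "finite S \<Longrightarrow> ?thesis" by (induction S rule: finite_induct) (simp_all add: A_add A0)
qed

definition bD :: "nat \<Rightarrow> 'c" where "bD k = (D ^^ k) v"

text \<open>At this point v has the value 1 and the derivation multiplies by t, so the k-th
  derivative of v takes the value t^k.\<close>

definition pt :: "'k \<Rightarrow> nat \<Rightarrow> 'k" where
  "pt t = (\<lambda>i. if i = 0 then 1 + \<Delta> * t else - t)"

lemma A_bD: "A (bD k) (pt t) = t ^ k"
  by (induction k) (simp_all add: bD_def A_v A_D pt_def)

lemma inj_bD: "inj bD"
proof (rule injI)
  fix i j assume "bD i = bD j"
  then have "(2 :: 'k) ^ i = 2 ^ j" using A_bD[of i 2] A_bD[of j 2] by simp
  then show "i = j" by (rule two_power_inj)
qed

text \<open>The module itself separates the derivatives of v, as their values are the powers of a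
  free parameter. This is the infinite independent family that \<open>U3_symbol_hom\<close> asks
  for.\<close>

lemma independent_bD: "vs.independent (range bD)"
proof
  assume "vs.dependent (range bD)"
  then obtain t u a where t: "finite t" "t \<subseteq> range bD" "(\<Sum>a\<in>t. scale (u a) a) = 0" "a \<in> t" "u a \<noteq> 0"
    unfolding vs.dependent_explicit by blast
  define I where "I = bD -` t"
  have fI: "finite I" unfolding I_def by (rule finite_vimageI[OF t(1) inj_bD])
  have tI: "t = bD ` I" using t(2) by (auto simp: I_def)
  have s0: "(\<Sum>k\<in>I. scale (u (bD k)) (bD k)) = 0"
    using t(3) unfolding tI by (simp add: sum.reindex inj_on_subset[OF inj_bD])
  obtain N where N: "I \<subseteq> {..<N}" using fI finite_nat_iff_bounded by blast
  define w where "w = (\<lambda>k. if k \<in> I then u (bD k) else 0)"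
  have "(\<Sum>k<N. w k * s ^ k) = 0" for s
  proof -
    have "(\<Sum>k<N. w k * s ^ k) = (\<Sum>k\<in>I. w k * s ^ k)"
      using N by (intro sum.mono_neutral_right) (auto simp: w_def)
    also have "\<dots> = A (\<Sum>k\<in>I. scale (u (bD k)) (bD k)) (pt s)"
      unfolding A_sum[OF fI] A_scale A_bD by (rule sum.cong) (auto simp: w_def)
    also have "\<dots> = 0" unfolding s0 using A_scale[of 0 v] by simp
    finally show ?thesis .
  qed
  then have w0: "w k = 0" if "k < N" for k
    using scalar_poly_zero[of "{}" w N k] that by simp
  obtain k where "a = bD k" "k \<in> I" using t(4) tI by blast
  then show False using w0[of k] N t(5) by (auto simp: w_def)
qed

definition h :: "'c \<Rightarrow> 'k sym3" where
  "h = (SOME h. (\<forall>a. psym3 (h a)) \<and> (\<forall>a b. h (a + b) = h a + h b) \<and>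
    (\<forall>c a. h (scale c a) = fscale c (h a)) \<and> (\<forall>a \<nu> x s. h (D a) \<nu> x s = - \<nu> * h a \<nu> x s) \<and>
    (\<forall>a b l \<nu> x s. h (L a b l) \<nu> x s = h a l x s * h b (\<nu> - l) (x + l) s) \<and> h v = vsym)"

lemma h_psym3: "psym3 (h a)" and h_add: "h (a + b) \<nu> x s = h a \<nu> x s + h b \<nu> x s"
  and h_scale: "h (scale c a) \<nu> x s = c * h a \<nu> x s" and h_D: "h (D a) \<nu> x s = - \<nu> * h a \<nu> x s"
  and h_L: "h (L a b l) \<nu> x s = h a l x s * h b (\<nu> - l) (x + l) s" and h_v: "h v \<nu> x s = x + s * \<nu>"
  using someI_ex[OF U3_symbol_hom[OF U3 inj_bD independent_bD], folded h_def]
  by (simp_all add: fscale_def vsym_def)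

lemma h_diff: "h (a - b) \<nu> x s = h a \<nu> x s - h b \<nu> x s"
  using h_add[of "a - b" b \<nu> x s] by simp

lemma polyfun_poly_0: "(\<lambda>z. poly q (z 0)) \<in> polyfun {0}"
  by (induction q) (auto intro!: polyfun.intros)

lemma act_poly: "act a (\<lambda>z. poly q (z 0)) y = poly q (y 0 + y 1) * A a y"
proof (induction q)
  case 0
  have "act a (\<lambda>z. 0 * 1) y = 0 * act a (\<lambda>z. 1) y" unfolding act_props(5)[OF pf_const] ..
  then show ?case by simp
next
  case (pCons c q)
  have "act a (\<lambda>z. c * 1 + z 0 * poly q (z 0)) y = act a (\<lambda>z. c * 1) y + act a (\<lambda>z. z 0 * poly q (z 0)) y"
    by (subst act_props(4)) (auto intro!: polyfun.intros polyfun_poly_0)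
  also have "act a (\<lambda>z. c * 1) y = c * A a y" unfolding act_props(5)[OF pf_const] A_def ..
  also have "act a (\<lambda>z. z 0 * poly q (z 0)) y = (y 0 + y 1) * (poly q (y 0 + y 1) * A a y)"
    unfolding act_props(7)[OF polyfun_poly_0] pCons.IH ..
  finally show ?case by (simp add: algebra_simps)
qed

text \<open>The action on the generator of M is the symbol at s = \<Delta>. For a fixed point the
  equality is linear in the element, so n-products reduce to \<lambda>-products, where both sides
  compose in the same way.\<close>

lemma A_eq: "A a y = h a (y 1) (y 0) \<Delta>"
  using all_generated[of a]
proof (induction arbitrary: y)
  case (gen_prod a b n)
  define W where "W = {c. A c y = h c (y 1) (y 0) \<Delta>}"
  have A0: "A 0 y = 0" "h 0 \<nu> x s = 0" for \<nu> x s
    using A_scale[of 0 v y] h_scale[of 0 v \<nu> x s] by simp_all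
  have "vs.subspace W"
    by (rule vs.subspaceI) (simp_all add: W_def A0 A_add h_add A_scale h_scale)
  moreover have "L a b l \<in> W" for l
  proof -
    \<comment> \<open>The parameters are split as l and y 1 - l, so that their sum in the
      associativity law is y 1.\<close>
    define x where "x = (\<lambda>i :: nat. if i = 0 then y 0 else if i = 1 then l else y 1 - l :: 'k)"
    obtain q where q: "\<And>t. h b (y 1 - l) t \<Delta> = poly q t"
    proof -
      have "psym_family (\<lambda>y. h b (y 0))" using h_psym3[of b] by (simp add: psym3_def)
      from psym_family_line_x[OF this, of "\<lambda>_. y 1 - l" \<Delta>] show ?thesis using that by auto
    qed
    have "A (L a b l) y = act (L a b l) (\<lambda>x. 1) (x(1 := x 1 + x 2))"
      unfolding A_def by (rule polyfun_local[OF act_props(1)[OF pf_const]]) (auto simp: x_def)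
    also have "\<dots> = act a (\<lambda>z. A b (z(1 := x 2))) x"
      using act_props(8)[OF pf_const, of a b 1 x] by (simp add: A_def x_def)
    also have "(\<lambda>z. A b (z(1 := x 2))) = (\<lambda>z. poly q (z 0))"
      unfolding gen_prod.IH by (simp add: x_def q[unfolded One_nat_def])
    also have "act a (\<lambda>z. poly q (z 0)) x = h (L a b l) (y 1) (y 0) \<Delta>"
      unfolding act_poly gen_prod.IH h_L by (simp add: x_def q[unfolded One_nat_def])
    finally show ?thesis by (simp add: W_def)
  qed
  ultimately show ?case using nprod_in[of W a b n] by (simp add: W_def)
qed (simp_all add: A_v h_v A_add h_add A_scale h_scale A_D h_D)

lemma act_eq:
  assumes "m \<in> polyfun {0}"
  shows "act a m y = h a (y 1) (y 0) \<Delta> * m (y(0 := y 0 + y 1))"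
proof -
  obtain q where q: "\<And>t. m ((\<lambda>_. 0)(0 := t)) = poly q t" using polyfun_line_upd[OF assms] by blast
  have m: "m z = poly q (z 0)" for z
    unfolding q[symmetric] by (rule polyfun_local[OF assms]) simp
  then have "m = (\<lambda>z. poly q (z 0))" by (rule ext)
  then have "act a m y = poly q (y 0 + y 1) * A a y" by (simp only: act_poly)
  then show ?thesis by (simp add: m A_eq)
qed

subsection \<open>The kernel of evaluation of symbols\<close>

lemma h_X: "h (X a) \<nu> x s = x * h a \<nu> x s"
  using h_L[of v a 0 \<nu> x s] by (simp add: L_v_0 h_v)

lemma h_e0: "h e0 \<nu> x s = s * (1 - s)"
proof -
  \<comment> \<open>The symbol of the \<lambda>-product of v with itself, computed in two ways,
    contains that of \<open>e0\<close> with the factor l (l - \<nu>), which must not vanish.\<close>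
  obtain l :: 'k where l: "l \<notin> {0, \<nu>}"
    using ex_new_if_finite[OF infinite_UNIV_char_0, of "{0, \<nu>}"] by auto
  have "h (L v v l) \<nu> x s = x * (x + s * \<nu>) + l * ((x + s * \<nu>) - \<nu> * h e0 \<nu> x s) + l ^ 2 * h e0 \<nu> x s"
    unfolding L_v_v by (simp add: h_add h_scale h_D h_X h_v)
  moreover have "h (L v v l) \<nu> x s = (x + s * l) * (x + l + s * (\<nu> - l))"
    by (simp add: h_L h_v)
  ultimately have "l * (l - \<nu>) * h e0 \<nu> x s = (x + s * l) * (x + l + s * (\<nu> - l)) - x * (x + s * \<nu>) - l * (x + s * \<nu>)"
    by (simp add: algebra_simps power2_eq_square)
  also have "\<dots> = l * (l - \<nu>) * (s * (1 - s))" by (simp add: algebra_simps)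
  finally show ?thesis using l by auto
qed

lemma h_ej: "h (ej j) \<nu> x s = s * (1 - s) * s ^ j"
proof (induction j arbitrary: \<nu> x)
  case (Suc j)
  have "h (ej (Suc j)) \<nu> x s = (x + s * 1) * (s * (1 - s) * s ^ j) - x * (s * (1 - s) * s ^ j)"
    by (simp add: h_diff h_L h_X h_v Suc.IH)
  then show ?case by (simp add: algebra_simps)
qed (simp add: h_e0)

lemma h_Xn: "h ((X ^^ i) a) \<nu> x s = x ^ i * h a \<nu> x s"
  by (induction i) (simp_all add: h_X mult.assoc)

fun gen :: "nat + nat \<times> nat \<Rightarrow> 'c" where
  "gen (Inl i) = (X ^^ i) v"
| "gen (Inr ij) = (X ^^ fst ij) (ej (snd ij))"

text \<open>Modulo the image of D + l the derivation is the scalar - l, so coefficients in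
  k[\<partial>] become scalars.\<close>

lemma span_gen_mod_D: "\<exists>b\<in>vs.span (range gen). \<exists>c. a = b + (D c + scale l c)"
  using all_Sp[of a]
proof induction
  case (Sp_v i)
  have "(X ^^ i) v \<in> vs.span (range gen)" by (rule vs.span_base, rule range_eqI[of _ _ "Inl i"]) simp
  moreover have "D 0 = 0" using D_scale[of 0 0] by simp
  ultimately show ?case by (intro bexI[of _ "(X ^^ i) v"] exI[of _ 0]) simp_all
next
  case (Sp_e i j)
  have "(X ^^ i) (ej j) \<in> vs.span (range gen)" by (rule vs.span_base, rule range_eqI[of _ _ "Inr (i, j)"]) simp
  moreover have "D 0 = 0" using D_scale[of 0 0] by simp
  ultimately show ?case by (intro bexI[of _ "(X ^^ i) (ej j)"] exI[of _ 0]) simp_all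
next
  case (Sp_add a b)
  then obtain a' c b' d where "a' \<in> vs.span (range gen)" "a = a' + (D c + scale l c)"
    "b' \<in> vs.span (range gen)" "b = b' + (D d + scale l d)" by blast
  then show ?case
    by (intro bexI[of _ "a' + b'"] exI[of _ "c + d"])
      (simp_all add: D_add vs.scale_right_distrib vs.span_add algebra_simps)
next
  case (Sp_scale a r)
  then obtain a' c where "a' \<in> vs.span (range gen)" "a = a' + (D c + scale l c)" by blast
  then show ?case
    by (intro bexI[of _ "scale r a'"] exI[of _ "scale r c"])
      (simp_all add: D_scale vs.scale_right_distrib vs.span_scale mult.commute)
next
  case (Sp_D a)
  then obtain a' c where "a' \<in> vs.span (range gen)" "a = a' + (D c + scale l c)" by blast
  then show ?case
    by (intro bexI[of _ "scale (- l) a'"] exI[of _ "a' + D c"])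
      (simp_all add: D_add D_scale vs.scale_right_distrib vs.span_scale vs.span_neg algebra_simps)
qed

text \<open>The symbols x^i (x + s l) and x^i s (1 - s) s^j are linearly independent for every l: at
  s = 0 only the former survive, and from the latter s (1 - s) can be cancelled.\<close>

lemma span_gen_inj:
  assumes b: "b \<in> vs.span (range gen)" and 0: "\<And>x s. h b l x s = 0"
  shows "b = 0"
proof -
  obtain t r where t: "finite t" "t \<subseteq> range gen" "b = (\<Sum>a\<in>t. scale (r a) a)"
    using b unfolding vs.span_explicit by blast
  define I where "I = inv gen ` t"
  have tI: "t = gen ` I" using image_inv_into_cancel[OF refl t(2)] by (simp only: I_def)
  have iI: "inj_on gen I"
  proof (rule inj_onI)
    fix i k assume ik: "i \<in> I" "k \<in> I" "gen i = gen k"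
    then obtain a b where ab: "a \<in> t" "b \<in> t" "i = inv gen a" "k = inv gen b" by (auto simp: I_def)
    have "gen i = a" "gen k = b" using ab t(2) by (simp_all add: f_inv_into_f subset_iff)
    then show "i = k" using ab ik(3) by simp
  qed
  have fI: "finite I" unfolding I_def using t(1) by simp
  define J where "J = (\<lambda>N. {..<N} <+> ({..<N} \<times> {..<N :: nat}))"
  have "\<exists>N. I \<subseteq> J N"
    using fI
  proof induction
    case (insert k I)
    then obtain N where N: "I \<subseteq> J N" by blast
    define M where "M = Suc (max N (case k of Inl i \<Rightarrow> i | Inr ij \<Rightarrow> max (fst ij) (snd ij)))"
    have "J N \<subseteq> J M" by (auto simp: J_def M_def)
    moreover have "k \<in> J M" by (cases k) (auto simp: J_def M_def less_Suc_eq_le)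
    ultimately show ?case using N by blast
  qed simp
  then obtain N where N: "I \<subseteq> J N" by blast
  have fJ: "finite (J N)" by (simp add: J_def)
  define u where "u = (\<lambda>k. if k \<in> I then r (gen k) else 0)"
  have bu: "b = (\<Sum>k\<in>J N. scale (u k) (gen k))"
  proof -
    have "b = (\<Sum>k\<in>I. scale (r (gen k)) (gen k))"
      unfolding t(3) tI by (simp add: sum.reindex[OF iI])
    also have "\<dots> = (\<Sum>k\<in>I. scale (u k) (gen k))" by (rule sum.cong) (auto simp: u_def)
    also have "\<dots> = (\<Sum>k\<in>J N. scale (u k) (gen k))"
      using N fJ by (intro sum.mono_neutral_left) (auto simp: u_def)
    finally show ?thesis .
  qed
  have h0: "h 0 \<nu> x s = 0" for \<nu> x s using h_scale[of 0 v \<nu> x s] by simp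
  have h_sum: "h (\<Sum>k\<in>K. g k) \<nu> x s = (\<Sum>k\<in>K. h (g k) \<nu> x s)" if "finite K" for K \<nu> x s and g :: "nat + nat \<times> nat \<Rightarrow> 'c"
    using that by (induction K rule: finite_induct) (simp_all add: h0 h_add)
  have eq: "(\<Sum>i<N. u (Inl i) * (x ^ i * (x + s * l)))
      + (\<Sum>i<N. \<Sum>j<N. u (Inr (i, j)) * (x ^ i * (s * (1 - s) * s ^ j))) = 0" for x s
  proof -
    have "0 = (\<Sum>k\<in>J N. u k * h (gen k) l x s)"
      using 0[of x s] unfolding bu h_sum[OF fJ] h_scale by simp
    also have "\<dots> = (\<Sum>i<N. u (Inl i) * h (gen (Inl i)) l x s) + (\<Sum>ij\<in>{..<N} \<times> {..<N}. u (Inr ij) * h (gen (Inr ij)) l x s)"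
      unfolding J_def by (subst sum.Plus) simp_all
    also have "(\<Sum>ij\<in>{..<N} \<times> {..<N}. u (Inr ij) * h (gen (Inr ij)) l x s)
        = (\<Sum>i<N. \<Sum>j<N. u (Inr (i, j)) * (x ^ i * (s * (1 - s) * s ^ j)))"
      by (simp add: sum.cartesian_product h_Xn h_ej case_prod_unfold)
    finally show ?thesis by (simp add: h_Xn h_v)
  qed
  have u1: "u (Inl i) = 0" if "i < N" for i
  proof (rule scalar_poly_zero[of "{0}" "\<lambda>i. u (Inl i)" N, OF _ _ that])
    fix x :: 'k assume "x \<notin> {0}"
    have "x * (\<Sum>i<N. u (Inl i) * x ^ i) = 0"
      using eq[of x 0] by (simp add: sum_distrib_left mult_ac)
    then show "(\<Sum>i<N. u (Inl i) * x ^ i) = 0" using \<open>x \<notin> {0}\<close> by simp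
  qed simp
  have u2: "u (Inr (i, j)) = 0" if "i < N" "j < N" for i j
  proof (rule scalar_poly_zero[of "{s. s * (1 - s) = 0}" "\<lambda>j. u (Inr (i, j))" N, OF finite_e_roots _ that(2)])
    fix s :: 'k assume s: "s \<notin> {s. s * (1 - s) = 0}"
    show "(\<Sum>j<N. u (Inr (i, j)) * s ^ j) = 0"
    proof (rule scalar_poly_zero[of "{}" "\<lambda>i. \<Sum>j<N. u (Inr (i, j)) * s ^ j" N, OF _ _ that(1)])
      fix x :: 'k
      have "s * (1 - s) * (\<Sum>i<N. (\<Sum>j<N. u (Inr (i, j)) * s ^ j) * x ^ i) = 0"
        using eq[of x s] u1 by (simp add: sum_distrib_left sum_distrib_right mult_ac)
      then show "(\<Sum>i<N. (\<Sum>j<N. u (Inr (i, j)) * s ^ j) * x ^ i) = 0" using s by auto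
    qed simp
  qed
  have "u k = 0" if "k \<in> J N" for k using that u1 u2 by (auto simp: J_def)
  then show ?thesis unfolding bu by simp
qed

lemma h_kernel:
  assumes "\<And>x s. h a l x s = 0"
  shows "\<exists>c. a = D c + scale l c"
proof -
  obtain b c where bc: "b \<in> vs.span (range gen)" "a = b + (D c + scale l c)"
    using span_gen_mod_D by blast
  have "h b l x s = 0" for x s
    using assms[of x s] unfolding bc(2) by (simp add: h_add h_D h_scale)
  then have "b = 0" by (rule span_gen_inj[OF bc(1)])
  then show ?thesis using bc(2) by auto
qed

end

section \<open>From conformal cochains to cochains on shift operators\<close>

lemma fits_replicate_iff: "fits l (replicate m Y) \<longleftrightarrow> length l = m \<and> set l \<subseteq> Y"
proof (induction m arbitrary: l)
  case (Suc m)
  then show ?case by (cases l) auto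
qed auto

text \<open>A normal form for polynomials that separates x and s, stored in variables 0 and 1, from
  the parameters behind them.\<close>

inductive_set msums :: "((nat \<Rightarrow> 'k::field_char_0) \<Rightarrow> 'k) set" where
  ms_mono: "c \<in> polyfun UNIV \<Longrightarrow> (\<lambda>y. c (\<lambda>i. y (i + 2)) * (y 0 ^ i * y 1 ^ j)) \<in> msums"
| ms_add: "f \<in> msums \<Longrightarrow> g \<in> msums \<Longrightarrow> (\<lambda>y. f y + g y) \<in> msums"

lemma msums_mono_mult:
  assumes "g \<in> msums" "c \<in> polyfun UNIV"
  shows "(\<lambda>y. c (\<lambda>i. y (i + 2)) * (y 0 ^ i * y 1 ^ j) * g y) \<in> msums"
  using assms(1)
proof induction
  case (ms_mono d i' j')
  have "(\<lambda>y. (c (\<lambda>i. y (i + 2)) * d (\<lambda>i. y (i + 2))) * (y 0 ^ (i + i') * y 1 ^ (j + j'))) \<in> msums"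
    by (rule msums.ms_mono[of "\<lambda>y. c y * d y"]) (intro pf_mult assms(2) ms_mono)
  then show ?case by (simp add: power_add mult_ac)
next
  case (ms_add f g)
  then show ?case using msums.ms_add[OF ms_add.IH] by (simp add: distrib_left)
qed

lemma polyfun_msums: "f \<in> polyfun UNIV \<Longrightarrow> f \<in> msums"
proof (induction rule: polyfun.induct)
  case (pf_const c)
  show ?case using ms_mono[of "\<lambda>_. c" 0 0] by (simp add: polyfun.pf_const)
next
  case (pf_var i)
  consider "i = 0" | "i = 1" | "i \<ge> 2" by linarith
  then show ?case
  proof cases
    case 3
    then obtain j where "i = j + 2" by (metis le_add_diff_inverse2)
    then show ?thesis using ms_mono[of "\<lambda>y. y j" 0 0] by (simp add: polyfun_UNIV_var)
  qed (use ms_mono[of "\<lambda>_. 1" 1 0] ms_mono[of "\<lambda>_. 1" 0 1] in \<open>simp_all add: polyfun.pf_const\<close>)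
next
  case (pf_mult f g)
  from pf_mult.IH(1) show ?case
  proof induction
    case (ms_mono c i j)
    then show ?case using msums_mono_mult[OF pf_mult.IH(2)] by blast
  next
    case (ms_add f1 f2)
    then show ?case using msums.ms_add[OF ms_add.IH] by (simp add: distrib_right)
  qed
qed (rule ms_add)

lemma hS_sum:
  "length l = Suc m \<Longrightarrow> hS f l x = (\<Sum>i<m. (-1) ^ i *
     f (take i l @ [hmul (l ! i) (l ! Suc i)] @ drop (Suc (Suc i)) l) x)"
proof (induction m arbitrary: f l)
  case 0
  then obtain a where "l = [a]" by (cases l) auto
  then show ?case by simp
next
  case (Suc m)
  then obtain a b l' where l: "l = a # b # l'" "length l' = m" using Suc.prems by (auto simp: length_Suc_conv)
  define F where "F = (\<lambda>i. (-1) ^ i * f (take i l @ [hmul (l ! i) (l ! Suc i)] @ drop (Suc (Suc i)) l) x)"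
  define G where "G = (\<lambda>i. (-1) ^ i *
     f (a # take i (b # l') @ [hmul ((b # l') ! i) ((b # l') ! Suc i)] @ drop (Suc (Suc i)) (b # l')) x)"
  have "length (b # l') = Suc m" using l(2) by simp
  from Suc.IH[OF this, of "\<lambda>l. f (a # l)"] have B: "hS (\<lambda>l. f (a # l)) (b # l') x = (\<Sum>i<m. G i)"
    unfolding G_def .
  have A: "hS f l x = f (hmul a b # l') x - hS (\<lambda>l. f (a # l)) (b # l') x" unfolding l(1) by simp
  have T: "F 0 = f (hmul a b # l') x" "F (Suc i) = - G i" for i
    unfolding F_def G_def l(1) by simp_all
  have "hS f l x = (\<Sum>i<Suc m. F i)"
    unfolding sum.lessThan_Suc_shift A B T sum_negf by simp
  then show ?case unfolding F_def .
qed

text \<open>Composition adds degrees, and acting with the first argument shifts x by exactly the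
  degree it removes from the list. So x plus all degrees passes through every term: the derivation
  commutes with the differential.\<close>

lemma hcob_weight:
  "hcob \<Delta> (\<lambda>l x. (x + sum_list (map snd l)) * f l x) l x
    = (x + sum_list (map snd l)) * hcob \<Delta> f l x"
proof -
  have S: "hS (\<lambda>l x. (x + (c + sum_list (map snd l))) * f l x) l x = (x + (c + sum_list (map snd l))) * hS f l x" for c f l x
  proof (induction l arbitrary: c f rule: induct_list012)
    case (3 a b l)
    have "hS (\<lambda>l x. (x + (c + sum_list (map snd (a # l)))) * f (a # l) x) (b # l) x
      = (x + ((c + snd a) + sum_list (map snd (b # l)))) * hS (\<lambda>l. f (a # l)) (b # l) x"
      using "3.IH"(2)[of "c + snd a" "\<lambda>l. f (a # l)"] by (simp add: add.assoc)
    then show ?case by (simp add: hmul_def algebra_simps)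
  qed auto
  show ?thesis
  proof (cases l)
    case (Cons a l')
    show ?thesis using S[of 0 f "a # l'" x] by (simp add: Cons hact_def algebra_simps)
  qed simp
qed

lemma good_weight:
  assumes "good (slots m X) f"
  shows "good (slots m X) (\<lambda>l x. (x + sum_list (map snd l)) * f l x)"
  unfolding good_def
proof
  show "mlin (slots m X) (\<lambda>l x. (x + sum_list (map snd l)) * f l x)"
    unfolding mlin_def
  proof (intro allI impI)
    fix l1 l2 :: "'a hom list" and a b c x
    assume "fits (l1 @ a # l2) (slots m X)" "fits (l1 @ b # l2) (slots m X)" "snd a = snd b"
    then have "f (l1 @ hadd c a b # l2) x = f (l1 @ a # l2) x + c * f (l1 @ b # l2) x"
      using assms by (intro mlinD[of "slots m X"]) (simp_all add: good_def)
    then show "(x + sum_list (map snd (l1 @ hadd c a b # l2))) * f (l1 @ hadd c a b # l2) x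
      = (x + sum_list (map snd (l1 @ a # l2))) * f (l1 @ a # l2) x
        + c * ((x + sum_list (map snd (l1 @ b # l2))) * f (l1 @ b # l2) x)"
      using \<open>snd a = snd b\<close> by (simp add: hadd_def algebra_simps)
  qed
  show "pfam (slots m X) (\<lambda>_ l x. (x + sum_list (map snd l)) * f l x)"
    unfolding pfam_def
  proof (intro allI impI)
    fix L :: "((nat \<Rightarrow> 'a) \<Rightarrow> 'a hom) list" and \<xi> :: "(nat \<Rightarrow> 'a) \<Rightarrow> 'a"
    assume L: "\<forall>H\<in>set L. hfam H" "\<forall>y. fits (map (\<lambda>H. H y) L) (slots m X)" "\<xi> \<in> polyfun UNIV"
    have "(\<lambda>y. sum_list (map snd (map (\<lambda>H. H y) L))) \<in> polyfun UNIV"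
      using L(1) by (induction L) (auto simp: hfam_def intro: polyfun_intros)
    moreover have "(\<lambda>y. f (map (\<lambda>H. H y) L) (\<xi> y)) \<in> polyfun UNIV"
      using assms L by (intro pfamD[of "slots m X" "\<lambda>_. f"]) (auto simp: good_def)
    ultimately show "(\<lambda>y. (\<xi> y + sum_list (map snd (map (\<lambda>H. H y) L))) * f (map (\<lambda>H. H y) L) (\<xi> y)) \<in> polyfun UNIV"
      by (intro polyfun_intros L(3))
  qed
qed

context U3_module
begin

lemma h_sA: "(h a l, l) \<in> sA"
proof -
  have "psym (h a l)" by (rule psym_familyI) (intro psym3_eval[OF h_psym3] pf_const)
  moreover have "h a l 0 0 = 0 \<and> (\<forall>x. h a l x 0 * (x + l) = x * h a l x 1)"
    using all_Sp[of a]
  proof induction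
    case (Sp_add a b)
    then have p: "h a l x 0 * (x + l) = x * h a l x 1" "h b l x 0 * (x + l) = x * h b l x 1"
      and z: "h a l 0 0 = 0" "h b l 0 0 = 0" for x by blast+
    have "(h a l x 0 + h b l x 0) * (x + l) = x * (h a l x 1 + h b l x 1)" for x
      by (simp only: distrib_right p) (simp only: distrib_left)
    then show ?case using z by (simp add: h_add)
  next
    case (Sp_scale a c)
    then show ?case by (simp add: h_scale mult.assoc mult.left_commute)
  next
    case (Sp_D a)
    then show ?case by (simp add: h_D mult.assoc mult.left_commute)
  qed (simp_all add: h_Xn h_v h_ej)
  ultimately show ?thesis by (simp add: sA_def)
qed

definition rep :: "(nat \<Rightarrow> 'k) \<Rightarrow> (((nat \<Rightarrow> 'k) \<Rightarrow> 'k) \<times> 'c) list \<Rightarrow> 'k \<Rightarrow> 'k sym" where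
  "rep y r l = (\<lambda>x s. \<Sum>ca\<leftarrow>r. fst ca y * h (snd ca) l x s)"

lemma rep_append: "rep y (r @ r') l x s = rep y r l x s + rep y r' l x s"
  by (simp add: rep_def)

text \<open>An element of \<open>sA\<close> of degree l has the form (x + s l) f(x) + s (1 - s)
  g(x,s). Expanding f and g in monomials expresses a family through the fixed elements X^i v and X^i
  e_j, with coefficients polynomial in the parameters.\<close>

lemma slot_rep:
  assumes H: "hfam H" "\<And>y. H y \<in> sA"
  shows "\<exists>r. (\<forall>ca\<in>set r. fst ca \<in> polyfun UNIV) \<and> (\<forall>y. fst (H y) = rep y r (snd (H y)))"
proof -
  let ?ext = "\<lambda>(y :: nat \<Rightarrow> 'k) x s i. if i = 0 then x else if i = 1 then s else y (i - 2)"
  have ext2: "(\<lambda>i. ?ext y x s (i + 2)) = y" for y x s by simp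
  note Hf = hfamD[OF H(1)]
  define f where "f = (\<lambda>y x. divx (\<lambda>x. fst (H y) x 0) x)"
  have f: "psym_family (\<lambda>y x s. f y x)"
    unfolding f_def by (rule psym_family_zero[OF psym_family_divx[OF Hf(1)]])
  have f01: "fst (H y) x 0 = x * f y x" "fst (H y) x 1 = (x + snd (H y)) * f y x" for y x
    unfolding f_def by (rule sA_divx[OF H(2)])+
  define P where "P = (\<lambda>y x s. fst (H y) x s - (x + s * snd (H y)) * f y x)"
  have P: "psym_family P" unfolding P_def
    by (rule psym_familyI) (intro polyfun_intros psym_family_eval[OF Hf(1)] psym_family_eval[OF f] polyfun_eval[OF Hf(2)])
  define g where "g = (\<lambda>y. dive (P y))"
  have g: "psym_family g" unfolding g_def by (rule psym_family_dive[OF P])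
  have decomp: "fst (H y) x s = (x + s * snd (H y)) * f y x + s * (1 - s) * g y x s" for y x s
  proof -
    have "P y x s = s * (1 - s) * g y x s"
      unfolding g_def by (rule e_decompI[OF psym_family_at[OF P]]) (simp_all add: P_def f01)
    then show ?thesis by (simp add: P_def algebra_simps)
  qed
  have R1: "\<exists>r. (\<forall>ca\<in>set r. fst ca \<in> polyfun UNIV) \<and>
      (\<forall>y x s l. (x + s * l) * F (?ext y x 0) = rep y r l x s)" if "F \<in> msums" for F
    using that
  proof induction
    case (ms_mono c i j)
    \<comment> \<open>Here F is evaluated at s = 0; the factor 0^j keeps exactly the monomials free
      of s, as 0^0 = 1.\<close>
    have "(\<lambda>y. c y * 0 ^ j) \<in> polyfun UNIV" by (intro polyfun_intros ms_mono)
    then show ?case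
      by (intro exI[of _ "[(\<lambda>y. c y * 0 ^ j, (X ^^ i) v)]"]) (simp add: rep_def h_Xn h_v algebra_simps)
  next
    case (ms_add f g)
    then obtain r r' where "\<forall>ca\<in>set r. fst ca \<in> polyfun UNIV" "\<And>y x s l. (x + s * l) * f (?ext y x 0) = rep y r l x s"
      "\<forall>ca\<in>set r'. fst ca \<in> polyfun UNIV" "\<And>y x s l. (x + s * l) * g (?ext y x 0) = rep y r' l x s" by blast
    then show ?case
      by (intro exI[of _ "r @ r'"]) (simp add: rep_append distrib_left ball_Un)
  qed
  have R2: "\<exists>r. (\<forall>ca\<in>set r. fst ca \<in> polyfun UNIV) \<and>
      (\<forall>y x s l. s * (1 - s) * F (?ext y x s) = rep y r l x s)" if "F \<in> msums" for F
    using that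
  proof induction
    case (ms_mono c i j)
    then show ?case
      by (intro exI[of _ "[(c, (X ^^ i) (ej j))]"]) (simp add: rep_def h_Xn h_ej algebra_simps)
  next
    case (ms_add f g)
    then obtain r r' where "\<forall>ca\<in>set r. fst ca \<in> polyfun UNIV" "\<And>y x s l. s * (1 - s) * f (?ext y x s) = rep y r l x s"
      "\<forall>ca\<in>set r'. fst ca \<in> polyfun UNIV" "\<And>y x s l. s * (1 - s) * g (?ext y x s) = rep y r' l x s" by blast
    then show ?case
      by (intro exI[of _ "r @ r'"]) (simp add: rep_append distrib_left ball_Un)
  qed
  from R1[OF polyfun_msums[OF f[unfolded psym_family_def]]]
  obtain r where r: "\<forall>ca\<in>set r. fst ca \<in> polyfun UNIV" "\<And>y x s l. (x + s * l) * f y x = rep y r l x s"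
    by auto
  from R2[OF polyfun_msums[OF g[unfolded psym_family_def]]]
  obtain r' where r': "\<forall>ca\<in>set r'. fst ca \<in> polyfun UNIV" "\<And>y x s l. s * (1 - s) * g y x s = rep y r' l x s"
    by auto
  have "fst (H y) = rep y (r @ r') (snd (H y))" for y
    by (intro ext) (simp add: decomp r(2) r'(2) rep_append)
  then show ?thesis using r(1) r'(1) by (intro exI[of _ "r @ r'"]) auto
qed

definition sel :: "'k hom \<Rightarrow> 'c" where
  "sel g = (SOME a. h a (snd g) = fst g)"

lemma h_scaleF: "h (\<Sum>ca\<leftarrow>r. scale (c ca) (snd ca)) l x s = (\<Sum>ca\<leftarrow>r. c ca * h (snd ca) l x s)"
  using h_scale[of 0 v l x s] by (induction r) (simp_all add: h_add h_scale)

lemma h_sel: assumes "g \<in> sA" shows "h (sel g) (snd g) = fst g"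
proof -
  have "hfam (\<lambda>_. g)" using assms by (intro hfam_const) (simp add: sA_iff)
  then obtain r where r: "\<And>y. fst g = rep y r (snd g)" using slot_rep[of "\<lambda>_. g"] assms by blast
  have "h (\<Sum>ca\<leftarrow>r. scale (fst ca (\<lambda>_. 0)) (snd ca)) (snd g) = fst g"
    by (subst r[of "\<lambda>_. 0"]) (intro ext, simp add: rep_def h_scaleF)
  then show ?thesis unfolding sel_def by (rule someI)
qed

lemma cochainD:
  assumes "cochain scale D m \<phi>"
  shows "length as \<noteq> m \<Longrightarrow> \<phi> as = (\<lambda>x. 0)" "length as = m \<Longrightarrow> \<phi> as \<in> polyfun {0..m}"
    "length as = m \<Longrightarrow> i < m \<Longrightarrow> \<phi> (as[i := a + b]) x = \<phi> (as[i := a]) x + \<phi> (as[i := b]) x"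
    "length as = m \<Longrightarrow> i < m \<Longrightarrow> \<phi> (as[i := scale c a]) x = c * \<phi> (as[i := a]) x"
    "length as = m \<Longrightarrow> i < m \<Longrightarrow> \<phi> (as[i := D a]) x = - x (Suc i) * \<phi> (as[i := a]) x"
proof -
  note C = assms[unfolded cochain_def]
  show "length as \<noteq> m \<Longrightarrow> \<phi> as = (\<lambda>x. 0)" using C by blast
  show "length as = m \<Longrightarrow> \<phi> as \<in> polyfun {0..m}" using C by blast
  show "length as = m \<Longrightarrow> i < m \<Longrightarrow> \<phi> (as[i := a + b]) x = \<phi> (as[i := a]) x + \<phi> (as[i := b]) x"
    using C by simp
  show "length as = m \<Longrightarrow> i < m \<Longrightarrow> \<phi> (as[i := scale c a]) x = c * \<phi> (as[i := a]) x"
    using C by simp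
  assume l: "length as = m" "i < m"
  then have "\<phi> ((as[i := a])[i := D (as[i := a] ! i)]) = (\<lambda>x. - x (Suc i) * \<phi> (as[i := a]) x)"
    using C by (metis length_list_update)
  then show "\<phi> (as[i := D a]) x = - x (Suc i) * \<phi> (as[i := a]) x" using l by simp
qed

text \<open>By \<open>h_kernel\<close> two elements with the same symbol at \<lambda> differ by D c
  + \<lambda> c, and sesquilinearity makes a cochain vanish there.\<close>

lemma cochain_swap:
  assumes C: "cochain scale D m \<phi>" and l: "length as = m" "i < m"
    and e: "h a (y (Suc i)) = h b (y (Suc i))"
  shows "\<phi> (as[i := a]) y = \<phi> (as[i := b]) y"
proof -
  have "h (a - b) (y (Suc i)) x s = 0" for x s using e by (simp add: h_diff)
  then obtain c where "a - b = D c + scale (y (Suc i)) c" using h_kernel by blast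
  then have "a = b + (D c + scale (y (Suc i)) c)" by (simp add: algebra_simps)
  then show ?thesis using cochainD(3-5)[OF C l] by simp
qed

lemma cochain_cong:
  assumes C: "cochain scale D m \<phi>" and l: "length as = m" "length bs = m"
    and e: "\<And>i. i < m \<Longrightarrow> h (as ! i) (y (Suc i)) = h (bs ! i) (y (Suc i))"
  shows "\<phi> as y = \<phi> bs y"
proof -
  \<comment> \<open>The hybrid list has its leading k entries already replaced; each step swaps one
    argument.\<close>
  let ?c = "\<lambda>k. map (\<lambda>i. if i < k then bs ! i else as ! i) [0..<m]"
  have "\<phi> (?c k) y = \<phi> as y" if "k \<le> m" for k
    using that
  proof (induction k)
    case 0
    have "?c 0 = as" using l by (intro nth_equalityI) simp_all
    then show ?case by simp
  next
    case (Suc k)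
    have 1: "?c (Suc k) = (?c k)[k := bs ! k]"
      using Suc.prems by (intro nth_equalityI) (auto simp: nth_list_update)
    have 2: "?c k = (?c k)[k := as ! k]"
      using Suc.prems by (intro nth_equalityI) (auto simp: nth_list_update)
    have "\<phi> ((?c k)[k := bs ! k]) y = \<phi> ((?c k)[k := as ! k]) y"
      using Suc.prems e[of k] by (intro cochain_swap[OF C]) simp_all
    then show ?case using Suc 1 2 by simp
  qed
  moreover have "?c m = bs" using l by (intro nth_equalityI) simp_all
  ultimately show ?thesis by (metis order_refl)
qed

section \<open>Passing between conformal cochains and cochains on symbols\<close>

definition pnt :: "'k \<Rightarrow> 'k hom list \<Rightarrow> nat \<Rightarrow> 'k" where
  "pnt x l i = (case i of 0 \<Rightarrow> x | Suc j \<Rightarrow> if j < length l then snd (l ! j) else 0)"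

text \<open>Evaluates a cochain on chosen preimages of the symbols, with each formal variable set to
  the degree in its slot; \<open>tr_eq\<close> shows that the choice is immaterial.\<close>

definition tr :: "('c list \<Rightarrow> (nat \<Rightarrow> 'k) \<Rightarrow> 'k) \<Rightarrow> 'k hom list \<Rightarrow> 'k \<Rightarrow> 'k" where
  "tr \<phi> l x = \<phi> (map sel l) (pnt x l)"

lemma tr_eq:
  assumes C: "cochain scale D m \<phi>" and l: "fits l (replicate m sA)" "length as = m"
    and e: "\<And>i. i < m \<Longrightarrow> h (as ! i) (snd (l ! i)) = fst (l ! i)"
    and y: "y 0 = x" "\<And>i. i < m \<Longrightarrow> y (Suc i) = snd (l ! i)"
  shows "tr \<phi> l x = \<phi> as y"
proof -
  have len: "length l = m" using l(1) by (auto dest: list_all2_lengthD)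
  have lA: "l ! i \<in> sA" if "i < m" for i using l(1) that len unfolding fits_replicate_iff by (meson nth_mem subsetD)
  have "\<phi> (map sel l) (pnt x l) = \<phi> (map sel l) y"
    using y len by (intro polyfun_local[OF cochainD(2)[OF C]])
      (auto simp: pnt_def split: nat.splits)
  also have "\<dots> = \<phi> as y"
    using len l(2) e y h_sel[OF lA] by (intro cochain_cong[OF C]) simp_all
  finally show ?thesis by (simp add: tr_def)
qed

definition lst :: "'c list \<Rightarrow> (nat \<Rightarrow> 'k) \<Rightarrow> 'k hom list" where
  "lst as y = map (\<lambda>i. (h (as ! i) (y (Suc i)), y (Suc i))) [0..<length as]"

lemma lst_fits: "fits (lst as y) (replicate (length as) sA)"
  unfolding fits_replicate_iff by (auto simp: lst_def h_sA)

lemma lst_nth: "i < length as \<Longrightarrow> lst as y ! i = (h (as ! i) (y (Suc i)), y (Suc i))"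
  by (simp add: lst_def)

lemma tr_lst: "cochain scale D m \<phi> \<Longrightarrow> length as = m \<Longrightarrow> tr \<phi> (lst as y) (y 0) = \<phi> as y"
  using lst_fits[of as y] by (intro tr_eq[where m = m]) (simp_all add: lst_nth)

lemma lst_sel:
  assumes "fits l (replicate m sA)" shows "lst (map sel l) (pnt x l) = l"
proof (rule nth_equalityI)
  show "lst (map sel l) (pnt x l) ! i = l ! i" if "i < length (lst (map sel l) (pnt x l))" for i
  proof -
    have i: "i < length l" using that by (simp add: lst_def)
    then have "l ! i \<in> sA" using assms unfolding fits_replicate_iff by (meson nth_mem subsetD)
    from h_sel[OF this] show ?thesis using i by (simp add: lst_def pnt_def)
  qed
qed (simp add: lst_def)

lemma good_tr:
  assumes C: "cochain scale D (Suc m) \<phi>"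
  shows "good (slots m sA) (tr \<phi>)"
proof -
  have ml: "mlin (slots m sA) (tr \<phi>)"
    unfolding mlin_def slots_sA
  proof (intro allI impI)
    fix l1 l2 :: "'k hom list" and a b c x
    assume f: "fits (l1 @ a # l2) (replicate (Suc m) sA)" "fits (l1 @ b # l2) (replicate (Suc m) sA)" "snd a = snd b"
    have len: "Suc (length l1 + length l2) = Suc m" using list_all2_lengthD[OF f(1)] by simp
    have sA: "set (l1 @ a # l2) \<subseteq> sA" "set (l1 @ b # l2) \<subseteq> sA" using f unfolding fits_replicate_iff by blast+
    have nth: "(l1 @ a # l2) ! i \<in> sA" if "i < Suc m" for i
      using sA(1) that len by (metis nth_mem subsetD length_append length_Cons add_Suc_right)
    have ab: "a \<in> sA" "b \<in> sA" using sA by simp_all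
    let ?as = "map sel (l1 @ a # l2)" and ?i = "length l1" and ?y = "pnt x (l1 @ a # l2)"
    have la: "length ?as = Suc m" "?i < Suc m" using len by simp_all
    have main: "tr \<phi> (l1 @ g # l2) x = \<phi> (?as[?i := d]) ?y"
      if g: "g \<in> sA" "snd g = snd a" "h d (snd g) = fst g" for g d
    proof (rule tr_eq[OF C])
      show "fits (l1 @ g # l2) (replicate (Suc m) sA)"
        unfolding fits_replicate_iff using sA(1) g(1) len by simp
      show "h (?as[?i := d] ! i) (snd ((l1 @ g # l2) ! i)) = fst ((l1 @ g # l2) ! i)" if i: "i < Suc m" for i
      proof (cases "i = ?i")
        case True
        then show ?thesis using g(3) len by simp
      next
        case False
        then have "(l1 @ g # l2) ! i = (l1 @ a # l2) ! i" by (simp add: nth_append nth_Cons split: nat.split)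
        moreover have "?as[?i := d] ! i = sel ((l1 @ a # l2) ! i)" using False i len by (simp only: nth_list_update_neq) (simp only: nth_map length_append length_Cons)
        ultimately show ?thesis using h_sel[OF nth[OF i]] by simp
      qed
      show "?y (Suc i) = snd ((l1 @ g # l2) ! i)" if "i < Suc m" for i
        using that len g(2) by (auto simp: pnt_def nth_append nth_Cons split: nat.split)
    qed (use len in \<open>simp_all add: pnt_def\<close>)
    have hd: "h (sel a + scale c (sel b)) (snd (hadd c a b)) = fst (hadd c a b)"
      using h_sel[OF ab(1)] h_sel[OF ab(2)] f(3) by (simp add: fun_eq_iff h_add h_scale hadd_def)
    have "tr \<phi> (l1 @ hadd c a b # l2) x = \<phi> (?as[?i := sel a + scale c (sel b)]) ?y"
      using amodD(3)[OF amod_sA ab f(3)] hd by (intro main) (simp_all add: hadd_def)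
    also have "\<dots> = \<phi> (?as[?i := sel a]) ?y + c * \<phi> (?as[?i := sel b]) ?y"
      using cochainD(3,4)[OF C la] by simp
    also have "\<dots> = tr \<phi> (l1 @ a # l2) x + c * tr \<phi> (l1 @ b # l2) x"
      using main[OF ab(1) refl h_sel[OF ab(1)]] main[OF ab(2) f(3)[symmetric] h_sel[OF ab(2)]] by simp
    finally show "tr \<phi> (l1 @ hadd c a b # l2) x = tr \<phi> (l1 @ a # l2) x + c * tr \<phi> (l1 @ b # l2) x" .
  qed
  \<comment> \<open>Generalised for induction: the slots in L1 already carry a fixed element at a
    polynomial parameter, and each slot of L2 is expanded by \<open>slot_rep\<close> and moved to
    L1. With L2 empty the value is a value of \<phi> at polynomial parameters.\<close>
  have pf: "(\<lambda>y. tr \<phi> (map (\<lambda>p. (h (fst p) (snd p y), snd p y)) L1 @ map (\<lambda>H. H y) L2) (\<xi> y)) \<in> polyfun UNIV"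
    if "\<forall>p\<in>set L1. snd p \<in> polyfun UNIV" "\<forall>H\<in>set L2. hfam H \<and> (\<forall>y. H y \<in> sA)"
      "length L1 + length L2 = Suc m" "\<xi> \<in> polyfun UNIV"
    for L1 :: "('c \<times> ((nat \<Rightarrow> 'k) \<Rightarrow> 'k)) list" and L2 and \<xi> :: "(nat \<Rightarrow> 'k) \<Rightarrow> 'k"
    using that
  proof (induction L2 arbitrary: L1)
    case Nil
    let ?z = "\<lambda>y i. case i of 0 \<Rightarrow> \<xi> y | Suc j \<Rightarrow> if j < Suc m then snd (L1 ! j) y else 0"
    have e: "tr \<phi> (map (\<lambda>p. (h (fst p) (snd p y), snd p y)) L1) (\<xi> y) = \<phi> (map fst L1) (?z y)" for y
      using Nil.prems(3) by (intro tr_eq[OF C]) (auto simp: fits_replicate_iff h_sA simp del: replicate.simps)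
    have "(\<lambda>y. \<phi> (map fst L1) (?z y)) \<in> polyfun UNIV"
    proof (rule polyfun_subst[OF cochainD(2)[OF C]])
      show "length (map fst L1) = Suc m" using Nil.prems(3) by simp
      show "(\<lambda>y. ?z y i) \<in> polyfun UNIV" for i
        using Nil.prems by (cases i) (auto intro!: polyfun_if pf_const)
    qed
    then show ?case by (simp add: e)
  next
    case (Cons H L2)
    note IHout = Cons.IH and prems_out = Cons.prems
    have H: "hfam H" "\<And>y. H y \<in> sA" using Cons.prems(2) by auto
    obtain r where r: "\<forall>ca\<in>set r. fst ca \<in> polyfun UNIV" "\<And>y. fst (H y) = rep y r (snd (H y))"
      using slot_rep[OF H] by blast
    let ?l1 = "\<lambda>y. map (\<lambda>p. (h (fst p) (snd p y), snd p y)) L1" and ?l2 = "\<lambda>y. map (\<lambda>H. H y) L2"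
    have fit: "fits (?l1 y @ g # ?l2 y) (replicate (Suc m) sA)" if "g \<in> sA" for g y
    proof -
      have "set (?l1 y @ g # ?l2 y) \<subseteq> sA" using that Cons.prems(2) by (auto simp: h_sA)
      moreover have "length (?l1 y @ g # ?l2 y) = Suc m" using Cons.prems(3) by simp
      ultimately show ?thesis unfolding fits_replicate_iff by blast
    qed
    have "(\<lambda>y. tr \<phi> (?l1 y @ (rep y r (snd (H y)), snd (H y)) # ?l2 y) (\<xi> y)) \<in> polyfun UNIV
        \<and> (\<forall>y. (rep y r (snd (H y)), snd (H y)) \<in> sA)"
      using r(1)
    proof (induction r)
      case Nil
      have z: "(rep y [] (snd (H y)), snd (H y)) \<in> sA" for y
        using psym_e by (auto simp: sA_iff rep_def intro: psym_familyI pf_const)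
      have "tr \<phi> (?l1 y @ (rep y [] (snd (H y)), snd (H y)) # ?l2 y) (\<xi> y) = 0" for y
      proof -
        have "hadd 1 (rep y [] (snd (H y)), snd (H y)) (rep y [] (snd (H y)), snd (H y)) = (rep y [] (snd (H y)), snd (H y))"
          by (simp add: hadd_def rep_def)
        then show ?thesis
          using mlinD[OF ml, of "?l1 y" "(rep y [] (snd (H y)), snd (H y))" "?l2 y" "(rep y [] (snd (H y)), snd (H y))" 1 "\<xi> y"]
            fit[OF z] by (simp add: slots_sA del: replicate.simps)
      qed
      then show ?case using z by (simp add: pf_const)
    next
      case (Cons ca r)
      have IH: "(\<lambda>y. tr \<phi> (?l1 y @ (rep y r (snd (H y)), snd (H y)) # ?l2 y) (\<xi> y)) \<in> polyfun UNIV"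
        "\<And>y. (rep y r (snd (H y)), snd (H y)) \<in> sA" using Cons by auto
      have had: "(rep y (ca # r) (snd (H y)), snd (H y))
        = hadd (fst ca y) (rep y r (snd (H y)), snd (H y)) (h (snd ca) (snd (H y)), snd (H y))" for y
        by (simp add: hadd_def rep_def fun_eq_iff add.commute)
      have mem: "(rep y (ca # r) (snd (H y)), snd (H y)) \<in> sA" for y
        unfolding had using IH(2) h_sA by (intro amodD(3)[OF amod_sA]) simp_all
      have lin: "tr \<phi> (?l1 y @ (rep y (ca # r) (snd (H y)), snd (H y)) # ?l2 y) (\<xi> y)
         = tr \<phi> (?l1 y @ (rep y r (snd (H y)), snd (H y)) # ?l2 y) (\<xi> y)
          + fst ca y * tr \<phi> (?l1 y @ (h (snd ca) (snd (H y)), snd (H y)) # ?l2 y) (\<xi> y)" for y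
        unfolding had using fit[OF IH(2)] fit[OF h_sA] by (intro mlinD[OF ml]) (simp_all add: slots_sA del: replicate.simps)
      have "(\<lambda>y. tr \<phi> (map (\<lambda>p. (h (fst p) (snd p y), snd p y)) (L1 @ [(snd ca, \<lambda>y. snd (H y))]) @ ?l2 y) (\<xi> y)) \<in> polyfun UNIV"
        using prems_out hfamD(2)[OF H(1)] by (intro IHout) auto
      then have "(\<lambda>y. tr \<phi> (?l1 y @ (h (snd ca) (snd (H y)), snd (H y)) # ?l2 y) (\<xi> y)) \<in> polyfun UNIV" by simp
      then show ?case unfolding lin using IH(1) Cons.prems mem by (auto intro!: polyfun_intros)
    qed
    then show ?case by (simp add: r(2)[symmetric])
  qed
  have "pfam (slots m sA) (\<lambda>_. tr \<phi>)"
    unfolding pfam_def slots_sA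
  proof (intro allI impI)
    fix L :: "((nat \<Rightarrow> 'k) \<Rightarrow> 'k hom) list" and \<xi> :: "(nat \<Rightarrow> 'k) \<Rightarrow> 'k"
    assume L: "\<forall>H\<in>set L. hfam H" "\<forall>y. fits (map (\<lambda>H. H y) L) (replicate (Suc m) sA)" "\<xi> \<in> polyfun UNIV"
    have LA: "length L = Suc m" "\<And>y. (\<lambda>H. H y) ` set L \<subseteq> sA"
      using L(2) unfolding fits_replicate_iff by auto
    then show "(\<lambda>y. tr \<phi> (map (\<lambda>H. H y) L) (\<xi> y)) \<in> polyfun UNIV"
      using pf[of "[]" L \<xi>] L(1,3) by (simp add: image_subset_iff)
  qed
  then show ?thesis using ml by (simp add: good_def)
qed

text \<open>The differentials agree term by term: \<open>act_eq\<close> turns the module action into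
  the shift operator at s = \<Delta>, and \<open>h_L\<close> turns the \<lambda>-product into
  composition of symbols.\<close>

lemma hdiff_eq_hcob:
  assumes C: "cochain scale D (Suc m) \<phi>" and len: "length as = Suc (Suc m)"
  shows "hdiff scale nprod act (Suc m) \<phi> as y = hcob \<Delta> (tr \<phi>) (lst as y) (y 0)"
proof -
  define l where "l = lst as y"
  have ll: "length l = Suc (Suc m)" using len by (simp add: l_def lst_def)
  have ln: "l ! i = (h (as ! i) (y (Suc i)), y (Suc i))" if "i < Suc (Suc m)" for i
    using that len by (simp add: l_def lst_nth)
  have lA: "set l \<subseteq> sA" by (auto simp: l_def lst_def h_sA)
  obtain a as' where as: "as = a # as'" "length as' = Suc m" using len by (auto simp: length_Suc_conv)
  obtain g l' where l: "l = g # l'" "length l' = Suc m" using ll by (auto simp: length_Suc_conv)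
  have g: "g = (h a (y 1), y 1)" using ln[of 0] by (simp add: as l)
  have l'n: "l' ! i = (h (as' ! i) (y (Suc (Suc i))), y (Suc (Suc i)))" if "i < Suc m" for i
    using ln[of "Suc i"] that by (simp add: as l)
  have fl': "fits l' (replicate (Suc m) sA)" unfolding fits_replicate_iff using lA l by simp
  let ?m = "\<lambda>z. \<phi> as' (\<lambda>j. if j = 0 then z 0 else y (Suc j))"
  have "(\<lambda>z. \<phi> as' (\<lambda>j. if j = 0 then z 0 else y (Suc j))) \<in> polyfun {0}"
    by (rule polyfun_subst[OF cochainD(2)[OF C as(2)]]) (auto intro!: polyfun_if intro: polyfun.intros)
  from act_eq[OF this, of a y]
  have T0: "act (as ! 0) (\<lambda>z. \<phi> (tl as) (\<lambda>j. if j = 0 then z 0 else y (Suc j))) y = hact \<Delta> g (tr \<phi> l') (y 0)"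
  proof -
    have "tr \<phi> l' (y 0 + y 1) = \<phi> as' (\<lambda>j. if j = 0 then y 0 + y 1 else y (Suc j))"
      using fl' as(2) l'n by (intro tr_eq[OF C]) simp_all
    then show ?thesis
      using \<open>act a ?m y = _\<close> by (simp add: as hact_def g cong: if_cong)
  qed
  have T: "\<phi> (take i as @ [L (as ! i) (as ! Suc i) (y (Suc i))] @ drop (Suc (Suc i)) as)
         (\<lambda>j. if j < Suc i then y j else if j = Suc i then y (Suc i) + y (Suc (Suc i)) else y (Suc j))
      = tr \<phi> (take i l @ [hmul (l ! i) (l ! Suc i)] @ drop (Suc (Suc i)) l) (y 0)" if i: "i < Suc m" for i
  proof (rule tr_eq[OF C, symmetric])
    have "hmul (l ! i) (l ! Suc i) \<in> sA"
      using i ll lA nth_mem[of i l] nth_mem[of "Suc i" l] by (intro amodD(1)[OF amod_sA]) (simp_all add: subsetD)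
    then show "fits (take i l @ [hmul (l ! i) (l ! Suc i)] @ drop (Suc (Suc i)) l) (replicate (Suc m) sA)"
      unfolding fits_replicate_iff using i ll lA set_take_subset[of i l] set_drop_subset[of "Suc (Suc i)" l] by auto
    show "length (take i as @ [L (as ! i) (as ! Suc i) (y (Suc i))] @ drop (Suc (Suc i)) as) = Suc m"
      using i len by simp
    fix j assume j: "j < Suc m"
    consider "j < i" | "j = i" | "j > i" by linarith
    then have "h ((take i as @ [L (as ! i) (as ! Suc i) (y (Suc i))] @ drop (Suc (Suc i)) as) ! j)
        (snd ((take i l @ [hmul (l ! i) (l ! Suc i)] @ drop (Suc (Suc i)) l) ! j))
      = fst ((take i l @ [hmul (l ! i) (l ! Suc i)] @ drop (Suc (Suc i)) l) ! j)
      \<and> (if Suc j < Suc i then y (Suc j) else if Suc j = Suc i then y (Suc i) + y (Suc (Suc i)) else y (Suc (Suc j)))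
        = snd ((take i l @ [hmul (l ! i) (l ! Suc i)] @ drop (Suc (Suc i)) l) ! j)"
    proof cases
      case 1
      then show ?thesis using i j len ll ln[of j] by (simp add: nth_append)
    next
      case 2
      then show ?thesis using i len ll ln[of i] ln[of "Suc i"]
        by (simp add: nth_append hmul_def fun_eq_iff h_L)
    next
      case 3
      then have e: "Suc (Suc i) + (j - Suc i) = Suc j" by simp
      have "(take i as @ [L (as ! i) (as ! Suc i) (y (Suc i))] @ drop (Suc (Suc i)) as) ! j = as ! Suc j"
        "(take i l @ [hmul (l ! i) (l ! Suc i)] @ drop (Suc (Suc i)) l) ! j = l ! Suc j"
        using 3 i j len ll e by (simp_all add: nth_append nth_Cons' del: add_Suc)
      then show ?thesis using 3 j ln[of "Suc j"] by simp
    qed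
    then show "h ((take i as @ [L (as ! i) (as ! Suc i) (y (Suc i))] @ drop (Suc (Suc i)) as) ! j)
        (snd ((take i l @ [hmul (l ! i) (l ! Suc i)] @ drop (Suc (Suc i)) l) ! j))
      = fst ((take i l @ [hmul (l ! i) (l ! Suc i)] @ drop (Suc (Suc i)) l) ! j)"
      "(if Suc j < Suc i then y (Suc j) else if Suc j = Suc i then y (Suc i) + y (Suc (Suc i)) else y (Suc (Suc j)))
        = snd ((take i l @ [hmul (l ! i) (l ! Suc i)] @ drop (Suc (Suc i)) l) ! j)" by blast+
  qed simp
  have "(\<Sum>i=1..Suc m. (-1) ^ i * \<phi> (take (i - 1) as @ [L (as ! (i - 1)) (as ! i) (y i)] @ drop (Suc i) as)
         (\<lambda>j. if j < i then y j else if j = i then y i + y (Suc i) else y (Suc j)))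
     = (\<Sum>i<Suc m. (-1) ^ Suc i * tr \<phi> (take i l @ [hmul (l ! i) (l ! Suc i)] @ drop (Suc (Suc i)) l) (y 0))"
    unfolding One_nat_def sum.atLeast1_atMost_eq
    by (intro sum.cong refl arg_cong[where f = "(*) _"]) (simp only: diff_Suc_Suc minus_nat.diff_0 T lessThan_iff)
  also have "\<dots> = - hS (tr \<phi>) l (y 0)"
    unfolding hS_sum[OF ll] by (simp add: sum_negf)
  finally show ?thesis
    unfolding hdiff_def using len T0 by (simp add: l_def[symmetric] l)
qed

definition coch :: "nat \<Rightarrow> ('k hom list \<Rightarrow> 'k \<Rightarrow> 'k) \<Rightarrow> 'c list \<Rightarrow> (nat \<Rightarrow> 'k) \<Rightarrow> 'k" where
  "coch m f as y = (if length as = m then f (lst as y) (y 0) else 0)"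

lemma cochain_coch:
  assumes f: "good (slots m sA) f"
  shows "cochain scale D (Suc m) (coch (Suc m) f)"
  unfolding cochain_def
proof (intro conjI allI impI)
  show "coch (Suc m) f as = (\<lambda>x. 0)" if "length as \<noteq> Suc m" for as
    using that by (simp add: coch_def fun_eq_iff)
  show "coch (Suc m) f as \<in> polyfun {0..Suc m}" if l: "length as = Suc m" for as
  proof (rule polyfun_restrict)
    let ?L = "map (\<lambda>i y. (h (as ! i) (y (Suc i)), y (Suc i))) [0..<Suc m]"
    have e: "map (\<lambda>H. H y) ?L = lst as y" for y by (simp add: lst_def l)
    have "(\<lambda>y. f (map (\<lambda>H. H y) ?L) (y 0)) \<in> polyfun UNIV"
    proof (rule pfamD[of "slots m sA" "\<lambda>_. f"])
      show "pfam (slots m sA) (\<lambda>_. f)" using f by (simp add: good_def)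
      have "hfam (\<lambda>y. (h a (y (Suc i)), y (Suc i)))" for a i
        unfolding hfam_def fst_conv snd_conv
        by (intro conjI psym_familyI psym3_eval[OF h_psym3] polyfun_UNIV_var)
      then show "hfam H" if "H \<in> set ?L" for H using that by auto
      show "fits (map (\<lambda>H. H y) ?L) (slots m sA)" for y
        unfolding e slots_sA using lst_fits[of as y] l by simp
    qed (rule polyfun_UNIV_var)
    then show "coch (Suc m) f as \<in> polyfun UNIV" unfolding e by (simp add: coch_def[abs_def] l)
    show "coch (Suc m) f as y = coch (Suc m) f as (\<lambda>i. if i \<in> {0..Suc m} then y i else 0)" for y
    proof -
      have "lst as (\<lambda>i. if i \<in> {0..Suc m} then y i else 0) = lst as y"
        using l by (simp add: lst_def)
      then show ?thesis by (simp add: coch_def)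
    qed
  qed
  fix as :: "'c list" and i assume l: "length as = Suc m" "i < Suc m"
  have split: "lst (as[i := a]) y = take i (lst as y) @ (h a (y (Suc i)), y (Suc i)) # drop (Suc i) (lst as y)" for a y
  proof -
    have "lst (as[i := a]) y = (lst as y)[i := (h a (y (Suc i)), y (Suc i))]"
      using l by (intro nth_equalityI) (auto simp: lst_def nth_list_update simp del: upt_Suc)
    then show ?thesis using l by (simp add: upd_conv_take_nth_drop lst_def)
  qed
  have fit: "fits (take i (lst as y) @ (h a (y (Suc i)), y (Suc i)) # drop (Suc i) (lst as y)) (slots m sA)" for a y
    unfolding slots_sA split[symmetric] using lst_fits[of "as[i := a]" y] l by simp
  have lin: "coch (Suc m) f (as[i := d]) y = coch (Suc m) f (as[i := a]) y + c * coch (Suc m) f (as[i := b]) y"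
    if "\<And>x s. h d (y (Suc i)) x s = h a (y (Suc i)) x s + c * h b (y (Suc i)) x s" for a b c d y
  proof -
    have "(h d (y (Suc i)), y (Suc i)) = hadd c (h a (y (Suc i)), y (Suc i)) (h b (y (Suc i)), y (Suc i))"
      using that by (simp add: hadd_def fun_eq_iff)
    then show ?thesis
      using mlinD[OF _ fit[of y a] fit[of y b], of f c "y 0"] f l by (simp add: coch_def split good_def)
  qed
  have h0: "h 0 \<nu> x s = 0" for \<nu> x s using h_scale[of 0 v \<nu> x s] by simp
  have zero: "coch (Suc m) f (as[i := 0]) y = 0" for y
    using lin[where d = 0 and a = 0 and b = 0 and c = 1 and y = y] by (simp add: h0)
  show "coch (Suc m) f (as[i := a + b]) = (\<lambda>x. coch (Suc m) f (as[i := a]) x + coch (Suc m) f (as[i := b]) x)" for a b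
    using lin[where a = a and b = b and c = 1 and d = "a + b"] by (simp add: h_add fun_eq_iff)
  show "coch (Suc m) f (as[i := scale c a]) = (\<lambda>x. c * coch (Suc m) f (as[i := a]) x)" for a c
    using lin[where a = 0 and b = a and c = c and d = "scale c a"] by (simp add: h_scale h0 zero fun_eq_iff)
  show "coch (Suc m) f (as[i := D (as ! i)]) = (\<lambda>x. - x (Suc i) * coch (Suc m) f as x)"
  proof
    fix y
    show "coch (Suc m) f (as[i := D (as ! i)]) y = - y (Suc i) * coch (Suc m) f as y"
      \<comment> \<open>The derivation rule is an instance of homogeneity: at \<lambda>_i the symbol
        of D a is - \<lambda>_i times that of a.\<close>
      using lin[where a = 0 and b = "as ! i" and c = "- y (Suc i)" and d = "D (as ! i)" and y = y] l
      by (simp add: h_D h0 zero)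
  qed
qed

lemma tr_coch: "fits l (replicate m sA) \<Longrightarrow> tr (coch m f) l = f l"
  using lst_sel[of l m] by (auto simp: tr_def coch_def fun_eq_iff pnt_def dest: list_all2_lengthD)

lemma cdiff_coch:
  assumes "length as = m"
  shows "cdiff m (coch m f) as y = (y 0 + sum_list (map snd (lst as y))) * f (lst as y) (y 0)"
proof -
  have "sum_list (map snd (lst as y)) = (\<Sum>i<m. y (Suc i))"
    using assms by (simp add: lst_def comp_def interv_sum_list_conv_sum_set_nat atLeast0LessThan)
  also have "\<dots> = (\<Sum>i=1..m. y i)"
    by (rule sum.reindex_bij_witness[of _ "\<lambda>i. i - 1" Suc]) auto
  finally show ?thesis using assms by (simp add: cdiff_def coch_def)
qed

lemma vanishing:
  assumes \<Delta>: "\<Delta> \<noteq> 0"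
  shows "hochschild_vanishes scale D nprod act (Suc (Suc (Suc k)))"
  unfolding hochschild_vanishes_def
proof (intro allI impI, elim conjE exE)
  let ?n = "Suc (Suc (Suc k))"
  fix \<phi> \<chi> assume C: "cochain scale D ?n \<phi>" and X: "cochain scale D (Suc ?n) \<chi>"
    and d: "hdiff scale nprod act ?n \<phi> = cdiff (Suc ?n) \<chi>"
  let ?w = "\<lambda>l :: 'k hom list. sum_list (map snd l)"
  have gC: "good (slots (Suc (Suc k)) sA) (tr \<phi>)" and gX: "good (slots ?n sA) (tr \<chi>)"
    by (rule good_tr[OF C], rule good_tr[OF X])
  have trX: "hcob \<Delta> (tr \<phi>) l x = (x + ?w l) * tr \<chi> l x" if l: "fits l (slots ?n sA)" for l x
  proof -
    have l': "fits l (replicate (Suc ?n) sA)" using l by (simp only: slots_sA)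
    define as where "as = map sel l"
    have len: "length as = Suc ?n" using list_all2_lengthD[OF l'] by (simp add: as_def)
    have ls: "lst as (pnt x l) = l" unfolding as_def by (rule lst_sel[OF l'])
    have p0: "pnt x l 0 = x" by (simp add: pnt_def)
    have "hcob \<Delta> (tr \<phi>) l x = hdiff scale nprod act ?n \<phi> as (pnt x l)"
      using hdiff_eq_hcob[OF C len, of "pnt x l"] by (simp add: ls p0)
    also have "\<dots> = cdiff (Suc ?n) \<chi> as (pnt x l)" by (simp only: d)
    also have "\<dots> = cdiff (Suc ?n) (coch (Suc ?n) (tr \<chi>)) as (pnt x l)"
      using tr_lst[OF X len, of "pnt x l"] len by (simp add: cdiff_def coch_def)
    also have "\<dots> = (x + ?w l) * tr \<chi> l x" unfolding cdiff_coch[OF len] ls p0 ..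
    finally show ?thesis .
  qed
  \<comment> \<open>The weight times the coboundary of \<chi> is the coboundary of a coboundary. The
    weight vanishes for a single x only, so polynomial continuation removes it.\<close>
  have cX: "hcob \<Delta> (tr \<chi>) l x = 0" if l: "fits l (slots (Suc ?n) sA)" for l x
  proof -
    have z: "(x + ?w l) * hcob \<Delta> (tr \<chi>) l x = 0" for x
    proof -
      have "hcob \<Delta> (\<lambda>l x. (x + ?w l) * tr \<chi> l x) l x = hcob \<Delta> (hcob \<Delta> (tr \<phi>)) l x"
        using l trX by (intro hcob_cong[OF amod_sA, of ?n, THEN fun_cong]) (auto simp: fun_eq_iff)
      then show ?thesis unfolding hcob_hcob hcob_weight .
    qed
    have g: "good (slots (Suc ?n) sA) (hcob \<Delta> (tr \<chi>))" by (rule good_hcob[OF amod_sA gX])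
    have "(\<lambda>y. hcob \<Delta> (tr \<chi>) (map (\<lambda>H. H y) (map (\<lambda>a _. a) l)) (y 0)) \<in> polyfun UNIV"
    proof (rule pfamD[of "slots (Suc ?n) sA" "\<lambda>_. hcob \<Delta> (tr \<chi>)"])
      show "pfam (slots (Suc ?n) sA) (\<lambda>_. hcob \<Delta> (tr \<chi>))" using g by (simp add: good_def)
      have "set l \<subseteq> sA" using l unfolding slots_sA fits_replicate_iff by blast
      then show "hfam H" if "H \<in> set (map (\<lambda>a _. a) l)" for H
        using that psym_sA by (auto intro!: hfam_const)
      show "fits (map (\<lambda>H. H y) (map (\<lambda>a _. a) l)) (slots (Suc ?n) sA)" for y
        using l by (simp add: comp_def)
    qed (rule polyfun_UNIV_var)
    then have "(\<lambda>y. hcob \<Delta> (tr \<chi>) l (y 0)) \<in> polyfun UNIV" by (simp add: comp_def)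
    from polyfun_line_upd[OF this, of "\<lambda>_. 0" 0] obtain p where p: "\<And>t. hcob \<Delta> (tr \<chi>) l t = poly p t" by auto
    have "p = 0"
    proof (rule poly_cofinite_eq[of "{- ?w l}"])
      fix t assume "t \<notin> {- ?w l}"
      then have "t + ?w l \<noteq> 0" by (simp add: eq_neg_iff_add_eq_0)
      then show "poly p t = poly 0 t" using z[of t] p[of t] by (metis mult_eq_0_iff poly_0)
    qed simp
    then show ?thesis using p by simp
  qed
  \<comment> \<open>The cochain \<chi> has degree n + 1, so vanishing is used in that degree here
    and in degree n below.\<close>
  obtain \<omega> where \<omega>: "good (slots (Suc (Suc k)) sA) \<omega>"
    "\<And>l x. fits l (slots ?n sA) \<Longrightarrow> hcob \<Delta> \<omega> l x = tr \<chi> l x"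
    using shift_vanishing[OF \<Delta> gX cX] by blast
  define f where "f = (\<lambda>l x. tr \<phi> l x - (x + ?w l) * \<omega> l x)"
  have gf: "good (slots (Suc (Suc k)) sA) f" unfolding f_def by (intro good_diff gC good_weight \<omega>(1))
  have cf: "hcob \<Delta> f l x = 0" if "fits l (slots ?n sA)" for l x
    using trX[OF that, of x] \<omega>(2)[OF that, of x] by (simp add: f_def hcob_diff hcob_weight)
  obtain \<psi> where \<psi>: "good (slots (Suc k) sA) \<psi>"
    "\<And>l x. fits l (slots (Suc (Suc k)) sA) \<Longrightarrow> hcob \<Delta> \<psi> l x = f l x"
    using shift_vanishing[OF \<Delta> gf cf] by blast
  let ?\<psi> = "coch (Suc (Suc k)) \<psi>" and ?\<omega> = "coch ?n \<omega>"
  have c\<psi>: "cochain scale D (Suc (Suc k)) ?\<psi>" and c\<omega>: "cochain scale D ?n ?\<omega>"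
    by (rule cochain_coch[OF \<psi>(1)], rule cochain_coch[OF \<omega>(1)])
  have "\<phi> as y = hdiff scale nprod act (Suc (Suc k)) ?\<psi> as y + cdiff ?n ?\<omega> as y" for as y
  proof (cases "length as = ?n")
    case True
    have fl: "fits (lst as y) (slots (Suc (Suc k)) sA)"
      unfolding slots_sA using lst_fits[of as y] True by simp
    have "hdiff scale nprod act (Suc (Suc k)) ?\<psi> as y = hcob \<Delta> (tr ?\<psi>) (lst as y) (y 0)"
      by (rule hdiff_eq_hcob[OF c\<psi> True])
    also have "\<dots> = hcob \<Delta> \<psi> (lst as y) (y 0)"
      using fl by (intro hcob_cong[OF amod_sA, of "Suc k", THEN fun_cong] tr_coch) (simp_all only: slots_sA)
    also have "\<dots> = tr \<phi> (lst as y) (y 0) - (y 0 + ?w (lst as y)) * \<omega> (lst as y) (y 0)"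
      unfolding \<psi>(2)[OF fl] f_def ..
    finally show ?thesis unfolding tr_lst[OF C True] cdiff_coch[OF True] by simp
  next
    case False
    then show ?thesis using cochainD(1)[OF C False] by (simp add: hdiff_def cdiff_def coch_def)
  qed
  then have "\<phi> = (\<lambda>as x. hdiff scale nprod act (?n - 1) ?\<psi> as x + cdiff ?n ?\<omega> as x)"
    by (simp add: fun_eq_iff)
  moreover have "cochain scale D (?n - 1) ?\<psi>" using c\<psi> by simp
  ultimately show "\<exists>\<psi> \<chi>. cochain scale D (?n - 1) \<psi> \<and> cochain scale D ?n \<chi> \<and>
      \<phi> = (\<lambda>as x. hdiff scale nprod act (?n - 1) \<psi> as x + cdiff ?n \<chi> as x)"
    using c\<omega> by blast
qed

end

theorem theorem4p5:
  fixes scale :: "'k::field_char_0 \<Rightarrow> 'c::ab_group_add \<Rightarrow> 'c"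
    and D :: "'c \<Rightarrow> 'c" and nprod :: "nat \<Rightarrow> 'c \<Rightarrow> 'c \<Rightarrow> 'c" and v :: 'c
    and \<Delta> :: 'k
    and act :: "'c \<Rightarrow> ((nat \<Rightarrow> 'k) \<Rightarrow> 'k) \<Rightarrow> ((nat \<Rightarrow> 'k) \<Rightarrow> 'k)"
  assumes "is_U3 scale D nprod v"
    and "is_M0Delta scale D nprod v \<Delta> act"
    and "\<Delta> \<noteq> 0"
    and "n \<ge> 3"
  shows "hochschild_vanishes scale D nprod act n"
proof -
  interpret U3_module scale D nprod v \<Delta> act
    by (rule U3_module.intro) (rule assms(1,2))+
  obtain k where "n = Suc (Suc (Suc k))"
    using assms(4) by (metis add.commute add_2_eq_Suc' le_Suc_ex numeral_3_eq_3 plus_nat.simps(2))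
  then show ?thesis using vanishing[OF assms(3)] by simp
qed

end
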